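(* Let $1\le d<n$, $\mathrm{rch}_{\min}>0$, $0<f_{\min}\le f_{\max}/4$, $L\ge0$, $\tau>0$, $\alpha<1$, and $\varepsilon\le\mathrm{rch}_{\min}/(2^{34}d^2)$. Assume $2^{d+1}\sigma_d f_{\min}\mathrm{rch}_{\min}^d\le1$. Then any randomized SQ algorithm estimating $M=\mathrm{Supp}(D)$ over the fixed point model $\mathcal{D}^{n,d}_{\mathrm{rch}_{\min}}(f_{\min},f_{\max},L;0)$ with respect to $d_H$ with precision $\varepsilon$ and probability of success at least $1-\alpha$ must make at least $$q\ge\left(\frac{n}{\omega_d f_{\min}\mathrm{rch}_{\min}^d}\left(\frac{\mathrm{rch}_{\min}}{2^{21}\varepsilon}\right)^{d/2}+\log(1-\alpha)\right)\Big/\log(1+1/\tau)$$ queries to $\mathrm{STAT}(\tau)$.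
   Context: Notation: $\omega_d$ is the volume of the unit ball of $\mathbb{R}^d$ and $\sigma_d$ the $d$-dimensional volume of the unit sphere of $\mathbb{R}^{d+1}$. $\mathrm{d}(z,K)=\inf_{p\in K}\|p-z\|$. The medial axis of a closed $K\subseteq\mathbb{R}^n$ is the set of points having at least two distinct nearest points in $K$, and the reach $\mathrm{rch}_K$ is the infimum of $\mathrm{d}(z,K)$ over the medial axis. $\mathcal{M}^{n,d}_{\rho}$ is the set of compact connected $d$-dimensional $C^2$ submanifolds of $\mathbb{R}^n$ without boundary with reach $\ge\rho$. $\mathcal{D}^{n,d}_{\mathrm{rch}_{\min}}(f_{\min},f_{\max},L)$ is the set of Borel probability distributions $D$ on $\mathbb{R}^n$ with support $M\in\mathcal{M}^{n,d}_{\mathrm{rch}_{\min}}$ having a density $f$ w.r.t. the $d$-dimensional Hausdorff measure restricted to $M$ with $f_{\min}\le f\le f_{\max}$ on $M$ and $f$ $L$-Lipschitz on $M$; the fixed point model $\mathcal{D}^{n,d}_{\mathrm{rch}_{\min}}(f_{\min},f_{\max},L;0)$ consists of those with $0\in M$. $d_H(K,K')=\sup_x|\mathrm{d}(x,K)-\mathrm{d}(x,K')|$. SQ framework: a $\mathrm{STAT}(\tau)$ oracle for $D$ answers each query $r:\mathbb{R}^n\to[-1,1]$ (measurable) with an arbitrary adversarial real $a$ such that $|a-\mathbb{E}_{D}[r]|\le\tau$. A deterministic SQ algorithm chooses each query adaptively as a function of previous answers and outputs a function of all answers. A randomized SQ algorithm is a probability distribution over deterministic SQ algorithms; it estimates $\mathrm{Supp}(D)$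 over a model with precision $\varepsilon$ and probability of success $1-\alpha$ if for every $D$ in the model and every valid $\mathrm{STAT}(\tau)$ oracle for $D$, with probability at least $1-\alpha$ over the draw of the algorithm its output $\hat M$ satisfies $d_H(\mathrm{Supp}(D),\hat M)\le\varepsilon$. *)

theory Defs
  imports "HOL-Analysis.Analysis" "HOL-Probability.Probability"
begin

definition hausdorff_pre :: "nat \<Rightarrow> real \<Rightarrow> 'a::metric_space set \<Rightarrow> ennreal" where
  "hausdorff_pre d \<delta> A =
     (INF C \<in> {C :: nat \<Rightarrow> 'a set. A \<subseteq> (\<Union>i. C i) \<and> (\<forall>i. bounded (C i) \<and> diameter (C i) \<le> \<delta>)}.
        (\<Sum>i. ennreal (unit_ball_vol (real d) * (diameter (C i) / 2) ^ d)))"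

definition hausdorff_outer :: "nat \<Rightarrow> 'a::metric_space set \<Rightarrow> ennreal" where
  "hausdorff_outer d A = (SUP \<delta> \<in> {0<..}. hausdorff_pre d \<delta> A)"

definition hausdorff_measure :: "nat \<Rightarrow> 'a::metric_space measure" where
  "hausdorff_measure d = measure_of UNIV (sets borel) (hausdorff_outer d)"

definition ball_volume :: "'d::finite itself \<Rightarrow> real" where
  "ball_volume _ = measure lborel (ball (0 :: real^'d) 1)"

definition sphere_volume :: "'d::finite itself \<Rightarrow> real" where
  "sphere_volume _ = measure (hausdorff_measure CARD('d)) (sphere (0 :: (real^'d) \<times> real) 1)"

definition einfdist :: "'a::metric_space \<Rightarrow> 'a set \<Rightarrow> ereal" where
  "einfdist x K = (INF p \<in> K. ereal (dist p x))"

definition hausdorff_distance :: "'a::metric_space set \<Rightarrow> 'a set \<Rightarrow> ereal" where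
  "hausdorff_distance K K' = (SUP x. \<bar>einfdist x K - einfdist x K'\<bar>)"

definition medial_axis :: "'a::metric_space set \<Rightarrow> 'a set" where
  "medial_axis K = {z. \<exists>p\<in>K. \<exists>p'\<in>K. p \<noteq> p' \<and>
      ereal (dist p z) = einfdist z K \<and> ereal (dist p' z) = einfdist z K}"

definition reach :: "'a::metric_space set \<Rightarrow> ereal" where
  "reach K = (INF z \<in> medial_axis K. einfdist z K)"

definition C2_immersion_on :: "'a::euclidean_space set \<Rightarrow> ('a \<Rightarrow> 'b::euclidean_space) \<Rightarrow> bool" where
  "C2_immersion_on V \<phi> \<longleftrightarrow>
     (\<exists>D1 :: 'a \<Rightarrow> ('a \<Rightarrow>\<^sub>L 'b). \<exists>D2 :: 'a \<Rightarrow> ('a \<Rightarrow>\<^sub>L ('a \<Rightarrow>\<^sub>L 'b)).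
        (\<forall>x\<in>V. (\<phi> has_derivative blinfun_apply (D1 x)) (at x)) \<and>
        (\<forall>x\<in>V. (D1 has_derivative blinfun_apply (D2 x)) (at x)) \<and>
        continuous_on V D2 \<and>
        (\<forall>x\<in>V. inj (blinfun_apply (D1 x))))"

definition C2_submanifold :: "'d::finite itself \<Rightarrow> (real^'n::finite) set \<Rightarrow> bool" where
  "C2_submanifold _ M \<longleftrightarrow>
     (\<forall>p\<in>M. \<exists>U V. \<exists>\<phi> :: real^'d \<Rightarrow> real^'n. \<exists>\<psi>.
        open U \<and> p \<in> U \<and> open V \<and> C2_immersion_on V \<phi> \<and> homeomorphism V (M \<inter> U) \<phi> \<psi>)"

definition manifold_class :: "'d::finite itself \<Rightarrow> real \<Rightarrow> (real^'n::finite) set set" where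
  "manifold_class t \<rho> = {M. compact M \<and> connected M \<and> C2_submanifold t M \<and> reach M \<ge> ereal \<rho>}"

definition support :: "'a::metric_space measure \<Rightarrow> 'a set" where
  "support D = {x. \<forall>e>0. emeasure D (ball x e) > 0}"

definition fixed_point_model ::
  "'d::finite itself \<Rightarrow> real \<Rightarrow> real \<Rightarrow> real \<Rightarrow> real \<Rightarrow> (real^'n::finite) measure set" where
  "fixed_point_model t rchmin fmin fmax L =
     {D. prob_space D \<and> sets D = sets borel \<and>
        (\<exists>M f. M \<in> manifold_class t rchmin \<and> support D = M \<and>
           D = density (hausdorff_measure CARD('d)) (\<lambda>x. ennreal (f x) * indicator M x) \<and>
           (\<forall>x\<in>M. fmin \<le> f x \<and> f x \<le> fmax) \<and> L-lipschitz_on M f \<and> 0 \<in> M)}"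

definition sq_queries :: "(real^'n::finite \<Rightarrow> real) set" where
  "sq_queries = {r. r \<in> borel_measurable borel \<and> (\<forall>x. \<bar>r x\<bar> \<le> 1)}"

text \<open>A STAT(tau) oracle for D: an adversary that, given the history of queries (the last one
  being the current query), answers within tau of the expectation of the current query.\<close>
definition stat_oracle :: "real \<Rightarrow> (real^'n::finite) measure \<Rightarrow> ((real^'n \<Rightarrow> real) list \<Rightarrow> real) \<Rightarrow> bool" where
  "stat_oracle \<tau> D orc \<longleftrightarrow>
     (\<forall>hs r. r \<in> sq_queries \<longrightarrow> \<bar>orc (hs @ [r]) - integral\<^sup>L D r\<bar> \<le> \<tau>)"

fun sq_run :: "(nat \<Rightarrow> real list \<Rightarrow> 'q) \<Rightarrow> ('q list \<Rightarrow> real) \<Rightarrow> nat \<Rightarrow> 'q list \<times> real list" where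
  "sq_run Q orc 0 = ([], [])"
| "sq_run Q orc (Suc i) =
     (let (qs, as) = sq_run Q orc i; r = Q i as in (qs @ [r], as @ [orc (qs @ [r])]))"

end

theory Submission
  imports Defs
begin

text \<open>
  The base manifold is the round \<open>d\<close>-sphere of volume \<open>1/(2 fmin)\<close>; the volume hypothesis says
  exactly that its radius \<open>R\<close> is at least \<open>2 rchmin\<close>. At the points of a maximal \<open>2\<delta>\<close>-separated subset,
  \<open>\<delta> = 10 \<surd>(\<epsilon> rchmin)\<close>, the sphere is pushed by bumps of height \<open>4\<epsilon>\<close> along unit normal vectors taken
  from an exponentially large spherical code in the \<open>(n-d)\<close>-dimensional normal space. The perturbation is
  \<open>C\<^sup>2\<close>-small enough to keep the reach above \<open>rchmin\<close> and to change volumes by a factor at most 2, so the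
  uniform distributions lie in the model, while two different choices of codewords give supports more
  than \<open>2\<epsilon>\<close> apart. One net point is left unperturbed and translated to the origin. There are
  \<open>exp (c n N)\<close> such supports with \<open>N\<close> of order \<open>1/(\<omega>\<^sub>d fmin \<delta>\<^sup>d)\<close>, whereas an oracle rounding its answers
  to \<open>1 + 1/\<tau>\<close> values lets \<open>q\<close> queries distinguish at most \<open>(1 + 1/\<tau>) ^ q\<close> of them.
\<close>

section \<open>Metric outer measures\<close>

lemma ennreal_suminf_tail_le:
  fixes f :: "nat \<Rightarrow> ennreal"
  assumes "(\<Sum>i. f i) \<noteq> \<top>" "0 < e"
  obtains n where "(\<Sum>i. f (i + n)) \<le> ennreal e"
proof -
  obtain n where n: "(\<Sum>i. f i) < (\<Sum>i<n. f i) + ennreal e"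
    using SUP_approx_ennreal[OF assms(2) UNIV_not_empty suminf_eq_SUP[of f]] assms(1) by auto
  have "(\<Sum>i<n. f i) \<noteq> \<top>"
    using assms(1) sum_le_suminf[of f "{..<n}"]
    by (metis finite_lessThan summableI top_unique zero_le)
  moreover have "(\<Sum>i<n. f i) + (\<Sum>i. f (i + n)) \<le> (\<Sum>i<n. f i) + ennreal e"
    using n suminf_offset[OF summableI, of f n] by (metis add.commute less_imp_le)
  ultimately have "(\<Sum>i. f (i + n)) \<le> ennreal e"
    by (metis ennreal_add_left_cancel_le infinity_ennreal_def)
  then show ?thesis by (rule that)
qed

locale total_outer_measure =
  fixes \<mu> :: "'a set \<Rightarrow> ennreal"
  assumes outer_measure: "outer_measure_space (Pow UNIV) \<mu>"
begin

lemma empty [simp]: "\<mu> {} = 0"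
  using outer_measure by (simp add: outer_measure_space_def positive_def)

lemma mono: "A \<subseteq> B \<Longrightarrow> \<mu> A \<le> \<mu> B"
  using outer_measure by (simp add: outer_measure_space_def increasing_def)

lemma countably_subadditive: "\<mu> (\<Union>i. A i) \<le> (\<Sum>i. \<mu> (A i))"
proof -
  have "\<mu> (\<Union>i. disjointed A i) \<le> (\<Sum>i. \<mu> (disjointed A i))"
    using outer_measure disjoint_family_disjointed[of A]
    by (auto simp: outer_measure_space_def countably_subadditive_def)
  also have "\<dots> \<le> (\<Sum>i. \<mu> (A i))"
    by (intro suminf_le mono disjointed_subset) auto
  finally show ?thesis by (simp add: UN_disjointed_eq)
qed

lemma subadditive: "\<mu> (A \<union> B) \<le> \<mu> A + \<mu> B"
proof -
  have "\<mu> (A \<union> B) \<le> (\<Sum>i. \<mu> (binaryset A B i))"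
    using countably_subadditive[of "binaryset A B"] by (simp add: UN_binaryset_eq)
  also have "\<dots> = \<mu> A + \<mu> B" by (rule suminf_binaryset_eq) simp
  finally show ?thesis .
qed

lemma finite_subadditive:
  assumes "finite I"
  shows "\<mu> (\<Union>i\<in>I. A i) \<le> (\<Sum>i\<in>I. \<mu> (A i))"
  using assms
proof induction
  case (insert i I)
  then show ?case
    using subadditive[of "A i" "\<Union>i\<in>I. A i"] by (auto intro: order_trans add_left_mono)
qed simp

end

locale metric_outer_measure = total_outer_measure \<mu>
  for \<mu> :: "'a::metric_space set \<Rightarrow> ennreal" +
  assumes separated_superadditive:
    "0 < g \<Longrightarrow> (\<And>x y. x \<in> A \<Longrightarrow> y \<in> B \<Longrightarrow> g \<le> dist x y) \<Longrightarrow> \<mu> A + \<mu> B \<le> \<mu> (A \<union> B)"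
begin

lemma sum_le_of_successively_separated:
  fixes A :: "nat \<Rightarrow> 'a set"
  assumes "\<And>n. \<exists>g>0. \<forall>x\<in>(\<Union>i<n. A i). \<forall>y\<in>A n. g \<le> dist x y"
  shows "(\<Sum>i<n. \<mu> (A i)) \<le> \<mu> (\<Union>i<n. A i)"
proof (induct n)
  case (Suc n)
  obtain g where "0 < g" "\<And>x y. x \<in> (\<Union>i<n. A i) \<Longrightarrow> y \<in> A n \<Longrightarrow> g \<le> dist x y"
    using assms[of n] by blast
  then have "\<mu> (\<Union>i<n. A i) + \<mu> (A n) \<le> \<mu> ((\<Union>i<n. A i) \<union> A n)"
    by (rule separated_superadditive)
  then have "\<mu> (\<Union>i<n. A i) + \<mu> (A n) \<le> \<mu> (\<Union>i<Suc n. A i)"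
    by (simp add: lessThan_Suc Un_commute)
  moreover have "(\<Sum>i<Suc n. \<mu> (A i)) \<le> \<mu> (\<Union>i<n. A i) + \<mu> (A n)"
    using Suc by (simp add: add_right_mono)
  ultimately show ?case by (rule order_trans[rotated])
qed simp

text \<open>Two shells whose indices differ by at least two are separated, so the shells of either parity
  have total measure at most the supremum.\<close>
lemma suminf_shells_le_of_separated:
  assumes B: "incseq B"
    and gap: "\<And>n. \<exists>g>0. \<forall>x\<in>B n. \<forall>y\<in>(\<Union>i. B i) - B (Suc n). g \<le> dist x y"
  shows "(\<Sum>n. \<mu> (B (Suc n) - B n)) \<le> 2 * (SUP n. \<mu> (B n))"
proof -
  let ?s = "SUP n. \<mu> (B n)"
  define R where "R n = B (Suc n) - B n" for n
  have alternate_le: "(\<Sum>i<n. \<mu> (R (2 * i + c))) \<le> ?s" for n c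
  proof -
    have inner: "R (2*i+c) \<subseteq> B (2*n+c-1)" if "i < n" for i n
      using incseqD[OF B, of "Suc (2*i+c)" "2*n+c-1"] that by (fastforce simp: R_def)
    have "(\<Sum>i<n. \<mu> (R (2 * i + c))) \<le> \<mu> (\<Union>i<n. R (2 * i + c))"
    proof (rule sum_le_of_successively_separated)
      fix n
      obtain g where g: "0 < g"
        "\<And>x y. x \<in> B (2*n+c-1) \<Longrightarrow> y \<in> (\<Union>i. B i) - B (Suc (2*n+c-1)) \<Longrightarrow> g \<le> dist x y"
        using gap[of "2*n+c-1"] by blast
      have "g \<le> dist x y" if x: "x \<in> (\<Union>i<n. R (2*i+c))" and y: "y \<in> R (2*n+c)" for x y
      proof -
        obtain i where i: "i < n" "x \<in> R (2*i+c)" using x by blast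
        moreover from i(1) have "Suc (2*n+c-1) = 2*n+c" by simp
        ultimately show ?thesis using y inner by (intro g(2)) (auto simp: R_def)
      qed
      then show "\<exists>g>0. \<forall>x\<in>(\<Union>i<n. R (2*i+c)). \<forall>y\<in>R (2*n+c). g \<le> dist x y" using g(1) by blast
    qed
    also have "\<dots> \<le> \<mu> (B (2*n+c-1))" using inner by (intro mono) blast
    also have "\<dots> \<le> ?s" by (intro SUP_upper) auto
    finally show ?thesis .
  qed
  have "(\<Sum>i<n. \<mu> (R i)) \<le> 2 * ?s" for n
  proof -
    have "(\<Sum>i<n. \<mu> (R i)) \<le> (\<Sum>i<2*n. \<mu> (R i))" by (intro sum_mono2) auto
    also have "\<dots> = (\<Sum>i<n. \<mu> (R (2*i+0))) + (\<Sum>i<n. \<mu> (R (2*i+1)))"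
      by (induct n) (auto simp: algebra_simps)
    also have "\<dots> \<le> 2 * ?s" unfolding mult_2[of ?s] by (intro add_mono alternate_le)
    finally show ?thesis .
  qed
  then show ?thesis unfolding R_def by (intro suminf_le_const) auto
qed

lemma continuous_from_below_of_separated:
  assumes B: "incseq B"
    and gap: "\<And>n. \<exists>g>0. \<forall>x\<in>B n. \<forall>y\<in>(\<Union>i. B i) - B (Suc n). g \<le> dist x y"
  shows "\<mu> (\<Union>n. B n) = (SUP n. \<mu> (B n))"
proof (rule antisym)
  let ?s = "SUP n. \<mu> (B n)" and ?R = "\<lambda>n. B (Suc n) - B n"
  show "\<mu> (\<Union>n. B n) \<le> ?s"
  proof (rule ennreal_le_epsilon)
    fix e :: real assume "?s < top" "0 < e"
    then have "2 * ?s < top" by (simp add: ennreal_mult_less_top)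
    then have "(\<Sum>i. \<mu> (?R i)) \<noteq> \<top>"
      using suminf_shells_le_of_separated[OF assms] by (metis leD)
    then obtain n where n: "(\<Sum>i. \<mu> (?R (i + n))) \<le> ennreal e"
      using ennreal_suminf_tail_le \<open>0 < e\<close> by blast
    have "B (n + k) \<subseteq> B n \<union> (\<Union>i. ?R (i + n))" for k
      by (induct k) (auto simp: add.commute)
    then have "(\<Union>n. B n) \<subseteq> B n \<union> (\<Union>i. ?R (i + n))"
      using incseqD[OF B, of _ "n + _"] by (meson UN_least le_add2 subset_trans)
    then have "\<mu> (\<Union>n. B n) \<le> \<mu> (B n) + \<mu> (\<Union>i. ?R (i + n))"
      using mono subadditive order_trans by meson
    also have "\<dots> \<le> ?s + ennreal e"
      using countably_subadditive[of "\<lambda>i. ?R (i + n)"] n by (intro add_mono SUP_upper) auto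
    finally show "\<mu> (\<Union>n. B n) \<le> ?s + ennreal e" .
  qed
qed (auto intro!: SUP_least mono)

lemma diff_closed_eq_SUP:
  assumes F: "closed F" "F \<noteq> {}"
  shows "\<mu> (A - F) = (SUP n. \<mu> {x\<in>A. inverse (real (Suc n)) \<le> infdist x F})"
proof -
  define B where "B n = {x\<in>A. inverse (real (Suc n)) \<le> infdist x F}" for n
  have "incseq B" by (rule incseq_SucI) (auto simp: B_def elim!: order_trans[rotated])
  moreover have "\<exists>g>0. \<forall>x\<in>B n. \<forall>y\<in>(\<Union>i. B i) - B (Suc n). g \<le> dist x y" for n
  proof (intro exI[of _ "inverse (real (Suc n)) - inverse (real (Suc (Suc n)))"] conjI ballI)
    fix x y assume "x \<in> B n" "y \<in> (\<Union>i. B i) - B (Suc n)"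
    then show "inverse (real (Suc n)) - inverse (real (Suc (Suc n))) \<le> dist x y"
      using infdist_triangle[of x F y] by (auto simp: B_def)
  qed simp
  ultimately have "\<mu> (\<Union>n. B n) = (SUP n. \<mu> (B n))" by (rule continuous_from_below_of_separated)
  moreover have "\<exists>n. x \<in> B n" if "x \<in> A - F" for x
  proof -
    have "0 < infdist x F"
      using in_closed_iff_infdist_zero[OF F, of x] infdist_nonneg[of x F] that by auto
    then show ?thesis using reals_Archimedean that by (auto simp: B_def intro: less_imp_le)
  qed
  then have "(\<Union>n. B n) = A - F" by (auto simp: B_def)
  ultimately show ?thesis by (simp add: B_def)
qed

lemma closed_in_lambda_system:
  assumes F: "closed F"
  shows "F \<in> lambda_system UNIV (Pow UNIV) \<mu>"
proof -
  have "\<mu> (F \<inter> A) + \<mu> (A - F) \<le> \<mu> A" for A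
  proof (cases "F = {}")
    case False
    let ?B = "\<lambda>n. {x\<in>A. inverse (real (Suc n)) \<le> infdist x F}"
    have "\<mu> (F \<inter> A) + \<mu> (?B n) \<le> \<mu> A" for n
    proof -
      have "\<mu> (F \<inter> A) + \<mu> (?B n) \<le> \<mu> (F \<inter> A \<union> ?B n)"
      proof (rule separated_superadditive)
        fix x y assume "x \<in> F \<inter> A" "y \<in> ?B n"
        then show "inverse (real (Suc n)) \<le> dist x y"
          using infdist_le[of x F y] by (auto simp: dist_commute)
      qed simp
      also have "\<dots> \<le> \<mu> A" by (intro mono) auto
      finally show ?thesis .
    qed
    then have "(SUP n. \<mu> (F \<inter> A) + \<mu> (?B n)) \<le> \<mu> A" by (rule SUP_least)
    then show ?thesis by (simp add: diff_closed_eq_SUP[OF F False] ennreal_SUP_add_right)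
  qed simp
  moreover have "\<mu> A \<le> \<mu> (F \<inter> A) + \<mu> (A - F)" for A
    using subadditive[of "F \<inter> A" "A - F"] by (simp add: Int_Diff_Un Int_commute)
  ultimately show ?thesis
    by (auto simp: lambda_system_def Diff_eq Int_commute intro: antisym)
qed

lemma measure_space_borel: "measure_space UNIV (sets borel) \<mu>"
proof -
  interpret sigma_algebra "UNIV::'a set" "Pow UNIV" by (rule sigma_algebra_Pow)
  let ?\<Lambda> = "lambda_system UNIV (Pow UNIV) \<mu>"
  have \<Lambda>: "measure_space UNIV ?\<Lambda> \<mu>" by (rule caratheodory_lemma[OF outer_measure])
  then interpret \<Lambda>: sigma_algebra UNIV ?\<Lambda> by (simp add: measure_space_def)
  have "sets (borel :: 'a measure) \<subseteq> ?\<Lambda>"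
    using \<Lambda>.sigma_sets_subset[of "Collect closed"] closed_in_lambda_system
    by (auto simp: borel_eq_closed)
  then show ?thesis
    using measure_down[OF \<Lambda>] sets.sigma_algebra_axioms[of "borel :: 'a measure"] by simp
qed

end

section \<open>Hausdorff measure\<close>

definition diameter_weight :: "nat \<Rightarrow> 'a::metric_space set \<Rightarrow> ennreal" where
  "diameter_weight d C = ennreal (unit_ball_vol (real d) * (diameter C / 2) ^ d)"

definition fine_cover :: "real \<Rightarrow> 'a::metric_space set \<Rightarrow> (nat \<Rightarrow> 'a set) \<Rightarrow> bool" where
  "fine_cover \<delta> A C \<longleftrightarrow> A \<subseteq> (\<Union>i. C i) \<and> (\<forall>i. bounded (C i) \<and> diameter (C i) \<le> \<delta>)"

lemma hausdorff_pre_eq_INF: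
  "hausdorff_pre d \<delta> A = (INF C\<in>Collect (fine_cover \<delta> A). \<Sum>i. diameter_weight d (C i))"
  unfolding hausdorff_pre_def fine_cover_def diameter_weight_def ..

lemma diameter_weight_empty [simp]: "0 < d \<Longrightarrow> diameter_weight d {} = 0"
  by (simp add: diameter_weight_def)

lemma diameter_weight_mono:
  assumes "bounded C" "diameter C \<le> 2 * r"
  shows "diameter_weight d C \<le> ennreal (unit_ball_vol (real d) * r ^ d)"
  unfolding diameter_weight_def using assms diameter_ge_0[OF assms(1)]
  by (intro ennreal_leI mult_left_mono power_mono) auto

lemma diameter_weight_scale:
  assumes "0 \<le> c" "bounded C" "0 \<le> diameter C'" "diameter C \<le> c * diameter C'"
  shows "diameter_weight d C \<le> ennreal (c ^ d) * diameter_weight d C'"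
proof -
  have "diameter_weight d C \<le> ennreal (unit_ball_vol (real d) * (c * (diameter C' / 2)) ^ d)"
    using assms by (intro diameter_weight_mono) auto
  also have "\<dots> = ennreal (c ^ d) * diameter_weight d C'"
    using assms by (simp add: diameter_weight_def power_mult_distrib[of c] ennreal_mult'[symmetric]
        mult.left_commute del: times_divide_eq_right)
  finally show ?thesis .
qed

lemma bounded_diameter_le:
  fixes S :: "'a::metric_space set"
  assumes "0 \<le> t" "\<And>x y. x \<in> S \<Longrightarrow> y \<in> S \<Longrightarrow> dist x y \<le> t"
  shows "bounded S" "diameter S \<le> t"
proof -
  show "bounded S" using assms(2) unfolding bounded_two_points by blast
  show "diameter S \<le> t"
    using assms by (cases "S = {}") (auto simp: diameter_def intro!: cSUP_least)
qed

lemma lipschitz_image_bounded_diameter: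
  fixes f :: "'a::metric_space \<Rightarrow> 'b::metric_space"
  assumes f: "L-lipschitz_on A f" and A: "bounded A"
  shows "bounded (f ` A)" "diameter (f ` A) \<le> L * diameter A"
proof -
  have "0 \<le> L" using f by (rule lipschitz_on_nonneg)
  have "dist (f x) (f y) \<le> L * diameter A" if "x \<in> A" "y \<in> A" for x y
    using lipschitz_onD[OF f that] mult_left_mono[OF diameter_bounded_bound[OF A that] \<open>0 \<le> L\<close>] by simp
  then show "bounded (f ` A)" "diameter (f ` A) \<le> L * diameter A"
    using bounded_diameter_le[of "L * diameter A" "f ` A"] diameter_ge_0[OF A] \<open>0 \<le> L\<close> by auto
qed

lemma hausdorff_pre_le:
  "fine_cover \<delta> A C \<Longrightarrow> hausdorff_pre d \<delta> A \<le> (\<Sum>i. diameter_weight d (C i))"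
  unfolding hausdorff_pre_eq_INF by (rule INF_lower) simp

lemma hausdorff_pre_mult_greatest:
  assumes c: "0 < c" and le: "\<And>C. fine_cover \<delta> A C \<Longrightarrow> x \<le> ennreal c * (\<Sum>i. diameter_weight d (C i))"
  shows "x \<le> ennreal c * hausdorff_pre d \<delta> A"
proof -
  have inv: "ennreal (1 / c) * (ennreal c * y) = y" "ennreal c * (ennreal (1 / c) * y) = y" for y
    using c by (simp_all add: mult.assoc[symmetric] ennreal_mult'[symmetric])
  have "ennreal (1 / c) * x \<le> hausdorff_pre d \<delta> A"
    unfolding hausdorff_pre_eq_INF
  proof (rule INF_greatest)
    fix C assume "C \<in> Collect (fine_cover \<delta> A)"
    then have "ennreal (1 / c) * x \<le> ennreal (1 / c) * (ennreal c * (\<Sum>i. diameter_weight d (C i)))"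
      by (intro mult_left_mono le) auto
    then show "ennreal (1 / c) * x \<le> (\<Sum>i. diameter_weight d (C i))" by (simp only: inv)
  qed
  then have "ennreal c * (ennreal (1 / c) * x) \<le> ennreal c * hausdorff_pre d \<delta> A"
    by (rule mult_left_mono) simp
  then show ?thesis by (simp only: inv)
qed

lemma hausdorff_pre_near_cover:
  assumes "hausdorff_pre d \<delta> A < top" "0 < e"
  obtains C where "fine_cover \<delta> A C" "(\<Sum>i. diameter_weight d (C i)) \<le> hausdorff_pre d \<delta> A + ennreal e"
proof -
  obtain C where "C \<in> Collect (fine_cover \<delta> A)"
    "(\<Sum>i. diameter_weight d (C i)) < hausdorff_pre d \<delta> A + ennreal e"
    using INF_approx_ennreal[OF assms(2) hausdorff_pre_eq_INF[of d \<delta> A]] assms(1)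
    by (auto simp: less_top)
  then show ?thesis using that by (auto intro: less_imp_le)
qed

lemma hausdorff_pre_mono: "A \<subseteq> B \<Longrightarrow> hausdorff_pre d \<delta> A \<le> hausdorff_pre d \<delta> B"
  unfolding hausdorff_pre_eq_INF by (intro INF_superset_mono) (force simp: fine_cover_def)+

lemma hausdorff_pre_antimono: "\<delta> \<le> \<delta>' \<Longrightarrow> hausdorff_pre d \<delta>' A \<le> hausdorff_pre d \<delta> A"
  unfolding hausdorff_pre_eq_INF
  by (intro INF_superset_mono) (auto simp: fine_cover_def, meson order_trans)

lemma hausdorff_pre_empty: "0 < d \<Longrightarrow> 0 \<le> \<delta> \<Longrightarrow> hausdorff_pre d \<delta> {} = 0"
  using hausdorff_pre_le[of \<delta> "{}" "\<lambda>_. {}" d] by (simp add: fine_cover_def)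

lemma fine_cover_Union:
  assumes "\<And>n. fine_cover \<delta> (A n) (C n)"
  shows "fine_cover \<delta> (\<Union>n. A n) (\<lambda>k. case prod_decode k of (n, i) \<Rightarrow> C n i)"
proof -
  have "x \<in> (\<Union>k. case prod_decode k of (n, i) \<Rightarrow> C n i)" if "x \<in> A n" for x n
  proof -
    have "A n \<subseteq> (\<Union>i. C n i)" using assms by (simp add: fine_cover_def)
    then obtain i where "x \<in> C n i" using \<open>x \<in> A n\<close> by blast
    then show ?thesis by (auto intro!: exI[of _ "prod_encode (n, i)"])
  qed
  then show ?thesis using assms by (auto simp: fine_cover_def split: prod.split)
qed

lemma hausdorff_pre_countably_subadditive:
  "hausdorff_pre d \<delta> (\<Union>n. A n) \<le> (\<Sum>n. hausdorff_pre d \<delta> (A n))"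
proof (rule ennreal_le_epsilon)
  fix e :: real
  assume fin: "(\<Sum>n. hausdorff_pre d \<delta> (A n)) < top" and e: "0 < e"
  have "\<exists>C. fine_cover \<delta> (A n) C \<and>
     (\<Sum>i. diameter_weight d (C i)) \<le> hausdorff_pre d \<delta> (A n) + ennreal (e * (1/2)^Suc n)" for n
  proof (rule hausdorff_pre_near_cover)
    show "hausdorff_pre d \<delta> (A n) < top" using fin by (rule ennreal_suminf_lessD)
    show "0 < e * (1/2)^Suc n" using e by simp
  qed blast
  then obtain C where C: "\<And>n. fine_cover \<delta> (A n) (C n)"
     "\<And>n. (\<Sum>i. diameter_weight d (C n i)) \<le> hausdorff_pre d \<delta> (A n) + ennreal (e * (1/2)^Suc n)"
    by metis
  have "hausdorff_pre d \<delta> (\<Union>n. A n) \<le> (\<Sum>k. case prod_decode k of (n, i) \<Rightarrow> diameter_weight d (C n i))"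
    using hausdorff_pre_le[OF fine_cover_Union[OF C(1)], of d] by (simp add: case_prod_unfold)
  also have "\<dots> = (\<Sum>n i. diameter_weight d (C n i))"
    using suminf_ennreal_2dimen[of "\<lambda>n. \<Sum>i. diameter_weight d (C n i)"
      "\<lambda>(n,i). diameter_weight d (C n i)"]
    by simp
  also have "\<dots> \<le> (\<Sum>n. hausdorff_pre d \<delta> (A n) + ennreal (e * (1/2)^Suc n))"
    by (intro suminf_le C) auto
  also have "\<dots> = (\<Sum>n. hausdorff_pre d \<delta> (A n)) + (\<Sum>n. ennreal (e * (1/2)^Suc n))"
    by (intro suminf_add[symmetric]) auto
  also have "(\<Sum>n. ennreal (e * (1/2)^Suc n)) = ennreal e"
    using sums_mult[OF power_half_series, of e] e by (intro suminf_ennreal_eq) auto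
  finally show "hausdorff_pre d \<delta> (\<Union>n. A n) \<le> (\<Sum>n. hausdorff_pre d \<delta> (A n)) + ennreal e" .
qed

lemma total_outer_measure_hausdorff_pre:
  assumes "0 < d" "0 \<le> \<delta>"
  shows "total_outer_measure (hausdorff_pre d \<delta>)"
  using assms hausdorff_pre_empty hausdorff_pre_mono hausdorff_pre_countably_subadditive
  by unfold_locales
    (auto simp: outer_measure_space_def positive_def increasing_def countably_subadditive_def)

lemma hausdorff_pre_le_diameter_weight:
  assumes "0 < d" "0 \<le> \<delta>" "bounded C" "diameter C \<le> \<delta>"
  shows "hausdorff_pre d \<delta> C \<le> diameter_weight d C"
proof -
  have "fine_cover \<delta> C (\<lambda>i. if i = 0 then C else {})"
    using assms by (auto simp: fine_cover_def)
  then have "hausdorff_pre d \<delta> C \<le> (\<Sum>i. diameter_weight d (if i = 0 then C else {}))"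
    by (rule hausdorff_pre_le)
  also have "\<dots> = (\<Sum>i\<in>{0::nat}. diameter_weight d (if i = 0 then C else {}))"
    using assms(1) by (intro suminf_finite) auto
  finally show ?thesis by simp
qed

lemma hausdorff_pre_separated:
  fixes A B :: "'a::metric_space set"
  assumes d: "0 < d" and \<delta>: "0 \<le> \<delta>" "\<delta> < g" and sep: "\<And>x y. x \<in> A \<Longrightarrow> y \<in> B \<Longrightarrow> g \<le> dist x y"
  shows "hausdorff_pre d \<delta> A + hausdorff_pre d \<delta> B \<le> hausdorff_pre d \<delta> (A \<union> B)"
  unfolding hausdorff_pre_eq_INF[of d \<delta> "A \<union> B"]
proof (rule INF_greatest)
  fix C :: "nat \<Rightarrow> 'a set" assume "C \<in> Collect (fine_cover \<delta> (A \<union> B))"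
  then have C: "A \<union> B \<subseteq> (\<Union>i. C i)" "\<And>i. bounded (C i)" "\<And>i. diameter (C i) \<le> \<delta>"
    by (auto simp: fine_cover_def)
  have disj: "C i \<inter> A = {} \<or> C i \<inter> B = {}" for i
  proof (rule ccontr)
    assume "\<not> ?thesis"
    then obtain x y where "x \<in> C i" "x \<in> A" "y \<in> C i" "y \<in> B" by auto
    then show False using diameter_bounded_bound[OF C(2)[of i], of x y] C(3)[of i]
      sep[of x y] \<delta> by simp
  qed
  let ?touching = "\<lambda>D i. if C i \<inter> D = {} then {} else C i"
  have touching: "fine_cover \<delta> D (?touching D)" if D: "D \<subseteq> A \<union> B" for D
  proof -
    have "D \<subseteq> (\<Union>i. ?touching D i)"
    proof
      fix x assume "x \<in> D"
      then obtain i where "x \<in> C i" using D C(1) by blast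
      then show "x \<in> (\<Union>i. ?touching D i)" using \<open>x \<in> D\<close> by (intro UN_I[of i]) auto
    qed
    then show ?thesis using C(2,3) \<delta> by (simp add: fine_cover_def)
  qed
  have "hausdorff_pre d \<delta> A + hausdorff_pre d \<delta> B
      \<le> (\<Sum>i. diameter_weight d (?touching A i)) + (\<Sum>i. diameter_weight d (?touching B i))"
    by (intro add_mono hausdorff_pre_le touching) auto
  also have "\<dots> = (\<Sum>i. diameter_weight d (?touching A i) + diameter_weight d (?touching B i))"
    by (intro suminf_add) auto
  also have "\<dots> \<le> (\<Sum>i. diameter_weight d (C i))"
    using disj d by (intro suminf_le) auto
  finally show "hausdorff_pre d \<delta> A + hausdorff_pre d \<delta> B \<le> (\<Sum>i. diameter_weight d (C i))" .
qed

lemma hausdorff_pre_le_outer: "0 < \<delta> \<Longrightarrow> hausdorff_pre d \<delta> A \<le> hausdorff_outer d A"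
  unfolding hausdorff_outer_def by (intro SUP_upper) auto

lemma hausdorff_outer_least: "(\<And>\<delta>. 0 < \<delta> \<Longrightarrow> hausdorff_pre d \<delta> A \<le> x) \<Longrightarrow> hausdorff_outer d A \<le> x"
  unfolding hausdorff_outer_def by (rule SUP_least) simp

lemma hausdorff_outer_mono: "A \<subseteq> B \<Longrightarrow> hausdorff_outer d A \<le> hausdorff_outer d B"
  by (meson hausdorff_outer_least hausdorff_pre_le_outer hausdorff_pre_mono order_trans)

lemma hausdorff_outer_separated:
  assumes d: "0 < d" and g: "0 < g" and sep: "\<And>x y. x \<in> A \<Longrightarrow> y \<in> B \<Longrightarrow> g \<le> dist x y"
  shows "hausdorff_outer d A + hausdorff_outer d B \<le> hausdorff_outer d (A \<union> B)"
proof -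
  have "hausdorff_outer d A + hausdorff_outer d B
      = (SUP \<delta>\<in>{0<..}. hausdorff_pre d \<delta> A + hausdorff_pre d \<delta> B)"
    unfolding hausdorff_outer_def
  proof (rule SUP_add_directed_ennreal[symmetric])
    fix i j :: real assume "i \<in> {0<..}" "j \<in> {0<..}"
    then show "\<exists>k\<in>{0<..}. hausdorff_pre d i A + hausdorff_pre d j B
        \<le> hausdorff_pre d k A + hausdorff_pre d k B"
      by (intro bexI[of _ "min i j"] add_mono hausdorff_pre_antimono) auto
  qed
  also have "\<dots> \<le> hausdorff_outer d (A \<union> B)"
  proof (rule SUP_least)
    fix \<delta> :: real assume "\<delta> \<in> {0<..}"
    then have \<delta>: "0 < min \<delta> (g/2)" using g by simp
    have "hausdorff_pre d \<delta> A + hausdorff_pre d \<delta> B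
        \<le> hausdorff_pre d (min \<delta> (g/2)) A + hausdorff_pre d (min \<delta> (g/2)) B"
      by (intro add_mono hausdorff_pre_antimono) auto
    also have "\<dots> \<le> hausdorff_pre d (min \<delta> (g/2)) (A \<union> B)"
      using \<delta> g by (intro hausdorff_pre_separated[OF d _ _ sep]) auto
    also have "\<dots> \<le> hausdorff_outer d (A \<union> B)" using \<delta> by (rule hausdorff_pre_le_outer)
    finally show "hausdorff_pre d \<delta> A + hausdorff_pre d \<delta> B \<le> hausdorff_outer d (A \<union> B)" .
  qed
  finally show ?thesis .
qed

lemma hausdorff_outer_countably_subadditive:
  "hausdorff_outer d (\<Union>n. A n) \<le> (\<Sum>n. hausdorff_outer d (A n))"
proof (rule hausdorff_outer_least)
  fix \<delta> :: real assume "0 < \<delta>"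
  then have "(\<Sum>n. hausdorff_pre d \<delta> (A n)) \<le> (\<Sum>n. hausdorff_outer d (A n))"
    by (intro suminf_le hausdorff_pre_le_outer) auto
  then show "hausdorff_pre d \<delta> (\<Union>n. A n) \<le> (\<Sum>n. hausdorff_outer d (A n))"
    using hausdorff_pre_countably_subadditive order_trans by blast
qed

lemma metric_outer_measure_hausdorff:
  assumes "0 < d"
  shows "metric_outer_measure (hausdorff_outer d)"
proof
  have "hausdorff_outer d {} \<le> 0"
    using assms by (intro hausdorff_outer_least) (simp add: hausdorff_pre_empty)
  then show "outer_measure_space (Pow UNIV) (hausdorff_outer d)"
    unfolding outer_measure_space_def positive_def increasing_def countably_subadditive_def
    using hausdorff_outer_mono hausdorff_outer_countably_subadditive by auto
qed (rule hausdorff_outer_separated[OF assms])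

lemma sets_hausdorff_measure [simp, measurable_cong]:
  "sets (hausdorff_measure d :: 'a::metric_space measure) = sets borel"
  unfolding hausdorff_measure_def
  using sets.sigma_sets_eq[of "borel :: 'a measure"] by simp

lemma emeasure_hausdorff_measure:
  assumes "0 < d" "A \<in> sets borel"
  shows "emeasure (hausdorff_measure d) A = hausdorff_outer d A"
  using metric_outer_measure.measure_space_borel[OF metric_outer_measure_hausdorff[OF assms(1)]]
    assms(2)
  unfolding hausdorff_measure_def measure_space_def
  by (intro emeasure_measure_of_sigma) auto

lemma hausdorff_outer_lipschitz_image:
  fixes f :: "'a::metric_space \<Rightarrow> 'b::metric_space"
  assumes L: "0 < L" and f: "L-lipschitz_on A f"
  shows "hausdorff_outer d (f ` A) \<le> ennreal (L ^ d) * hausdorff_outer d A"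
proof (rule hausdorff_outer_least)
  fix \<delta> :: real assume \<delta>: "0 < \<delta>"
  have "hausdorff_pre d \<delta> (f ` A) \<le> ennreal (L ^ d) * hausdorff_pre d (\<delta> / L) A"
  proof (rule hausdorff_pre_mult_greatest)
    fix C assume C: "fine_cover (\<delta> / L) A C"
    then have bd: "bounded (C i)" and \<delta>: "L * diameter (C i) \<le> \<delta>" for i
      using L by (auto simp: fine_cover_def field_simps)
    have "L-lipschitz_on (C i \<inter> A) f" for i using f by (rule lipschitz_on_subset) simp
    note im = lipschitz_image_bounded_diameter[OF this bounded_Int[OF disjI1[OF bd]]]
    have diam: "diameter (f ` (C i \<inter> A)) \<le> L * diameter (C i)" for i
      using order_trans[OF im(2)[of i] mult_left_mono[OF diameter_subset[OF Int_lower1 bd]]] L by simp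
    have "fine_cover \<delta> (f ` A) (\<lambda>i. f ` (C i \<inter> A))"
      unfolding fine_cover_def
    proof (intro conjI allI)
      have "A \<subseteq> (\<Union>i. C i)" using C by (simp add: fine_cover_def)
      then show "f ` A \<subseteq> (\<Union>i. f ` (C i \<inter> A))" by blast
      show "diameter (f ` (C i \<inter> A)) \<le> \<delta>" for i using diam \<delta> by (rule order_trans)
    qed (rule im(1))
    then have "hausdorff_pre d \<delta> (f ` A) \<le> (\<Sum>i. diameter_weight d (f ` (C i \<inter> A)))"
      by (rule hausdorff_pre_le)
    also have "\<dots> \<le> (\<Sum>i. ennreal (L ^ d) * diameter_weight d (C i))"
      using L im(1) diam diameter_ge_0[OF bd] by (intro suminf_le diameter_weight_scale) auto
    finally show "hausdorff_pre d \<delta> (f ` A) \<le> ennreal (L ^ d) * (\<Sum>i. diameter_weight d (C i))"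
      by simp
  qed (use L in simp)
  also have "\<dots> \<le> ennreal (L ^ d) * hausdorff_outer d A"
    using \<delta> L by (intro mult_left_mono hausdorff_pre_le_outer) auto
  finally show "hausdorff_pre d \<delta> (f ` A) \<le> ennreal (L ^ d) * hausdorff_outer d A" .
qed

lemma hausdorff_outer_le_expanding_image:
  fixes f :: "'a::metric_space \<Rightarrow> 'b::metric_space"
  assumes c: "0 < c" and exp: "\<And>x y. x \<in> A \<Longrightarrow> y \<in> A \<Longrightarrow> c * dist x y \<le> dist (f x) (f y)"
  shows "hausdorff_outer d A \<le> ennreal ((1 / c) ^ d) * hausdorff_outer d (f ` A)"
proof -
  let ?g = "inv_into A f"
  have inj: "inj_on f A"
  proof (rule inj_onI)
    fix x y assume "x \<in> A" "y \<in> A" "f x = f y"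
    then show "x = y" using exp[of x y] c by (simp add: mult_le_0_iff)
  qed
  have "(1 / c)-lipschitz_on (f ` A) ?g"
  proof (rule lipschitz_onI)
    fix y z assume "y \<in> f ` A" "z \<in> f ` A"
    then show "dist (?g y) (?g z) \<le> 1 / c * dist y z"
      using exp c by (auto simp: inv_into_f_f[OF inj] field_simps)
  qed (use c in simp)
  then have "hausdorff_outer d (?g ` f ` A) \<le> ennreal ((1 / c) ^ d) * hausdorff_outer d (f ` A)"
    using c by (intro hausdorff_outer_lipschitz_image) auto
  then show ?thesis by (simp add: inv_into_image_cancel[OF inj])
qed

lemma hausdorff_outer_scaleR_le:
  fixes A :: "'a::real_normed_vector set"
  assumes "0 < c"
  shows "hausdorff_outer d ((\<lambda>x. c *\<^sub>R x) ` A) \<le> ennreal (c ^ d) * hausdorff_outer d A"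
  using assms by (intro hausdorff_outer_lipschitz_image lipschitz_onI)
    (auto simp: dist_norm simp flip: scaleR_diff_right)

lemma hausdorff_outer_scaleR:
  fixes A :: "'a::real_normed_vector set"
  assumes c: "0 < c"
  shows "hausdorff_outer d ((\<lambda>x. c *\<^sub>R x) ` A) = ennreal (c ^ d) * hausdorff_outer d A"
proof (rule antisym[OF hausdorff_outer_scaleR_le[OF c]])
  let ?cA = "(\<lambda>x. c *\<^sub>R x) ` A"
  have "A = (\<lambda>x. (1 / c) *\<^sub>R x) ` ?cA" using c by (simp add: image_image)
  then have "hausdorff_outer d A \<le> ennreal ((1 / c) ^ d) * hausdorff_outer d ?cA"
    using hausdorff_outer_scaleR_le[of "1 / c" d ?cA] c by simp
  then have "ennreal (c ^ d) * hausdorff_outer d A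
      \<le> ennreal (c ^ d) * (ennreal ((1 / c) ^ d) * hausdorff_outer d ?cA)"
    by (rule mult_left_mono) simp
  also have "\<dots> = hausdorff_outer d ?cA"
    using c by (simp add: mult.assoc[symmetric] ennreal_mult'[symmetric] power_divide)
  finally show "ennreal (c ^ d) * hausdorff_outer d A \<le> hausdorff_outer d ?cA" .
qed

lemma emeasure_lborel_le_diameter_weight:
  fixes C :: "'a::euclidean_space set"
  assumes "bounded C"
  obtains B where "closed B" "C \<subseteq> B"
    "emeasure lborel B \<le> ennreal (2 ^ DIM('a)) * diameter_weight (DIM('a)) C"
proof (cases "C = {}")
  case True
  then show ?thesis using that[of "{}"] by simp
next
  case False
  then obtain x where "x \<in> C" by auto
  then have "C \<subseteq> cball x (diameter C)" using diameter_bounded_bound[OF assms] by auto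
  then show ?thesis
    using that[of "cball x (diameter C)"] diameter_ge_0[OF assms]
    by (simp add: emeasure_cball diameter_weight_def power_divide ennreal_mult'[symmetric])
qed

text \<open>The factor \<open>2 ^ d\<close> avoids the isodiametric inequality: a set of diameter \<open>t\<close> lies in a ball
  of radius \<open>t\<close>.\<close>
lemma lborel_le_hausdorff_outer:
  fixes A :: "'a::euclidean_space set"
  assumes A: "A \<in> sets borel"
  shows "emeasure lborel A \<le> ennreal (2 ^ DIM('a)) * hausdorff_outer (DIM('a)) A"
proof -
  let ?c = "ennreal (2 ^ DIM('a))" and ?w = "diameter_weight DIM('a)"
  have "emeasure lborel A \<le> ?c * hausdorff_pre DIM('a) 1 A"
  proof (rule hausdorff_pre_mult_greatest)
    fix C :: "nat \<Rightarrow> 'a set" assume C: "fine_cover 1 A C"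
    then have "\<exists>B. closed B \<and> C i \<subseteq> B \<and> emeasure lborel B \<le> ?c * ?w (C i)" for i
      using emeasure_lborel_le_diameter_weight[of "C i"] unfolding fine_cover_def by metis
    then obtain B where B: "\<And>i. closed (B i)" "\<And>i. C i \<subseteq> B i"
      "\<And>i. emeasure lborel (B i) \<le> ?c * ?w (C i)"
      by metis
    have "A \<subseteq> (\<Union>i. B i)" using C B(2) by (fastforce simp: fine_cover_def)
    then have "emeasure lborel A \<le> emeasure lborel (\<Union>i. B i)"
      using B(1) by (intro emeasure_mono) (auto intro: borel_closed)
    also have "\<dots> \<le> (\<Sum>i. emeasure lborel (B i))"
      using B(1) by (intro emeasure_subadditive_countably) (auto intro: borel_closed)
    also have "\<dots> \<le> (\<Sum>i. ?c * ?w (C i))" by (intro suminf_le B(3)) auto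
    finally show "emeasure lborel A \<le> ?c * (\<Sum>i. ?w (C i))" by simp
  qed simp
  also have "\<dots> \<le> ?c * hausdorff_outer DIM('a) A"
    by (intro mult_left_mono hausdorff_pre_le_outer) auto
  finally show ?thesis .
qed

section \<open>Separated nets\<close>

lemma maximal_pairwise_subset:
  fixes far :: "'a \<Rightarrow> 'a \<Rightarrow> bool"
  assumes sym: "\<And>x y. far x y \<Longrightarrow> far y x"
    and bound: "\<And>P. finite P \<Longrightarrow> P \<subseteq> S \<Longrightarrow> pairwise far P \<Longrightarrow> card P \<le> B"
  obtains P where "finite P" "P \<subseteq> S" "pairwise far P" "\<And>x. x \<in> S \<Longrightarrow> x \<in> P \<or> (\<exists>p\<in>P. \<not> far p x)"
proof -
  let ?Q = "\<lambda>P. finite P \<and> P \<subseteq> S \<and> pairwise far P"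
  have "\<exists>P. ?Q P \<and> (\<forall>P'. ?Q P' \<longrightarrow> card P' \<le> card P)"
    using bound by (intro ex_has_greatest_nat[of ?Q "{}" card "Suc B"]) (auto simp: less_Suc_eq_le)
  then obtain P where P: "?Q P" and max: "\<And>P'. ?Q P' \<Longrightarrow> card P' \<le> card P" by blast
  have "x \<in> P \<or> (\<exists>p\<in>P. \<not> far p x)" if "x \<in> S" for x
  proof (rule ccontr)
    assume uncovered: "\<not> ?thesis"
    then have "?Q (insert x P)" using P that sym by (auto simp: pairwise_insert)
    then have "card (insert x P) \<le> card P" by (rule max)
    then show False using uncovered P by simp
  qed
  then show ?thesis using that P by blast
qed

definition dist_separated :: "real \<Rightarrow> 'a::metric_space set \<Rightarrow> bool" where
  "dist_separated r P \<longleftrightarrow> pairwise (\<lambda>x y. r \<le> dist x y) P"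

lemma dist_separatedD: "dist_separated r P \<Longrightarrow> x \<in> P \<Longrightarrow> y \<in> P \<Longrightarrow> x \<noteq> y \<Longrightarrow> r \<le> dist x y"
  by (simp add: dist_separated_def pairwise_def)

lemma compact_separated_card_bound:
  fixes S :: "'a::metric_space set"
  assumes "compact S" "0 < r"
  obtains B where "\<And>P. P \<subseteq> S \<Longrightarrow> dist_separated r P \<Longrightarrow> card P \<le> B"
proof -
  have "S \<subseteq> (\<Union>x\<in>S. ball x (r/2))" using assms(2) by force
  then obtain K where K: "finite K" "S \<subseteq> (\<Union>x\<in>K. ball x (r/2))"
    using compactE_image[OF assms(1), of S "\<lambda>x. ball x (r/2)"] by (metis open_ball)
  have "card P \<le> card K" if P: "P \<subseteq> S" "dist_separated r P" for P
  proof -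
    have "\<forall>p\<in>P. \<exists>k\<in>K. dist k p < r/2" using P(1) K(2) by fastforce
    then obtain g where g: "\<And>p. p \<in> P \<Longrightarrow> g p \<in> K \<and> dist (g p) p < r/2" by metis
    have "inj_on g P"
    proof (rule inj_onI, rule ccontr)
      fix p q assume pq: "p \<in> P" "q \<in> P" "g p = g q" "p \<noteq> q"
      then have "dist p q < r" using g[of p] g[of q] dist_triangle_half_r[of "g p" p r q] by simp
      then show False using dist_separatedD[OF P(2)] pq by force
    qed
    then show ?thesis using g K(1) by (intro card_inj_on_le) auto
  qed
  then show ?thesis using that by blast
qed

lemma compact_separated_net:
  fixes S :: "'a::metric_space set"
  assumes "compact S" "0 < r"
  obtains P where "finite P" "P \<subseteq> S" "dist_separated r P" "S \<subseteq> (\<Union>p\<in>P. ball p r)"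
proof -
  obtain B where B: "\<And>P. P \<subseteq> S \<Longrightarrow> dist_separated r P \<Longrightarrow> card P \<le> B"
    using compact_separated_card_bound[OF assms] by blast
  obtain P where P: "finite P" "P \<subseteq> S" "pairwise (\<lambda>x y. r \<le> dist x y) P"
    and max: "\<And>x. x \<in> S \<Longrightarrow> x \<in> P \<or> (\<exists>p\<in>P. \<not> r \<le> dist p x)"
    by (rule maximal_pairwise_subset[of "\<lambda>x y. r \<le> dist x y"])
      (use B in \<open>auto simp: dist_commute dist_separated_def\<close>)
  have "S \<subseteq> (\<Union>p\<in>P. ball p r)" using max assms(2) by (force simp: not_le)
  then show ?thesis using that P by (simp add: dist_separated_def)
qed

lemma card_separated_cball_le:
  fixes P :: "'a::euclidean_space set"
  assumes P: "finite P" "P \<subseteq> cball a s" "dist_separated h P" and pos: "0 < h" "0 \<le> s"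
  shows "real (card P) * h ^ DIM('a) \<le> (2 * s + h) ^ DIM('a)"
proof -
  let ?d = "DIM('a)" and ?\<omega> = "unit_ball_vol (real DIM('a))"
  have "disjoint_family_on (\<lambda>p. ball p (h / 2)) P"
    unfolding disjoint_family_on_def using dist_separatedD[OF P(3)] by (auto intro!: disjoint_ballI)
  then have "(\<Sum>p\<in>P. measure lborel (ball p (h/2))) = measure lborel (\<Union>p\<in>P. ball p (h/2))"
    using P pos by (intro measure_finite_Union[symmetric]) (auto simp: emeasure_ball less_imp_le)
  also have "\<dots> \<le> measure lborel (ball a (s + h/2))"
  proof (rule measure_mono_fmeasurable)
    show "(\<Union>p\<in>P. ball p (h/2)) \<subseteq> ball a (s + h/2)"
      using P(2) by (force intro: le_less_trans[OF dist_triangle add_le_less_mono])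
  qed (use P pos in \<open>auto simp: fmeasurable_def emeasure_ball\<close>)
  finally have "?\<omega> * (real (card P) * (h/2) ^ ?d) \<le> ?\<omega> * (s + h/2) ^ ?d"
    using pos by (simp add: content_ball mult.left_commute)
  then have "real (card P) * (h/2) ^ ?d \<le> (s + h/2) ^ ?d"
    by (subst (asm) mult_le_cancel_left_pos) auto
  moreover have "(s + h/2) ^ ?d = (2 * s + h) ^ ?d / 2 ^ ?d"
    by (simp add: power_divide[symmetric] add_divide_distrib)
  ultimately show ?thesis by (simp add: power_divide field_simps)
qed

lemma hausdorff_outer_cball_le:
  fixes a :: "'a::euclidean_space"
  assumes s: "0 < s"
  shows "hausdorff_outer (DIM('a)) (cball a s) \<le> ennreal (unit_ball_vol (DIM('a)) * (2 * s) ^ DIM('a))"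
proof (rule hausdorff_outer_least)
  fix \<delta> :: real assume \<delta>: "0 < \<delta>"
  let ?d = "DIM('a)" and ?\<omega> = "unit_ball_vol (real DIM('a))"
  interpret total_outer_measure "hausdorff_pre ?d \<delta> :: 'a set \<Rightarrow> ennreal"
    using \<delta> by (intro total_outer_measure_hausdorff_pre) auto
  have bound: "hausdorff_pre ?d \<delta> (cball a s) \<le> ennreal (?\<omega> * (2 * s + h) ^ ?d)"
    if h: "0 < h" "2 * h \<le> \<delta>" for h
  proof -
    obtain P where P: "finite P" "P \<subseteq> cball a s" "dist_separated h P" "cball a s \<subseteq> (\<Union>p\<in>P. ball p h)"
      using compact_separated_net[OF compact_cball h(1)] by metis
    have "hausdorff_pre ?d \<delta> (cball a s) \<le> (\<Sum>p\<in>P. hausdorff_pre ?d \<delta> (ball p h))"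
      using order_trans[OF mono[OF P(4)] finite_subadditive[OF P(1)]] .
    also have "\<dots> \<le> (\<Sum>p\<in>P. ennreal (?\<omega> * h ^ ?d))"
    proof (rule sum_mono)
      fix p :: 'a
      have "hausdorff_pre ?d \<delta> (ball p h) \<le> diameter_weight ?d (ball p h)"
        using h \<delta> by (intro hausdorff_pre_le_diameter_weight) auto
      also have "\<dots> \<le> ennreal (?\<omega> * h ^ ?d)" using h by (intro diameter_weight_mono) auto
      finally show "hausdorff_pre ?d \<delta> (ball p h) \<le> ennreal (?\<omega> * h ^ ?d)" .
    qed
    also have "\<dots> = ennreal (?\<omega> * (real (card P) * h ^ ?d))"
      using h by (simp add: ennreal_mult ennreal_of_nat_eq_real_of_nat mult.left_commute)
    also have "\<dots> \<le> ennreal (?\<omega> * (2 * s + h) ^ ?d)"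
      using card_separated_cball_le[OF P(1-3) h(1)] s by (intro ennreal_leI mult_left_mono) auto
    finally show ?thesis .
  qed
  have "((\<lambda>h. ennreal (?\<omega> * (2 * s + h) ^ ?d)) \<longlongrightarrow> ennreal (?\<omega> * (2 * s + 0) ^ ?d)) (at_right 0)"
    by (intro tendsto_intros)
  moreover have "eventually (\<lambda>h. hausdorff_pre ?d \<delta> (cball a s)
      \<le> ennreal (?\<omega> * (2 * s + h) ^ ?d)) (at_right 0)"
    unfolding eventually_at_right_field using \<delta> bound by (intro exI[of _ "\<delta>/2"]) auto
  ultimately show "hausdorff_pre ?d \<delta> (cball a s) \<le> ennreal (?\<omega> * (2 * s) ^ ?d)"
    using tendsto_lowerbound[of _ _ "at_right (0::real)"] by simp
qed

section \<open>Round spheres\<close>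

text \<open>For \<open>a = b\<close> the quotient is \<open>0 / 0 = 0\<close> and the map is the identity.\<close>
definition householder :: "'a::real_inner \<Rightarrow> 'a \<Rightarrow> 'a \<Rightarrow> 'a" where
  "householder a b x = x - (2 * (x \<bullet> (a - b)) / ((a - b) \<bullet> (a - b))) *\<^sub>R (a - b)"

lemma orthogonal_transformation_householder: "orthogonal_transformation (householder a b)"
proof -
  define u where "u = a - b"
  have h: "householder a b x = x - (2 * (x \<bullet> u) / (u \<bullet> u)) *\<^sub>R u" for x
    by (simp add: householder_def u_def)
  have "linear (householder a b)"
    by (rule linearI) (auto simp: h inner_left_distrib algebra_simps add_divide_distrib)
  moreover have "norm (householder a b x) = norm x" for x
  proof (cases "u = 0")
    case False
    then have "householder a b x \<bullet> householder a b x = x \<bullet> x"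
      by (simp add: h inner_diff_left inner_diff_right inner_commute[of u x]
        field_simps power2_eq_square)
    then show ?thesis by (simp add: norm_eq_sqrt_inner)
  qed (simp add: h)
  ultimately show ?thesis by (simp add: orthogonal_transformation)
qed

lemma householder_involutive [simp]: "householder a b (householder a b x) = x"
proof (cases "a = b")
  case False
  define u where "u = a - b"
  have "u \<bullet> u \<noteq> 0" using False by (simp add: u_def)
  then show ?thesis
    unfolding householder_def u_def[symmetric]
    by (simp add: inner_diff_left algebra_simps add_divide_distrib[symmetric]
      scaleR_add_left[symmetric])
qed (simp add: householder_def)

lemma householder_swaps:
  assumes "norm a = norm b"
  shows "householder a b a = b"
proof (cases "a = b")
  case False
  define u where "u = a - b"
  have "a \<bullet> a = b \<bullet> b" using assms by (metis dot_square_norm)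
  then have "2 * (a \<bullet> u) = u \<bullet> u"
    by (simp add: u_def inner_diff_left inner_diff_right inner_commute)
  moreover have "u \<bullet> u \<noteq> 0" using False by (simp add: u_def)
  ultimately show ?thesis by (simp add: householder_def flip: u_def) (simp add: u_def)
qed (simp add: householder_def)

lemma orthogonal_transformation_dist: "orthogonal_transformation f \<Longrightarrow> dist (f x) (f y) = dist x y"
  by (metis dist_norm linear_diff orthogonal_transformation_linear orthogonal_transformation_norm)

definition hemisphere_graph :: "real \<Rightarrow> 'a::real_normed_vector \<Rightarrow> 'a \<times> real" where
  "hemisphere_graph R x = (x, sqrt (R\<^sup>2 - (norm x)\<^sup>2))"

lemma fst_hemisphere_graph [simp]: "fst (hemisphere_graph R x) = x"
  by (simp add: hemisphere_graph_def)

lemma norm_hemisphere_graph: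
  assumes "norm x \<le> R"
  shows "norm (hemisphere_graph R x) = R"
proof -
  have "(norm x)\<^sup>2 \<le> R\<^sup>2" "0 \<le> R"
    using assms norm_ge_zero[of x] by (auto intro!: power_mono simp del: norm_ge_zero)
  then show ?thesis by (simp add: hemisphere_graph_def norm_Pair)
qed

lemma hemisphere_graph_image:
  assumes "0 < R"
  shows "hemisphere_graph R ` ball (0::'a::real_normed_vector) R = {p \<in> sphere 0 R. 0 < snd p}"
proof (intro equalityI subsetI)
  fix p :: "'a \<times> real" assume "p \<in> {p \<in> sphere 0 R. 0 < snd p}"
  then have p: "0 < snd p" "R\<^sup>2 = (norm (fst p))\<^sup>2 + (snd p)\<^sup>2"
    by (cases p; auto simp: norm_Pair)+
  then have "(norm (fst p))\<^sup>2 < R\<^sup>2" by simp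
  then have "fst p \<in> ball 0 R" using assms by (auto intro: power_less_imp_less_base)
  moreover have "hemisphere_graph R (fst p) = p"
    using p by (simp add: hemisphere_graph_def prod_eq_iff)
  ultimately show "p \<in> hemisphere_graph R ` ball 0 R" by (metis imageI)
next
  fix p assume "p \<in> hemisphere_graph R ` ball (0::'a) R"
  then obtain x :: 'a where x: "norm x < R" "p = hemisphere_graph R x" by auto
  then have "(norm x)\<^sup>2 < R\<^sup>2" by (intro power_strict_mono) auto
  then show "p \<in> {p \<in> sphere 0 R. 0 < snd p}"
    using x norm_hemisphere_graph[of x R] by (simp add: hemisphere_graph_def)
qed

lemma hemisphere_graph_near_pole:
  assumes "norm x \<le> R"
  shows "dist (0, R) (hemisphere_graph R x) \<le> 2 * norm x"
proof -
  have "0 \<le> R" using assms norm_ge_zero[of x] by linarith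
  then have "sqrt (R\<^sup>2 - (norm x)\<^sup>2) \<le> R" by (intro real_le_lsqrt) auto
  moreover have "R - norm x \<le> sqrt (R\<^sup>2 - (norm x)\<^sup>2)"
    using assms by (intro real_le_rsqrt) (auto simp: power2_eq_square algebra_simps mult_right_mono)
  ultimately have "\<bar>R - sqrt (R\<^sup>2 - (norm x)\<^sup>2)\<bar> \<le> norm x" by linarith
  then show ?thesis
    using norm_Pair_le[of "0 - x" "R - sqrt (R\<^sup>2 - (norm x)\<^sup>2)"]
    by (simp add: hemisphere_graph_def dist_norm)
qed

lemma hemisphere_height_ge:
  assumes "0 \<le> R" "norm x \<le> R / 2"
  shows "R / 2 \<le> sqrt (R\<^sup>2 - (norm x)\<^sup>2)" "(norm x)\<^sup>2 \<le> R\<^sup>2"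
proof -
  have "(norm x)\<^sup>2 \<le> (R/2)\<^sup>2" using assms by (intro power_mono) auto
  moreover have "(R/2)\<^sup>2 + (R/2)\<^sup>2 \<le> R\<^sup>2" by (simp add: power_divide)
  ultimately have square: "(R/2)\<^sup>2 \<le> R\<^sup>2 - (norm x)\<^sup>2" by linarith
  then show "R / 2 \<le> sqrt (R\<^sup>2 - (norm x)\<^sup>2)" by (rule real_le_rsqrt)
  show "(norm x)\<^sup>2 \<le> R\<^sup>2" using square zero_le_power2[of "R/2"] by linarith
qed

lemma hemisphere_graph_lipschitz:
  assumes R: "0 < R" and s: "s \<le> R / 20"
  shows "(11/10)-lipschitz_on (cball (0::'a::real_normed_vector) s) (hemisphere_graph R)"
proof (rule lipschitz_onI)
  fix x y :: 'a assume xy: "x \<in> cball 0 s" "y \<in> cball 0 s"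
  define g where "g x = sqrt (R\<^sup>2 - (norm x)\<^sup>2)" for x :: 'a
  have g: "R / 2 \<le> g x" "R / 2 \<le> g y" "(g x)\<^sup>2 = R\<^sup>2 - (norm x)\<^sup>2" "(g y)\<^sup>2 = R\<^sup>2 - (norm y)\<^sup>2"
    using hemisphere_height_ge[of R x] hemisphere_height_ge[of R y] xy R s by (auto simp: g_def)
  have "\<bar>g x - g y\<bar> * R \<le> \<bar>g x - g y\<bar> * (g x + g y)" using g by (intro mult_left_mono) auto
  also have "\<dots> = \<bar>(g x - g y) * (g x + g y)\<bar>" using g R by (simp add: abs_mult)
  also have "(g x - g y) * (g x + g y) = (norm y - norm x) * (norm y + norm x)"
    using g(3,4) by (simp add: algebra_simps power2_eq_square)
  also have "\<bar>\<dots>\<bar> \<le> norm (x - y) * (R / 10)"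
    unfolding abs_mult using xy s norm_triangle_ineq3[of y x]
    by (intro mult_mono) (auto simp: norm_minus_commute)
  finally have "\<bar>g x - g y\<bar> \<le> norm (x - y) / 10" using R by simp
  then show "dist (hemisphere_graph R x) (hemisphere_graph R y) \<le> 11 / 10 * dist x y"
    using norm_Pair_le[of "x - y" "g x - g y"] by (simp add: hemisphere_graph_def dist_norm g_def)
qed simp

definition sphere_chart :: "'a::real_inner \<times> real \<Rightarrow> 'a \<Rightarrow> 'a \<times> real" where
  "sphere_chart c x = householder (0, norm c) c (hemisphere_graph (norm c) x)"

definition sphere_chart_inv :: "'a::real_inner \<times> real \<Rightarrow> 'a \<times> real \<Rightarrow> 'a" where
  "sphere_chart_inv c y = fst (householder (0, norm c) c y)"

lemma householder_pole [simp]: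
  "householder (0, norm c) c (0, norm c) = c" "householder (0, norm c) c c = (0, norm c)"
proof -
  show pole: "householder (0, norm c) c (0, norm c) = c"
    by (rule householder_swaps) (simp add: norm_Pair)
  show "householder (0, norm c) c c = (0, norm c)"
    using householder_involutive[of "(0, norm c)" c "(0, norm c)"] by (simp only: pole)
qed

lemma sphere_chart_inv_chart [simp]: "sphere_chart_inv c (sphere_chart c x) = x"
  by (simp add: sphere_chart_def sphere_chart_inv_def)

lemma dist_sphere_chart: "dist (sphere_chart c x) (sphere_chart c y)
    = dist (hemisphere_graph (norm c) x) (hemisphere_graph (norm c) y)"
  by (simp add: sphere_chart_def orthogonal_transformation_dist orthogonal_transformation_householder)

lemma dist_le_sphere_chart: "dist x y \<le> dist (sphere_chart c x) (sphere_chart c y)"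
  unfolding dist_sphere_chart
  using dist_fst_le[of "hemisphere_graph (norm c) x" "hemisphere_graph (norm c) y"] by simp

lemma dist_sphere_chart_inv_le: "dist (sphere_chart_inv c y) (sphere_chart_inv c z) \<le> dist y z"
  unfolding sphere_chart_inv_def
  using dist_fst_le orthogonal_transformation_dist[OF orthogonal_transformation_householder] by metis

lemma sphere_chart_image:
  assumes "c \<noteq> 0"
  shows "sphere_chart c ` ball 0 (norm c) = {y \<in> sphere 0 (norm c). 0 < y \<bullet> c}"
proof -
  let ?f = "householder (0, norm c) c"
  have norm: "norm (?f y) = norm y" for y
    by (rule orthogonal_transformation_norm[OF orthogonal_transformation_householder])
  have inner: "y \<bullet> c = snd (?f y) * norm c" for y
  proof -
    have "y \<bullet> c = ?f y \<bullet> ?f c"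
      using orthogonal_transformation_householder[of "(0, norm c)" c]
      unfolding orthogonal_transformation_def by presburger
    then show ?thesis by (cases "?f y") simp
  qed
  have "sphere_chart c ` ball 0 (norm c) = ?f ` {p \<in> sphere 0 (norm c). 0 < snd p}"
    using assms
    by (subst hemisphere_graph_image[symmetric]) (simp_all add: sphere_chart_def[abs_def] image_image)
  also have "\<dots> = {y \<in> sphere 0 (norm c). 0 < snd (?f y)}"
  proof (intro equalityI subsetI)
    fix y assume "y \<in> {y \<in> sphere 0 (norm c). 0 < snd (?f y)}"
    then have "?f y \<in> {p \<in> sphere 0 (norm c). 0 < snd p}" by (simp add: norm)
    then show "y \<in> ?f ` {p \<in> sphere 0 (norm c). 0 < snd p}"
      by (intro image_eqI[of _ ?f "?f y"]) auto
  qed (auto simp: norm)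
  also have "\<dots> = {y \<in> sphere 0 (norm c). 0 < y \<bullet> c}"
    unfolding inner using assms by (simp add: zero_less_mult_iff)
  finally show ?thesis .
qed

lemma inner_diff_same_norm:
  fixes x y :: "'a::real_inner"
  assumes "norm x = norm y"
  shows "(x - y) \<bullet> x = (norm (x - y))\<^sup>2 / 2"
  using assms dot_square_norm[of x] dot_square_norm[of y] dot_square_norm[of "x - y"]
  by (simp add: inner_diff_left inner_diff_right inner_commute)

lemma sphere_chart_covers_cap:
  assumes c: "c \<noteq> 0" and s: "s \<le> norm c"
  shows "sphere 0 (norm c) \<inter> ball c s \<subseteq> sphere_chart c ` cball 0 s"
proof
  fix y assume y: "y \<in> sphere 0 (norm c) \<inter> ball c s"
  have "y \<bullet> c = (norm c)\<^sup>2 - (dist c y)\<^sup>2 / 2"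
    using inner_diff_same_norm[of c y] y by (simp add: dist_norm inner_diff_left dot_square_norm)
  moreover have "(dist c y)\<^sup>2 < (norm c)\<^sup>2"
    using y s by (intro power_strict_mono) auto
  moreover have "0 \<le> (dist c y)\<^sup>2" by simp
  ultimately have "0 < y \<bullet> c" by argo
  then obtain x where x: "y = sphere_chart c x"
    using sphere_chart_image[OF c] y by fastforce
  have "norm x \<le> dist y c"
    using dist_sphere_chart_inv_le[of c y c] by (simp add: x) (simp add: sphere_chart_inv_def)
  then show "y \<in> sphere_chart c ` cball 0 s" using y x by (auto simp: dist_commute)
qed

lemma hausdorff_outer_cap_le:
  fixes c :: "'a::euclidean_space \<times> real"
  assumes s: "0 < s" "s \<le> norm c / 20"
  shows "hausdorff_outer (DIM('a)) (sphere 0 (norm c) \<inter> ball c s)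
    \<le> ennreal (unit_ball_vol (DIM('a)) * (9 / 4 * s) ^ DIM('a))"
proof -
  let ?d = "DIM('a)" and ?\<omega> = "unit_ball_vol (real DIM('a))"
  have c: "c \<noteq> 0" "0 < norm c" using s by auto
  have "(11/10)-lipschitz_on (cball 0 s) (sphere_chart c)"
    using hemisphere_graph_lipschitz[OF c(2) s(2), where 'a='a]
    by (simp add: lipschitz_on_def dist_sphere_chart)
  then have "hausdorff_outer ?d (sphere_chart c ` cball 0 s)
      \<le> ennreal ((11/10) ^ ?d) * hausdorff_outer ?d (cball (0::'a) s)"
    by (intro hausdorff_outer_lipschitz_image) auto
  also have "\<dots> \<le> ennreal ((11/10) ^ ?d) * ennreal (?\<omega> * (2 * s) ^ ?d)"
    using s by (intro mult_left_mono hausdorff_outer_cball_le) auto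
  also have "\<dots> = ennreal (?\<omega> * (11/10 * (2 * s)) ^ ?d)"
    using s unfolding power_mult_distrib[of "11/10"]
    by (subst ennreal_mult[symmetric]) (auto simp: mult.left_commute)
  also have "\<dots> \<le> ennreal (?\<omega> * (9 / 4 * s) ^ ?d)"
    using s by (intro ennreal_leI mult_left_mono power_mono) auto
  finally show ?thesis
    using hausdorff_outer_mono[OF sphere_chart_covers_cap[OF c(1)], of s ?d] s order_trans by fastforce
qed

lemma hausdorff_outer_ball_pos:
  assumes "0 < r"
  shows "0 < hausdorff_outer (DIM('a)) (ball (a::'a::euclidean_space) r)"
proof (rule ccontr)
  assume "\<not> ?thesis"
  then have "emeasure lborel (ball a r) \<le> 0"
    using lborel_le_hausdorff_outer[of "ball a r"] by (simp add: not_less)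
  then show False using assms unit_ball_vol_pos[of "real DIM('a)"] by (simp add: emeasure_ball)
qed

lemma hausdorff_outer_cap_pos:
  fixes c :: "'a::euclidean_space \<times> real"
  assumes c: "c \<noteq> 0" and e: "0 < e"
  shows "0 < hausdorff_outer (DIM('a)) (sphere 0 (norm c) \<inter> ball c e)"
proof -
  let ?d = "DIM('a)" and ?cap = "sphere 0 (norm c) \<inter> ball c e"
  define r where "r = min (e / 2) (norm c)"
  have "ball 0 r \<subseteq> sphere_chart_inv c ` ?cap"
  proof
    fix x :: 'a assume "x \<in> ball 0 r"
    then have x: "norm x < norm c" "2 * norm x < e" by (auto simp: r_def)
    have "dist c (sphere_chart c x) = dist (0, norm c) (hemisphere_graph (norm c) x)"
      using orthogonal_transformation_dist[OF orthogonal_transformation_householder,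
          of "(0, norm c)" c "(0, norm c)"]
      by (simp add: sphere_chart_def)
    then have "sphere_chart c x \<in> ball c e"
      using hemisphere_graph_near_pole[of x "norm c"] x by simp
    moreover have "sphere_chart c x \<in> sphere 0 (norm c)"
      using sphere_chart_image[OF c] x(1) by fastforce
    ultimately show "x \<in> sphere_chart_inv c ` ?cap"
      by (intro image_eqI[of _ _ "sphere_chart c x"]) auto
  qed
  then have "hausdorff_outer ?d (ball (0::'a) r) \<le> hausdorff_outer ?d (sphere_chart_inv c ` ?cap)"
    by (rule hausdorff_outer_mono)
  also have "\<dots> \<le> ennreal (1 ^ ?d) * hausdorff_outer ?d ?cap"
    by (intro hausdorff_outer_lipschitz_image lipschitz_onI) (auto simp: dist_sphere_chart_inv_le)
  finally have "hausdorff_outer ?d (ball (0::'a) r) \<le> hausdorff_outer ?d ?cap" by simp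
  moreover have "0 < hausdorff_outer ?d (ball (0::'a) r)"
    using c e by (intro hausdorff_outer_ball_pos) (simp add: r_def)
  ultimately show ?thesis by (rule less_le_trans[rotated])
qed

lemma sphere_net:
  assumes s: "0 < s" "s \<le> R / 20"
  obtains P :: "('a::euclidean_space \<times> real) set"
  where "finite P" "P \<subseteq> sphere 0 R" "dist_separated s P" "2 \<le> card P"
    "hausdorff_outer (DIM('a)) (sphere (0::'a \<times> real) R)
       \<le> ennreal (real (card P) * (unit_ball_vol (DIM('a)) * (9 / 4 * s) ^ DIM('a)))"
proof -
  let ?S = "sphere (0::'a \<times> real) R" and ?d = "DIM('a)"
  have R: "0 < R" using s by simp
  obtain P where P: "finite P" "P \<subseteq> ?S" "dist_separated s P" and cover: "?S \<subseteq> (\<Union>p\<in>P. ball p s)"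
    using compact_separated_net[OF compact_sphere s(1)] by metis
  interpret metric_outer_measure "hausdorff_outer ?d :: ('a \<times> real) set \<Rightarrow> ennreal"
    by (rule metric_outer_measure_hausdorff) simp
  have "hausdorff_outer ?d ?S \<le> hausdorff_outer ?d (\<Union>p\<in>P. ?S \<inter> ball p s)"
    using cover by (intro mono) blast
  also have "\<dots> \<le> (\<Sum>p\<in>P. hausdorff_outer ?d (?S \<inter> ball p s))" by (rule finite_subadditive[OF P(1)])
  also have "\<dots> \<le> (\<Sum>p\<in>P. ennreal (unit_ball_vol ?d * (9 / 4 * s) ^ ?d))"
  proof (rule sum_mono)
    fix p assume "p \<in> P"
    then show "hausdorff_outer ?d (?S \<inter> ball p s) \<le> ennreal (unit_ball_vol ?d * (9 / 4 * s) ^ ?d)"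
      using P(2) s hausdorff_outer_cap_le[of s p] by auto
  qed
  also have "\<dots> = ennreal (real (card P) * (unit_ball_vol ?d * (9 / 4 * s) ^ ?d))"
    using s by (simp add: ennreal_mult ennreal_of_nat_eq_real_of_nat)
  finally have measure: "hausdorff_outer ?d ?S \<le> \<dots>" .
  have pole: "(0, R) \<in> ?S" using R by (simp add: norm_Pair)
  then obtain p where p: "p \<in> P" using cover by blast
  then have "- p \<in> ?S" using P(2) by auto
  then obtain q where q: "q \<in> P" "- p \<in> ball q s" using cover by (meson UN_E subsetD)
  have "q \<noteq> p"
  proof
    assume "q = p"
    moreover have "dist p (- p) = 2 * R" using p P(2) by (auto simp: dist_norm simp flip: scaleR_2)
    ultimately show False using q s R by simp
  qed
  then have "2 \<le> card P" using card_mono[OF P(1), of "{p, q}"] p q by simp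
  then show ?thesis using that P measure by blast
qed

section \<open>Twice continuously differentiable maps\<close>

definition C2_on :: "'a::euclidean_space set \<Rightarrow> ('a \<Rightarrow> 'b::euclidean_space) \<Rightarrow> bool" where
  "C2_on V f \<longleftrightarrow>
     (\<exists>D1 :: 'a \<Rightarrow> ('a \<Rightarrow>\<^sub>L 'b). \<exists>D2 :: 'a \<Rightarrow> ('a \<Rightarrow>\<^sub>L ('a \<Rightarrow>\<^sub>L 'b)).
        (\<forall>x\<in>V. (f has_derivative blinfun_apply (D1 x)) (at x)) \<and>
        (\<forall>x\<in>V. (D1 has_derivative blinfun_apply (D2 x)) (at x)) \<and>
        continuous_on V D2)"

lemma C2_onI:
  fixes D1 :: "'a::euclidean_space \<Rightarrow> ('a \<Rightarrow>\<^sub>L 'b::euclidean_space)"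
  assumes "\<And>x. x \<in> V \<Longrightarrow> (f has_derivative blinfun_apply (D1 x)) (at x)"
    and "\<And>x. x \<in> V \<Longrightarrow> (D1 has_derivative D2 x) (at x)"
    and "\<And>i. i \<in> Basis \<Longrightarrow> continuous_on V (\<lambda>x. D2 x i)"
  shows "C2_on V f"
proof -
  have app: "blinfun_apply (Blinfun (D2 x)) = D2 x" if "x \<in> V" for x
    using assms(2)[OF that] has_derivative_bounded_linear bounded_linear_Blinfun_apply by blast
  have "continuous_on V (\<lambda>x. Blinfun (D2 x))"
  proof (rule continuous_on_blinfun_componentwise)
    fix i :: 'a assume "i \<in> Basis"
    from assms(3)[OF this] show "continuous_on V (\<lambda>x. blinfun_apply (Blinfun (D2 x)) i)"
      by (rule continuous_on_eq) (simp add: app)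
  qed
  then show ?thesis
    unfolding C2_on_def using assms(1,2) app
    by (intro exI[of _ D1] exI[of _ "\<lambda>x. Blinfun (D2 x)"]) auto
qed

lemma C2_on_bounded_linear: "bounded_linear f \<Longrightarrow> C2_on V f"
  by (rule C2_onI[of _ _ "\<lambda>x. Blinfun f" "\<lambda>x w. 0"])
    (auto simp: bounded_linear_Blinfun_apply bounded_linear_imp_has_derivative)

lemma C2_on_const: "C2_on V (\<lambda>x. c)"
  by (rule C2_onI[of _ _ "\<lambda>x. 0" "\<lambda>x w. 0"])
    (auto intro: has_derivative_eq_rhs[OF has_derivative_const] simp: fun_eq_iff)

lemma C2_on_add:
  assumes "C2_on V f" "C2_on V g"
  shows "C2_on V (\<lambda>x. f x + g x)"
proof -
  obtain F1 F2 where F: "\<And>x. x \<in> V \<Longrightarrow> (f has_derivative blinfun_apply (F1 x)) (at x)"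
    "\<And>x. x \<in> V \<Longrightarrow> (F1 has_derivative blinfun_apply (F2 x)) (at x)" "continuous_on V F2"
    using assms(1) unfolding C2_on_def by blast
  obtain G1 G2 where G: "\<And>x. x \<in> V \<Longrightarrow> (g has_derivative blinfun_apply (G1 x)) (at x)"
    "\<And>x. x \<in> V \<Longrightarrow> (G1 has_derivative blinfun_apply (G2 x)) (at x)" "continuous_on V G2"
    using assms(2) unfolding C2_on_def by blast
  show ?thesis
  proof (rule C2_onI)
    show "((\<lambda>x. f x + g x) has_derivative blinfun_apply (F1 x + G1 x)) (at x)" if "x \<in> V" for x
      using has_derivative_add[OF F(1)[OF that] G(1)[OF that]]
      by (rule has_derivative_eq_rhs) (simp add: fun_eq_iff blinfun.add_left)
    show "((\<lambda>x. F1 x + G1 x) has_derivative (\<lambda>w. F2 x w + G2 x w)) (at x)" if "x \<in> V" for x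
      using has_derivative_add[OF F(2)[OF that] G(2)[OF that]] .
    show "continuous_on V (\<lambda>x. F2 x i + G2 x i)" for i
      by (intro continuous_intros F G)
  qed
qed

lemma C2_on_sum: "(\<And>i. i \<in> I \<Longrightarrow> C2_on V (f i)) \<Longrightarrow> C2_on V (\<lambda>x. \<Sum>i\<in>I. f i x)"
  by (induction I rule: infinite_finite_induct) (auto intro: C2_on_const C2_on_add)

lemma C2_on_compose:
  assumes "C2_on W f" "C2_on V g" "g ` V \<subseteq> W"
  shows "C2_on V (\<lambda>x. f (g x))"
proof -
  obtain F1 F2 where F: "\<And>x. x \<in> W \<Longrightarrow> (f has_derivative blinfun_apply (F1 x)) (at x)"
    "\<And>x. x \<in> W \<Longrightarrow> (F1 has_derivative blinfun_apply (F2 x)) (at x)" "continuous_on W F2"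
    using assms(1) unfolding C2_on_def by blast
  obtain G1 G2 where G: "\<And>x. x \<in> V \<Longrightarrow> (g has_derivative blinfun_apply (G1 x)) (at x)"
    "\<And>x. x \<in> V \<Longrightarrow> (G1 has_derivative blinfun_apply (G2 x)) (at x)" "continuous_on V G2"
    using assms(2) unfolding C2_on_def by blast
  have W: "g x \<in> W" if "x \<in> V" for x using assms(3) that by auto
  have FG: "((\<lambda>x. F1 (g x)) has_derivative (\<lambda>w. F2 (g x) (G1 x w))) (at x)" if "x \<in> V" for x
    using has_derivative_compose[OF G(1)[OF that] F(2)[OF W[OF that]]] by simp
  have cg: "continuous_on V g" "continuous_on V G1" "continuous_on V (\<lambda>x. F1 (g x))"
    using G(1,2) FG by (auto intro!: continuous_at_imp_continuous_on has_derivative_continuous)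
  have cF: "continuous_on V (\<lambda>x. F2 (g x))"
    using continuous_on_compose2[OF F(3) cg(1) assms(3)] .
  show ?thesis
  proof (rule C2_onI)
    show "((\<lambda>x. f (g x)) has_derivative blinfun_apply (F1 (g x) o\<^sub>L G1 x)) (at x)" if "x \<in> V" for x
      using has_derivative_compose[OF G(1)[OF that] F(1)[OF W[OF that]]]
      by (rule has_derivative_eq_rhs) (simp add: fun_eq_iff)
    show "((\<lambda>x. F1 (g x) o\<^sub>L G1 x) has_derivative
        (\<lambda>w. (F1 (g x) o\<^sub>L G2 x w) + (F2 (g x) (G1 x w) o\<^sub>L G1 x))) (at x)" if "x \<in> V" for x
      using bounded_bilinear.FDERIV[OF bounded_bilinear_blinfun_compose FG[OF that] G(2)[OF that]] .
    show "continuous_on V (\<lambda>x. (F1 (g x) o\<^sub>L G2 x i) + (F2 (g x) (G1 x i) o\<^sub>L G1 x))" for i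
      by (intro continuous_intros cg cF G(3)
          bounded_bilinear.continuous_on[OF bounded_bilinear_blinfun_compose])
  qed
qed

lemma C2_on_inner_self: "C2_on V (\<lambda>x. x \<bullet> x)"
proof (rule C2_onI)
  fix x :: 'a
  show "((\<lambda>x. x \<bullet> x) has_derivative blinfun_apply (2 *\<^sub>R blinfun_inner_left x)) (at x)"
    by (auto intro!: derivative_eq_intros simp: fun_eq_iff blinfun.scaleR_left inner_commute)
  have "bounded_linear (\<lambda>x::'a. 2 *\<^sub>R blinfun_inner_left x)"
    by (intro bounded_linear_intros)
  then show "((\<lambda>x. 2 *\<^sub>R blinfun_inner_left x) has_derivative (\<lambda>w. 2 *\<^sub>R blinfun_inner_left w)) (at x)"
    by (rule bounded_linear_imp_has_derivative)
qed auto

lemma C2_on_real: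
  fixes g :: "real \<Rightarrow> real"
  assumes "\<And>t. t \<in> V \<Longrightarrow> (g has_field_derivative g' t) (at t)"
    "\<And>t. t \<in> V \<Longrightarrow> (g' has_field_derivative g'' t) (at t)" "continuous_on V g''"
  shows "C2_on V g"
proof (rule C2_onI)
  fix t assume t: "t \<in> V"
  show "(g has_derivative blinfun_apply (g' t *\<^sub>R id_blinfun)) (at t)"
    using assms(1)[OF t] unfolding has_field_derivative_def
    by (rule has_derivative_eq_rhs) (simp add: fun_eq_iff blinfun.scaleR_left)
  show "((\<lambda>t. g' t *\<^sub>R id_blinfun) has_derivative (\<lambda>h. (g'' t * h) *\<^sub>R id_blinfun)) (at t)"
    using assms(2)[OF t] unfolding has_field_derivative_def by (intro derivative_eq_intros) auto
next
  show "continuous_on V (\<lambda>t. (g'' t * i) *\<^sub>R id_blinfun)" for i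
    by (intro continuous_intros assms)
qed

lemma C2_on_imp_continuous_on: "C2_on V f \<Longrightarrow> continuous_on V f"
  unfolding C2_on_def by (meson continuous_at_imp_continuous_on has_derivative_continuous)

lemma expanding_derivative_norm_ge:
  assumes f: "(f has_derivative D) (at x)" and V: "open V" "x \<in> V"
    and exp: "\<And>y. y \<in> V \<Longrightarrow> c * dist x y \<le> dist (f x) (f y)"
  shows "c * norm w \<le> norm (D w)"
proof (cases "w = 0")
  case False
  show ?thesis
  proof (rule field_le_epsilon)
    fix e :: real assume e: "0 < e"
    then obtain r where r: "0 < r"
      "\<And>y. norm (y - x) < r \<Longrightarrow> norm (f y - f x - D (y - x)) \<le> e / norm w * norm (y - x)"
      using f False unfolding has_derivative_at_alt by (metis divide_pos_pos zero_less_norm_iff)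
    obtain s where s: "0 < s" "ball x s \<subseteq> V" using V openE by blast
    define t where "t = min r s / (2 * norm w)"
    have t: "0 < t" "t * norm w < r" "t * norm w < s"
      using r s False by (auto simp: t_def min_def)
    then have "x + t *\<^sub>R w \<in> V" using s by (auto simp: dist_norm)
    then have "c * (t * norm w) \<le> norm (f (x + t *\<^sub>R w) - f x)"
      using exp[of "x + t *\<^sub>R w"] t by (simp add: dist_norm norm_minus_commute)
    also have "\<dots> \<le> norm (D (t *\<^sub>R w)) + norm (f (x + t *\<^sub>R w) - f x - D (t *\<^sub>R w))"
      by (metis add.commute diff_add_cancel norm_triangle_ineq)
    also have "\<dots> \<le> t * norm (D w) + e * t"
      using r(2)[of "x + t *\<^sub>R w"] t False linear_cmul[OF has_derivative_linear[OF f], of t w] by simp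
    finally have "t * (c * norm w) \<le> t * (norm (D w) + e)" by (simp add: algebra_simps)
    then show "c * norm w \<le> norm (D w) + e" using t(1) by simp
  qed
qed simp

lemma C2_immersion_onI:
  assumes V: "open V" and f: "C2_on V f" and c: "0 < c"
    and exp: "\<And>x y. x \<in> V \<Longrightarrow> y \<in> V \<Longrightarrow> c * dist x y \<le> dist (f x) (f y)"
  shows "C2_immersion_on V f"
proof -
  obtain D1 D2 where D: "\<And>x. x \<in> V \<Longrightarrow> (f has_derivative blinfun_apply (D1 x)) (at x)"
    "\<And>x. x \<in> V \<Longrightarrow> (D1 has_derivative blinfun_apply (D2 x)) (at x)" "continuous_on V D2"
    using f unfolding C2_on_def by blast
  have "w = 0" if "x \<in> V" "D1 x w = 0" for x w
    using expanding_derivative_norm_ge[OF D(1) V, of x c w] exp that c by (simp add: mult_le_0_iff)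
  then have "inj (blinfun_apply (D1 x))" if "x \<in> V" for x
    using that by (simp add: linear_injective_0 bounded_linear.linear blinfun.bounded_linear_right)
  then show ?thesis unfolding C2_immersion_on_def using D by blast
qed

lemma C2_on_hemisphere_graph:
  assumes "0 < R"
  shows "C2_on (ball (0::'a::euclidean_space) R) (hemisphere_graph R)"
proof -
  have "C2_on {0<..} sqrt"
  proof (rule C2_on_real)
    fix t :: real assume "t \<in> {0<..}"
    then have t: "0 < t" by simp
    show "(sqrt has_field_derivative inverse (sqrt t) / 2) (at t)" using t by (rule DERIV_real_sqrt)
    show "((\<lambda>t. inverse (sqrt t) / 2) has_field_derivative
        - (inverse (sqrt t) * (inverse (sqrt t) / 2) * inverse (sqrt t)) / 2) (at t)"
      using t by (auto intro!: derivative_eq_intros)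
  qed (auto intro!: continuous_intros)
  moreover have "C2_on (ball (0::'a) R) (\<lambda>x. R\<^sup>2 + (-1) *\<^sub>R (x \<bullet> x))"
    by (intro C2_on_add C2_on_const bounded_linear_scaleR_right
        C2_on_compose[OF C2_on_bounded_linear C2_on_inner_self, where W=UNIV and f="\<lambda>x. (-1) *\<^sub>R x"]) auto
  moreover have "(\<lambda>x::'a. R\<^sup>2 + (-1) *\<^sub>R (x \<bullet> x)) ` ball 0 R \<subseteq> {0<..}"
    using assms by (auto simp: dot_square_norm power_strict_mono)
  ultimately have "C2_on (ball (0::'a) R) (\<lambda>x. sqrt (R\<^sup>2 + (-1) *\<^sub>R (x \<bullet> x)))"
    by (rule C2_on_compose)
  then have "C2_on (ball (0::'a) R) (\<lambda>x. (0::'a, sqrt (R\<^sup>2 + (-1) *\<^sub>R (x \<bullet> x))))"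
    by (rule C2_on_compose[rotated, where f="\<lambda>t. (0::'a, t)" and W=UNIV])
      (auto intro!: C2_on_bounded_linear bounded_linear_Pair)
  moreover have "C2_on (ball (0::'a) R) (\<lambda>x. (x, 0::real))"
    by (intro C2_on_bounded_linear bounded_linear_Pair bounded_linear_ident bounded_linear_zero)
  ultimately have "C2_on (ball (0::'a) R) (\<lambda>x. (x, 0) + (0, sqrt (R\<^sup>2 + (-1) *\<^sub>R (x \<bullet> x))))"
    by (rule C2_on_add[rotated])
  then show ?thesis
    by (simp add: hemisphere_graph_def[abs_def] dot_square_norm)
qed

lemma C2_on_linear: "linear f \<Longrightarrow> C2_on V (f :: 'a::euclidean_space \<Rightarrow> 'b::euclidean_space)"
  by (simp add: C2_on_bounded_linear linear_conv_bounded_linear)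

lemma C2_on_sphere_chart:
  assumes "c \<noteq> 0"
  shows "C2_on (ball 0 (norm c)) (sphere_chart (c :: 'a::euclidean_space \<times> real))"
proof -
  have "linear (householder (0, norm c) c)"
    by (rule orthogonal_transformation_linear[OF orthogonal_transformation_householder])
  from C2_on_compose[OF C2_on_linear[OF this] C2_on_hemisphere_graph, of "norm c" UNIV] show ?thesis
    using assms by (simp add: sphere_chart_def[abs_def])
qed

lemma homeomorphism_sphere_chart:
  fixes c :: "'a::euclidean_space \<times> real"
  assumes "c \<noteq> 0"
  shows "homeomorphism (ball 0 (norm c)) {y \<in> sphere 0 (norm c). 0 < y \<bullet> c}
    (sphere_chart c) (sphere_chart_inv c)"
  unfolding sphere_chart_image[OF assms, symmetric]
proof (rule homeomorphismI)
  show "continuous_on (ball 0 (norm c)) (sphere_chart c)"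
    by (rule C2_on_imp_continuous_on[OF C2_on_sphere_chart[OF assms]])
  have "1-lipschitz_on UNIV (sphere_chart_inv c)"
    by (rule lipschitz_onI) (simp_all add: dist_sphere_chart_inv_le)
  then show "continuous_on (sphere_chart c ` ball 0 (norm c)) (sphere_chart_inv c)"
    using lipschitz_on_continuous_on continuous_on_subset by blast
qed auto

lemma C2_submanifold_sphere_image:
  fixes \<Psi> :: "(real^'d::finite) \<times> real \<Rightarrow> real^'n::finite"
  assumes R: "0 < R" and C2: "C2_on UNIV \<Psi>" and c: "0 < c"
    and exp: "\<And>x y. c * dist x y \<le> dist (\<Psi> x) (\<Psi> y)"
  shows "C2_submanifold TYPE('d) (\<Psi> ` sphere 0 R)"
  unfolding C2_submanifold_def
proof
  let ?S = "sphere (0::(real^'d) \<times> real) R"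
  fix p assume "p \<in> \<Psi> ` ?S"
  then obtain x where x: "norm x = R" "p = \<Psi> x" by auto
  then have x0: "x \<noteq> 0" using R by auto
  let ?T = "{y \<in> ?S. 0 < y \<bullet> x}" and ?V = "ball (0::real^'d) R"
  have "inj_on \<Psi> ?S"
  proof (rule inj_onI)
    fix y z assume "\<Psi> y = \<Psi> z"
    then show "y = z" using exp[of y z] c by (simp add: mult_le_0_iff)
  qed
  then obtain g where g: "homeomorphism ?S (\<Psi> ` ?S) \<Psi> g"
    using homeomorphism_compact[OF compact_sphere] C2_on_imp_continuous_on[OF C2] continuous_on_subset
    by (metis subset_UNIV)
  have "openin (top_of_set ?S) ?T"
    using openin_open_Int[of "{y. 0 < y \<bullet> x}" ?S] open_halfspace_gt[of 0 x]
    by (simp add: inner_commute Int_def conj_commute)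
  then have "openin (top_of_set (\<Psi> ` ?S)) (\<Psi> ` ?T)" by (rule homeomorphism_imp_open_map[OF g])
  then obtain U where U: "open U" "\<Psi> ` ?T = \<Psi> ` ?S \<inter> U" by (auto simp: openin_open)
  have "C2_immersion_on ?V (\<lambda>a. \<Psi> (sphere_chart x a))"
  proof (rule C2_immersion_onI[OF open_ball _ c])
    show "C2_on ?V (\<lambda>a. \<Psi> (sphere_chart x a))"
      using C2_on_compose[OF C2 C2_on_sphere_chart[OF x0]] x by simp
    show "c * dist a b \<le> dist (\<Psi> (sphere_chart x a)) (\<Psi> (sphere_chart x b))" for a b
      using order_trans[OF mult_left_mono[OF dist_le_sphere_chart] exp] c by simp
  qed
  moreover have "homeomorphism ?V (\<Psi> ` ?S \<inter> U) (\<Psi> \<circ> sphere_chart x) (sphere_chart_inv x \<circ> g)"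
  proof (rule homeomorphism_compose)
    show "homeomorphism ?V ?T (sphere_chart x) (sphere_chart_inv x)"
      using homeomorphism_sphere_chart[OF x0] x by simp
    show "homeomorphism ?T (\<Psi> ` ?S \<inter> U) \<Psi> g"
      unfolding U(2)[symmetric] by (rule homeomorphism_of_subsets[OF g]) auto
  qed
  moreover have "p \<in> U" using U(2) x x0 by auto
  ultimately show "\<exists>U V. \<exists>\<phi> :: real^'d \<Rightarrow> real^'n. \<exists>\<psi>.
      open U \<and> p \<in> U \<and> open V \<and> C2_immersion_on V \<phi> \<and> homeomorphism V (\<Psi> ` ?S \<inter> U) \<phi> \<psi>"
    using U(1) by (auto simp: comp_def)
qed

section \<open>Reach of sphere images\<close>

text \<open>Federer's criterion: at equidistant nearest points \<open>p, q\<close> of \<open>z\<close> one has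
  \<open>2 (z - p) \<bullet> (q - p) = \<parallel>q - p\<parallel>\<^sup>2\<close>.\<close>
lemma reach_geI:
  fixes M :: "'a::real_inner set"
  assumes "\<And>z p q. p \<in> M \<Longrightarrow> q \<in> M \<Longrightarrow> (\<And>y. y \<in> M \<Longrightarrow> dist p z \<le> dist y z) \<Longrightarrow>
      2 * r * ((z - p) \<bullet> (q - p)) \<le> norm (z - p) * (norm (q - p))\<^sup>2"
  shows "ereal r \<le> reach M"
  unfolding reach_def
proof (rule INF_greatest)
  fix z assume "z \<in> medial_axis M"
  then obtain p q where pq: "p \<in> M" "q \<in> M" "p \<noteq> q"
    and z: "ereal (dist p z) = einfdist z M" "ereal (dist q z) = einfdist z M"
    by (auto simp: medial_axis_def)
  then have eq: "dist p z = dist q z" by (metis ereal.inject)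
  have "dist p z \<le> dist y z" if "y \<in> M" for y
    using z(1) that unfolding einfdist_def by (metis INF_lower ereal_less_eq(3))
  then have "2 * r * ((z - p) \<bullet> (q - p)) \<le> norm (z - p) * (norm (q - p))\<^sup>2"
    by (intro assms pq)
  moreover have "2 * ((z - p) \<bullet> (q - p)) = (norm (q - p))\<^sup>2"
    using inner_diff_same_norm[of "z - p" "z - q"] eq
    by (simp add: dist_norm norm_minus_commute inner_commute)
  ultimately have "r * (norm (q - p))\<^sup>2 \<le> norm (z - p) * (norm (q - p))\<^sup>2"
    by (metis mult.assoc mult.commute)
  then have "r \<le> norm (z - p)" using pq(3) by simp
  then show "ereal r \<le> einfdist z M" by (simp add: z(1)[symmetric] dist_norm norm_minus_commute)
qed

lemma nearest_point_normal_to_curve: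
  fixes \<gamma> :: "real \<Rightarrow> 'a::real_inner"
  assumes \<gamma>: "(\<gamma> has_vector_derivative w) (at 0)" and nearest: "\<And>t. dist (\<gamma> 0) z \<le> dist (\<gamma> t) z"
  shows "(z - \<gamma> 0) \<bullet> w = 0"
proof -
  have "((\<lambda>t. (z - \<gamma> t) \<bullet> (z - \<gamma> t)) has_derivative (\<lambda>s. s * (- 2 * ((z - \<gamma> 0) \<bullet> w)))) (at 0)"
    using \<gamma> unfolding has_vector_derivative_def
    by (auto intro!: derivative_eq_intros simp: inner_commute algebra_simps)
  then have "((\<lambda>t. (z - \<gamma> t) \<bullet> (z - \<gamma> t)) has_real_derivative - 2 * ((z - \<gamma> 0) \<bullet> w)) (at 0)"
    unfolding has_field_derivative_def by (rule has_derivative_eq_rhs) (simp add: fun_eq_iff)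
  moreover have "(z - \<gamma> 0) \<bullet> (z - \<gamma> 0) \<le> (z - \<gamma> t) \<bullet> (z - \<gamma> t)" for t
    using nearest[of t]
    by (auto simp: dot_square_norm dist_norm norm_minus_commute intro: power_mono)
  ultimately have "- 2 * ((z - \<gamma> 0) \<bullet> w) = 0" by (intro DERIV_local_min[of _ _ 0 1]) auto
  then show ?thesis by simp
qed

lemma great_circle_on_sphere:
  fixes p u :: "'a::real_inner"
  assumes "norm p = R" "norm u = R" "u \<bullet> p = 0"
  shows "norm (cos \<theta> *\<^sub>R p + sin \<theta> *\<^sub>R u) = R"
proof -
  have "orthogonal (cos \<theta> *\<^sub>R p) (sin \<theta> *\<^sub>R u)"
    using assms(3) by (simp add: orthogonal_def inner_commute)
  then have "(norm (cos \<theta> *\<^sub>R p + sin \<theta> *\<^sub>R u))\<^sup>2 = R\<^sup>2"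
    using assms by (simp only: norm_add_Pythagorean) (simp add: power_mult_distrib flip: distrib_right)
  then show ?thesis using assms(1) by (auto intro: power2_eq_imp_eq)
qed

lemma nearest_point_normal_to_sphere_image:
  fixes \<Psi> :: "'a::real_inner \<Rightarrow> 'b::real_inner"
  assumes R: "0 < R" and p: "norm p = R" and D: "(\<Psi> has_derivative D) (at p)"
    and nearest: "\<And>y. y \<in> sphere 0 R \<Longrightarrow> dist (\<Psi> p) z \<le> dist (\<Psi> y) z"
    and w: "w \<bullet> p = 0"
  shows "(z - \<Psi> p) \<bullet> D w = 0"
proof (cases "w = 0")
  case True
  then show ?thesis using has_derivative_linear[OF D] by (simp add: linear_0)
next
  case False
  define u where "u = (R / norm w) *\<^sub>R w"
  define \<gamma> where "\<gamma> \<theta> = cos \<theta> *\<^sub>R p + sin \<theta> *\<^sub>R u" for \<theta>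
  have "\<gamma> \<theta> \<in> sphere 0 R" for \<theta>
    using great_circle_on_sphere[OF p, of u] False R w by (simp add: \<gamma>_def u_def)
  moreover have \<gamma>0: "\<gamma> 0 = p" by (simp add: \<gamma>_def)
  moreover have "((\<lambda>\<theta>. \<Psi> (\<gamma> \<theta>)) has_vector_derivative D u) (at 0)"
  proof -
    have "(\<gamma> has_derivative (\<lambda>s. s *\<^sub>R u)) (at 0)"
      unfolding \<gamma>_def by (auto intro!: derivative_eq_intros)
    then have "((\<lambda>\<theta>. \<Psi> (\<gamma> \<theta>)) has_derivative (\<lambda>s. D (s *\<^sub>R u))) (at 0)"
      using has_derivative_compose[of \<gamma> _ 0 UNIV \<Psi>] D by (simp add: \<gamma>0)
    then show ?thesis
      using has_derivative_linear[OF D] by (simp add: has_vector_derivative_def linear_cmul)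
  qed
  ultimately have "(z - \<Psi> p) \<bullet> D u = 0"
    using nearest_point_normal_to_curve[of "\<lambda>\<theta>. \<Psi> (\<gamma> \<theta>)" "D u" z] nearest by simp
  then show ?thesis
    using False R linear_cmul[OF has_derivative_linear[OF D], of "R / norm w" w]
    by (simp add: u_def)
qed

lemma sphere_image_normal_secant_le:
  fixes \<Psi> :: "'a::real_inner \<Rightarrow> 'b::real_inner"
  assumes R: "0 < R" and pq: "norm p = R" "norm q = R" and D: "linear D" "norm (D p) \<le> b * R"
    and normal: "\<And>w. w \<bullet> p = 0 \<Longrightarrow> \<nu> \<bullet> D w = 0"
    and rem: "norm (\<Psi> q - \<Psi> p - D (q - p)) \<le> K * (norm (q - p))\<^sup>2"
  shows "2 * (\<nu> \<bullet> (\<Psi> q - \<Psi> p)) \<le> norm \<nu> * ((b / R + 2 * K) * (norm (q - p))\<^sup>2)"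
proof -
  define c where "c = (norm (q - p))\<^sup>2 / (2 * R\<^sup>2)"
  have "(q - p) \<bullet> p = - c * (p \<bullet> p)"
    using inner_diff_same_norm[of p q] pq R
    by (simp add: c_def dot_square_norm norm_minus_commute[of q] inner_diff_left)
  then have "\<nu> \<bullet> D (q - p + c *\<^sub>R p) = 0" by (intro normal) (simp add: inner_add_left)
  then have "\<nu> \<bullet> D (q - p) = - c * (\<nu> \<bullet> D p)"
    by (simp add: linear_add[OF D(1)] linear_cmul[OF D(1)] inner_add_right)
  also have "\<dots> \<le> c * (norm \<nu> * (b * R))"
  proof -
    have "- (\<nu> \<bullet> D p) \<le> norm \<nu> * norm (D p)" using Cauchy_Schwarz_ineq2[of \<nu> "D p"] by linarith
    also have "\<dots> \<le> norm \<nu> * (b * R)" using D(2) by (intro mult_left_mono) auto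
    finally have "c * - (\<nu> \<bullet> D p) \<le> c * (norm \<nu> * (b * R))"
      by (intro mult_left_mono) (auto simp: c_def)
    then show ?thesis by simp
  qed
  also have "\<dots> = norm \<nu> * (b / R * (norm (q - p))\<^sup>2) / 2"
    using R by (simp add: c_def power2_eq_square field_simps)
  finally have tangential: "\<nu> \<bullet> D (q - p) \<le> norm \<nu> * (b / R * (norm (q - p))\<^sup>2) / 2" .
  have "\<nu> \<bullet> (\<Psi> q - \<Psi> p - D (q - p)) \<le> norm \<nu> * (K * (norm (q - p))\<^sup>2)"
    using norm_cauchy_schwarz mult_left_mono[OF rem norm_ge_zero] by (rule order_trans)
  then show ?thesis using tangential by (simp add: inner_diff_right algebra_simps)
qed

lemma reach_sphere_image_ge:
  fixes \<Psi> :: "'a::real_inner \<Rightarrow> 'b::real_inner"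
  assumes R: "0 < R" and a: "0 \<le> a" and r: "0 \<le> r"
    and D: "\<And>x. (\<Psi> has_derivative D x) (at x)"
    and normD: "\<And>x w. norm (D x w) \<le> b * norm w"
    and rem: "\<And>x y. norm (\<Psi> y - \<Psi> x - D x (y - x)) \<le> K * (norm (y - x))\<^sup>2"
    and exp: "\<And>x y. a * dist x y \<le> dist (\<Psi> x) (\<Psi> y)"
    and curvature: "r * (b / R + 2 * K) \<le> a\<^sup>2"
  shows "ereal r \<le> reach (\<Psi> ` sphere 0 R)"
proof (rule reach_geI)
  fix z P Q
  assume PQ: "P \<in> \<Psi> ` sphere 0 R" "Q \<in> \<Psi> ` sphere 0 R"
    and nearest: "\<And>y. y \<in> \<Psi> ` sphere 0 R \<Longrightarrow> dist P z \<le> dist y z"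
  from PQ obtain p q where p: "norm p = R" "P = \<Psi> p" and q: "norm q = R" "Q = \<Psi> q" by auto
  define \<nu> where "\<nu> = z - \<Psi> p"
  have "\<nu> \<bullet> D p w = 0" if "w \<bullet> p = 0" for w
    using nearest_point_normal_to_sphere_image[OF R p(1) D _ that] nearest p by (simp add: \<nu>_def)
  then have "2 * (\<nu> \<bullet> (\<Psi> q - \<Psi> p)) \<le> norm \<nu> * ((b / R + 2 * K) * (norm (q - p))\<^sup>2)"
    using sphere_image_normal_secant_le[OF R p(1) q(1) has_derivative_linear[OF D[of p]] _ _ rem]
      normD[of p p] p(1)
    by blast
  then have "r * (2 * (\<nu> \<bullet> (\<Psi> q - \<Psi> p))) \<le> r * (norm \<nu> * ((b / R + 2 * K) * (norm (q - p))\<^sup>2))"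
    using r by (rule mult_left_mono)
  also have "\<dots> = norm \<nu> * (r * (b / R + 2 * K) * (norm (q - p))\<^sup>2)" by (simp only: ac_simps)
  also have "\<dots> \<le> norm \<nu> * (a\<^sup>2 * (norm (q - p))\<^sup>2)"
    using curvature by (intro mult_left_mono mult_right_mono) auto
  also have "\<dots> \<le> norm \<nu> * (norm (\<Psi> q - \<Psi> p))\<^sup>2"
    using exp[of q p] a unfolding dist_norm power_mult_distrib[symmetric]
    by (intro mult_left_mono power_mono) auto
  finally show "2 * r * ((z - P) \<bullet> (Q - P)) \<le> norm (z - P) * (norm (Q - P))\<^sup>2"
    by (simp add: \<nu>_def p q mult.assoc mult.left_commute)
qed

section \<open>Bumps\<close>

lemma DERIV_max_0_power:
  fixes x :: real
  shows "((\<lambda>x. max 0 x ^ (k + 2)) has_real_derivative real (k + 2) * max 0 x ^ (k + 1)) (at x)"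
proof (cases x "0::real" rule: linorder_cases)
  case less
  have "((\<lambda>x. 0) has_real_derivative 0) (at x)" by simp
  then have "((\<lambda>x. max 0 x ^ (k + 2)) has_real_derivative 0) (at x)"
    by (rule has_field_derivative_transform_within_open[where S="{..<0}"]) (use less in auto)
  then show ?thesis using less by simp
next
  case greater
  have "((\<lambda>x. x ^ (k + 2)) has_real_derivative real (k + 2) * x ^ (k + 1)) (at x)"
    using DERIV_pow[of "k + 2" x] by simp
  then have "((\<lambda>x. max 0 x ^ (k + 2)) has_real_derivative real (k + 2) * x ^ (k + 1)) (at x)"
    by (rule has_field_derivative_transform_within_open[where S="{0<..}"]) (use greater in auto)
  then show ?thesis using greater by simp
next
  case equal
  have "((\<lambda>h::real. max 0 h ^ (k + 2) / h) \<longlongrightarrow> 0) (at 0)"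
  proof (rule Lim_null_comparison)
    have "norm (max 0 h ^ (k + 2) / h) \<le> \<bar>h\<bar> ^ (k + 1)" for h :: real
    proof (cases "0 < h")
      case False
      then have "norm (max 0 h ^ (k + 2) / h) = 0" by (simp add: max_absorb1)
      then show ?thesis using zero_le_power[OF abs_ge_zero, of h "k + 1"] by linarith
    qed simp
    then show "\<forall>\<^sub>F h in at 0. norm (max 0 h ^ (k + 2) / h) \<le> \<bar>h\<bar> ^ (k + 1)"
      by (intro always_eventually allI)
    show "((\<lambda>h::real. \<bar>h\<bar> ^ (k + 1)) \<longlongrightarrow> 0) (at 0)"
      by (auto intro!: tendsto_eq_intros)
  qed
  then show ?thesis using equal by (simp add: has_field_derivative_iff)
qed

definition bump :: "'a::real_inner \<Rightarrow> real" where
  "bump u = max 0 (1 - u \<bullet> u) ^ 3"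

definition bump_deriv :: "'a::real_inner \<Rightarrow> 'a \<Rightarrow> real" where
  "bump_deriv u w = - 6 * (max 0 (1 - u \<bullet> u))\<^sup>2 * (u \<bullet> w)"

lemma bump_0 [simp]: "bump 0 = 1"
  by (simp add: bump_def)

lemma bump_range: "0 \<le> bump u" "bump u \<le> 1"
  by (auto simp: bump_def intro: power_le_one)

lemma bump_support:
  assumes "1 \<le> norm u"
  shows "bump u = 0" "bump_deriv u w = 0"
proof -
  have "1 \<le> u \<bullet> u" using assms power_mono[of 1 "norm u" 2] by (simp add: dot_square_norm)
  then show "bump u = 0" "bump_deriv u w = 0" by (auto simp: bump_def bump_deriv_def)
qed

lemma bump_deriv_scaleR: "bump_deriv u (c *\<^sub>R w) = c * bump_deriv u w"
  by (simp add: bump_deriv_def)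

lemma DERIV_cut_power:
  fixes t :: real
  shows "((\<lambda>t. max 0 (1 - t) ^ 3) has_real_derivative - 3 * (max 0 (1 - t))\<^sup>2) (at t)"
    and "((\<lambda>t. (max 0 (1 - t))\<^sup>2) has_real_derivative - 2 * max 0 (1 - t)) (at t)"
proof -
  have g: "((\<lambda>t. 1 - t) has_real_derivative - 1) (at t)" by (auto intro!: derivative_eq_intros)
  show "((\<lambda>t. max 0 (1 - t) ^ 3) has_real_derivative - 3 * (max 0 (1 - t))\<^sup>2) (at t)"
    using DERIV_chain2[where f="\<lambda>x. max 0 x ^ (1 + 2)" and g="\<lambda>t. 1 - t", OF DERIV_max_0_power g]
    by (simp add: numeral_3_eq_3 numeral_2_eq_2)
  show "((\<lambda>t. (max 0 (1 - t))\<^sup>2) has_real_derivative - 2 * max 0 (1 - t)) (at t)"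
    using DERIV_chain2[where f="\<lambda>x. max 0 x ^ (0 + 2)" and g="\<lambda>t. 1 - t", OF DERIV_max_0_power g]
    by (simp add: numeral_2_eq_2)
qed

definition bump_second_deriv :: "'a::real_inner \<Rightarrow> 'a \<Rightarrow> real" where
  "bump_second_deriv u w = 24 * max 0 (1 - u \<bullet> u) * (u \<bullet> w)\<^sup>2 - 6 * (max 0 (1 - u \<bullet> u))\<^sup>2 * (w \<bullet> w)"

lemma has_derivative_bump: "(bump has_derivative bump_deriv u) (at u)"
proof -
  have "((\<lambda>u. u \<bullet> u) has_derivative (\<lambda>w. 2 * (u \<bullet> w))) (at u)"
    by (auto intro!: derivative_eq_intros simp: inner_commute)
  from has_derivative_compose[OF this DERIV_cut_power(1)[of "u \<bullet> u", unfolded has_field_derivative_def]]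
  show ?thesis
    unfolding bump_def[abs_def]
    by (rule has_derivative_eq_rhs) (simp add: fun_eq_iff bump_deriv_def)
qed

lemma C2_on_bump: "C2_on V (bump :: 'a::euclidean_space \<Rightarrow> real)"
proof -
  have "C2_on UNIV (\<lambda>t::real. max 0 (1 - t) ^ 3)"
  proof (rule C2_on_real[OF DERIV_cut_power(1)])
    show "((\<lambda>t. - 3 * (max 0 (1 - t))\<^sup>2) has_real_derivative 6 * max 0 (1 - t)) (at t)" for t :: real
      using DERIV_cmult[OF DERIV_cut_power(2)[of t], of "-3"] by simp
  qed (intro continuous_intros)
  from C2_on_compose[OF this C2_on_inner_self] show ?thesis by (simp add: bump_def[abs_def])
qed

lemma bump_along_line:
  fixes u w :: "'a::real_inner"
  shows "((\<lambda>\<tau>. bump (u + \<tau> *\<^sub>R w)) has_real_derivative bump_deriv (u + \<tau> *\<^sub>R w) w) (at \<tau>)"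
    and "((\<lambda>\<tau>. bump_deriv (u + \<tau> *\<^sub>R w) w)
        has_real_derivative bump_second_deriv (u + \<tau> *\<^sub>R w) w) (at \<tau>)"
proof -
  let ?x = "\<lambda>\<tau>. u + \<tau> *\<^sub>R w"
  have x: "(?x has_derivative (\<lambda>s. s *\<^sub>R w)) (at \<tau>)" for \<tau> by (auto intro!: derivative_eq_intros)
  show "((\<lambda>\<tau>. bump (?x \<tau>)) has_real_derivative bump_deriv (?x \<tau>) w) (at \<tau>)"
    using has_derivative_compose[OF x has_derivative_bump]
    by (simp add: has_field_derivative_def bump_deriv_scaleR mult.commute[of _ "bump_deriv _ _"])
  have square: "((\<lambda>\<tau>. ?x \<tau> \<bullet> ?x \<tau>) has_real_derivative 2 * (?x \<tau> \<bullet> w)) (at \<tau>)"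
    unfolding has_field_derivative_def
    by (rule has_derivative_eq_rhs) (auto intro!: derivative_eq_intros simp: inner_commute)
  have linear: "((\<lambda>\<tau>. ?x \<tau> \<bullet> w) has_real_derivative w \<bullet> w) (at \<tau>)"
    unfolding has_field_derivative_def
    by (rule has_derivative_eq_rhs) (auto intro!: derivative_eq_intros)
  have "((\<lambda>\<tau>. - 6 * (max 0 (1 - ?x \<tau> \<bullet> ?x \<tau>))\<^sup>2 * (?x \<tau> \<bullet> w))
      has_real_derivative bump_second_deriv (?x \<tau>) w) (at \<tau>)"
    using DERIV_cmult[OF DERIV_mult[OF DERIV_chain2[OF DERIV_cut_power(2) square] linear], of "-6"]
    by (simp add: bump_second_deriv_def algebra_simps power2_eq_square)
  then show "((\<lambda>\<tau>. bump_deriv (?x \<tau>) w) has_real_derivative bump_second_deriv (?x \<tau>) w) (at \<tau>)"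
    by (simp add: bump_deriv_def)
qed

lemma bump_deriv_bound: "\<bar>bump_deriv u w\<bar> \<le> 6 * norm w"
proof (cases "1 \<le> norm u")
  case True
  then show ?thesis by (simp add: bump_support)
next
  case False
  have "(max 0 (1 - u \<bullet> u))\<^sup>2 \<le> 1" by (intro power_le_one) auto
  then have "(max 0 (1 - u \<bullet> u))\<^sup>2 * \<bar>u \<bullet> w\<bar> \<le> norm u * norm w"
    using Cauchy_Schwarz_ineq2[of u w] mult_mono[of "(max 0 (1 - u \<bullet> u))\<^sup>2" 1 "\<bar>u \<bullet> w\<bar>"
      "norm u * norm w"]
    by simp
  also have "\<dots> \<le> norm w" using False mult_right_mono[of "norm u" 1 "norm w"] by simp
  finally show ?thesis by (simp add: bump_deriv_def abs_mult)
qed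

lemma bump_lipschitz: "\<bar>bump y - bump x\<bar> \<le> 6 * norm (y - x)"
proof -
  obtain \<tau> :: real where "bump (x + 1 *\<^sub>R (y - x)) - bump (x + 0 *\<^sub>R (y - x))
      = (1 - 0) * bump_deriv (x + \<tau> *\<^sub>R (y - x)) (y - x)"
    using MVT2[of 0 1 "\<lambda>\<tau>. bump (x + \<tau> *\<^sub>R (y - x))" "\<lambda>\<tau>. bump_deriv (x + \<tau> *\<^sub>R (y - x)) (y - x)"]
      bump_along_line(1)[of x "y - x"] by auto
  then show ?thesis using bump_deriv_bound[of "x + \<tau> *\<^sub>R (y - x)" "y - x"] by simp
qed

lemma bump_second_deriv_bound: "\<bar>bump_second_deriv u w\<bar> \<le> 6 * (norm w)\<^sup>2"
proof -
  define m where "m = max 0 (1 - u \<bullet> u)"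
  have m: "0 \<le> m" "m \<le> 1" by (auto simp: m_def)
  have "m * (u \<bullet> u) \<le> 1/4"
  proof -
    have "a * (1 - a) \<le> 1/4" for a :: real
      using zero_le_power2[of "a - 1/2"] by (simp add: power2_eq_square algebra_simps)
    from this[of "1 - u \<bullet> u"] show ?thesis by (auto simp: m_def max_def)
  qed
  then have "m * (u \<bullet> u) * (w \<bullet> w) \<le> 1/4 * (w \<bullet> w)" by (rule mult_right_mono) simp
  moreover have "m * (u \<bullet> w)\<^sup>2 \<le> m * (u \<bullet> u) * (w \<bullet> w)"
    using mult_left_mono[OF Cauchy_Schwarz_ineq m(1)] by (simp add: mult.assoc)
  moreover have "0 \<le> m * (u \<bullet> w)\<^sup>2" using m by simp
  moreover have "0 \<le> m\<^sup>2 * (w \<bullet> w)" "m\<^sup>2 * (w \<bullet> w) \<le> 1 * (w \<bullet> w)"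
    using m by (simp, intro mult_right_mono power_le_one) auto
  ultimately show ?thesis
    unfolding bump_second_deriv_def m_def[symmetric] mult.assoc abs_le_iff dot_square_norm[symmetric]
    by (intro conjI; linarith)
qed

lemma bump_taylor: "\<bar>bump y - bump x - bump_deriv x (y - x)\<bar> \<le> 3 * (norm (y - x))\<^sup>2"
proof -
  define w where "w = y - x"
  define diff where "diff n \<tau> = (if n = 0 then bump (x + \<tau> *\<^sub>R w)
      else if n = 1 then bump_deriv (x + \<tau> *\<^sub>R w) w else bump_second_deriv (x + \<tau> *\<^sub>R w) w)"
    for n :: nat and \<tau>
  have "(diff n has_real_derivative diff (Suc n) t) (at t)" if "n < 2" for n t
    using that bump_along_line[of x w t] unfolding diff_def
    by (cases "n = 0") (auto simp: less_2_cases_iff)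
  moreover have "diff 0 = (\<lambda>\<tau>. bump (x + \<tau> *\<^sub>R w))" by (simp add: diff_def fun_eq_iff)
  ultimately obtain t where "bump (x + 1 *\<^sub>R w)
      = (\<Sum>n<2. diff n 0 / fact n * 1 ^ n) + diff 2 t / fact 2 * 1\<^sup>2"
    using Maclaurin[of 1 2 diff "\<lambda>\<tau>. bump (x + \<tau> *\<^sub>R w)"] by auto
  then have "bump y - bump x - bump_deriv x w = bump_second_deriv (x + t *\<^sub>R w) w / 2"
    by (simp add: numeral_2_eq_2 diff_def w_def)
  then show ?thesis using bump_second_deriv_bound[of "x + t *\<^sub>R w" w] by (simp add: w_def)
qed

definition bump_field :: "real \<Rightarrow> real \<Rightarrow> 'a::real_inner set \<Rightarrow> ('a \<Rightarrow> 'b::real_vector) \<Rightarrow> 'a \<Rightarrow> 'b" where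
  "bump_field h \<delta> X v x = (\<Sum>i\<in>X. (h * bump ((x - i) /\<^sub>R \<delta>)) *\<^sub>R v i)"

definition bump_field_deriv ::
  "real \<Rightarrow> real \<Rightarrow> 'a::real_inner set \<Rightarrow> ('a \<Rightarrow> 'b::real_vector) \<Rightarrow> 'a \<Rightarrow> 'a \<Rightarrow> 'b" where
  "bump_field_deriv h \<delta> X v x w = (\<Sum>i\<in>X. (h * bump_deriv ((x - i) /\<^sub>R \<delta>) (w /\<^sub>R \<delta>)) *\<^sub>R v i)"

lemma norm_sum_two_terms_le:
  fixes F :: "'i \<Rightarrow> 'b::real_normed_vector"
  assumes "finite X" "\<And>i. i \<in> X \<Longrightarrow> i \<noteq> a \<Longrightarrow> i \<noteq> b \<Longrightarrow> F i = 0"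
    and "\<And>i. i \<in> X \<Longrightarrow> norm (F i) \<le> c" "0 \<le> c"
  shows "norm (\<Sum>i\<in>X. F i) \<le> 2 * c"
proof -
  have "(\<Sum>i\<in>X. F i) = (\<Sum>i\<in>X \<inter> {a, b}. F i)"
    using assms(1,2) by (intro sum.mono_neutral_right) auto
  also have "norm \<dots> \<le> of_nat (card (X \<inter> {a, b})) * c"
    using assms(3) by (intro sum_norm_bound) auto
  also have "\<dots> \<le> 2 * c"
  proof (rule mult_right_mono)
    have "card (X \<inter> {a, b}) \<le> card {a, b}" by (intro card_mono) auto
    also have "\<dots> \<le> 2" by (simp add: card_insert_if)
    finally show "real (card (X \<inter> {a, b})) \<le> 2" by simp
  qed (rule assms)
  finally show ?thesis .
qed

locale separated_bumps =
  fixes h \<delta> :: real and X :: "'a::euclidean_space set" and v :: "'a \<Rightarrow> 'b::euclidean_space"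
  assumes h: "0 < h" and \<delta>: "0 < \<delta>" and X: "finite X" "dist_separated (2 * \<delta>) X"
    and v: "\<And>i. i \<in> X \<Longrightarrow> norm (v i) \<le> 1"
begin

lemma bump_far_from_site:
  assumes "\<delta> \<le> dist x i"
  shows "bump ((x - i) /\<^sub>R \<delta>) = 0" "bump_deriv ((x - i) /\<^sub>R \<delta>) w = 0"
proof -
  have "1 \<le> norm ((x - i) /\<^sub>R \<delta>)" using assms \<delta> by (simp add: dist_norm) (simp add: field_simps)
  then show "bump ((x - i) /\<^sub>R \<delta>) = 0" "bump_deriv ((x - i) /\<^sub>R \<delta>) w = 0"
    by (simp_all only: bump_support)
qed

lemma other_sites_far:
  assumes "i \<in> X" "dist x i < \<delta>" "j \<in> X" "j \<noteq> i"
  shows "\<delta> \<le> dist x j"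
  using dist_separatedD[OF X(2), of i j] assms dist_triangle[of i j x] by (simp add: dist_commute)

lemma near_site_unique: obtains a where "\<And>i. i \<in> X \<Longrightarrow> i \<noteq> a \<Longrightarrow> \<delta> \<le> dist x i"
proof (cases "\<exists>a\<in>X. dist x a < \<delta>")
  case True
  then show ?thesis using that other_sites_far by blast
next
  case False
  then show ?thesis using that[of undefined] by force
qed

text \<open>At most two sites are within \<open>\<delta>\<close> of one of two given points.\<close>
lemma norm_bump_sum_le:
  assumes c: "0 \<le> c" "\<And>i. i \<in> X \<Longrightarrow> \<bar>t i\<bar> \<le> c"
    and far: "\<And>i. i \<in> X \<Longrightarrow> \<delta> \<le> dist x i \<Longrightarrow> \<delta> \<le> dist y i \<Longrightarrow> t i = 0"
  shows "norm (\<Sum>i\<in>X. (h * t i) *\<^sub>R v i) \<le> 2 * (h * c)"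
proof -
  obtain a where a: "\<And>i. i \<in> X \<Longrightarrow> i \<noteq> a \<Longrightarrow> \<delta> \<le> dist x i" using near_site_unique[of x] by blast
  obtain b where b: "\<And>i. i \<in> X \<Longrightarrow> i \<noteq> b \<Longrightarrow> \<delta> \<le> dist y i" using near_site_unique[of y] by blast
  show ?thesis
  proof (rule norm_sum_two_terms_le[OF X(1), of a b])
    show "norm ((h * t i) *\<^sub>R v i) \<le> h * c" if "i \<in> X" for i
      using v[OF that] c(2)[OF that] h mult_mono[of "\<bar>h * t i\<bar>" "h * c" "norm (v i)" 1]
      by (auto simp: abs_mult)
  qed (use a b far h c in auto)
qed

lemma norm_bump_field_le: "norm (bump_field h \<delta> X v x) \<le> 2 * h"
proof -
  have "norm (\<Sum>i\<in>X. (h * bump ((x - i) /\<^sub>R \<delta>)) *\<^sub>R v i) \<le> 2 * (h * 1)"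
    by (rule norm_bump_sum_le[of _ _ x x])
      (simp_all add: bump_far_from_site bump_range abs_of_nonneg[OF bump_range(1)])
  then show ?thesis by (simp add: bump_field_def)
qed

lemma bump_field_lipschitz: "norm (bump_field h \<delta> X v y - bump_field h \<delta> X v x)
    \<le> 12 * h / \<delta> * norm (y - x)"
proof -
  let ?t = "\<lambda>i. bump ((y - i) /\<^sub>R \<delta>) - bump ((x - i) /\<^sub>R \<delta>)"
  have "norm (\<Sum>i\<in>X. (h * ?t i) *\<^sub>R v i) \<le> 2 * (h * (6 * (norm (y - x) / \<delta>)))"
  proof (rule norm_bump_sum_le[of _ _ x y])
    show "\<bar>?t i\<bar> \<le> 6 * (norm (y - x) / \<delta>)" for i
      using bump_lipschitz[of "(y - i) /\<^sub>R \<delta>" "(x - i) /\<^sub>R \<delta>"] \<delta>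
      by (simp add: scaleR_diff_right[symmetric] divide_inverse mult.commute)
  qed (use \<delta> in \<open>auto simp: bump_far_from_site\<close>)
  then show ?thesis
    by (simp add: bump_field_def right_diff_distrib scaleR_left_diff_distrib sum_subtractf)
qed

lemma bump_field_taylor:
  "norm (bump_field h \<delta> X v y - bump_field h \<delta> X v x - bump_field_deriv h \<delta> X v x (y - x))
    \<le> 6 * h / \<delta>\<^sup>2 * (norm (y - x))\<^sup>2"
proof -
  let ?t = "\<lambda>i. bump ((y - i) /\<^sub>R \<delta>) - bump ((x - i) /\<^sub>R \<delta>) - bump_deriv ((x - i) /\<^sub>R \<delta>) ((y - x) /\<^sub>R \<delta>)"
  have "norm (\<Sum>i\<in>X. (h * ?t i) *\<^sub>R v i) \<le> 2 * (h * (3 * (norm (y - x) / \<delta>)\<^sup>2))"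
  proof (rule norm_bump_sum_le[of _ _ x y])
    show "\<bar>?t i\<bar> \<le> 3 * (norm (y - x) / \<delta>)\<^sup>2" for i
      using bump_taylor[of "(y - i) /\<^sub>R \<delta>" "(x - i) /\<^sub>R \<delta>"] \<delta>
      by (simp add: scaleR_diff_right[symmetric] divide_inverse mult.commute)
  qed (auto simp: bump_far_from_site)
  then show ?thesis
    by (simp add: bump_field_def bump_field_deriv_def right_diff_distrib scaleR_left_diff_distrib
        sum_subtractf power_divide)
qed

lemma bump_field_deriv_bound: "norm (bump_field_deriv h \<delta> X v x w) \<le> 12 * h / \<delta> * norm w"
proof -
  have "norm (\<Sum>i\<in>X. (h * bump_deriv ((x - i) /\<^sub>R \<delta>) (w /\<^sub>R \<delta>)) *\<^sub>R v i) \<le> 2 * (h * (6 * (norm w / \<delta>)))"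
  proof (rule norm_bump_sum_le[of _ _ x x])
    show "\<bar>bump_deriv ((x - i) /\<^sub>R \<delta>) (w /\<^sub>R \<delta>)\<bar> \<le> 6 * (norm w / \<delta>)" for i
      using bump_deriv_bound[of "(x - i) /\<^sub>R \<delta>" "w /\<^sub>R \<delta>"] \<delta>
      by (simp add: divide_inverse mult.commute)
  qed (use \<delta> in \<open>auto simp: bump_far_from_site\<close>)
  then show ?thesis by (simp add: bump_field_deriv_def)
qed

lemma has_derivative_bump_field: "(bump_field h \<delta> X v has_derivative bump_field_deriv h \<delta> X v x) (at x)"
proof -
  have "((\<lambda>x. bump ((x - i) /\<^sub>R \<delta>)) has_derivative (\<lambda>w. bump_deriv ((x - i) /\<^sub>R \<delta>) (w /\<^sub>R \<delta>))) (at x)" for i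
    by (rule has_derivative_compose[OF _ has_derivative_bump]) (auto intro!: derivative_eq_intros)
  then show ?thesis
    unfolding bump_field_def[abs_def] bump_field_deriv_def[abs_def]
    by (intro has_derivative_sum has_derivative_scaleR_left has_derivative_mult_right)
qed

lemma C2_on_bump_field: "C2_on V (bump_field h \<delta> X v)"
proof -
  have "C2_on V (\<lambda>x. (h * bump ((x - i) /\<^sub>R \<delta>)) *\<^sub>R v i)" for i
  proof -
    have "C2_on V (\<lambda>x. x /\<^sub>R \<delta> + - (i /\<^sub>R \<delta>))"
      by (intro C2_on_add C2_on_const C2_on_bounded_linear bounded_linear_scaleR_right)
    from C2_on_compose[OF C2_on_bump this, of UNIV]
    have "C2_on V (\<lambda>x. bump ((x - i) /\<^sub>R \<delta>))" by (simp add: scaleR_diff_right)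
    from C2_on_compose[OF C2_on_bounded_linear this, of "\<lambda>t. (h * t) *\<^sub>R v i" UNIV]
    show ?thesis by (auto intro: bounded_linear_scaleR_const bounded_linear_mult_right)
  qed
  then show ?thesis unfolding bump_field_def[abs_def] by (intro C2_on_sum)
qed

lemma bump_field_near_site:
  assumes "i \<in> X" "dist z i < \<delta>"
  shows "bump_field h \<delta> X v z = (h * bump ((z - i) /\<^sub>R \<delta>)) *\<^sub>R v i"
proof -
  have "bump_field h \<delta> X v z = (\<Sum>j\<in>{i}. (h * bump ((z - j) /\<^sub>R \<delta>)) *\<^sub>R v j)"
    unfolding bump_field_def using X(1) assms other_sites_far[OF assms]
    by (intro sum.mono_neutral_right) (auto simp: bump_far_from_site)
  then show ?thesis by simp
qed

lemma bump_field_far_from_sites: "(\<And>i. i \<in> X \<Longrightarrow> \<delta> \<le> dist x i) \<Longrightarrow> bump_field h \<delta> X v x = 0"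
  unfolding bump_field_def by (intro sum.neutral) (auto simp: bump_far_from_site)

end

section \<open>Uniform distributions on submanifolds\<close>

lemma support_uniform_measure:
  fixes N :: "'a::metric_space measure"
  assumes N: "sets N = sets borel" and M: "closed M" "emeasure N M \<noteq> \<infinity>"
    and pos: "\<And>x e. x \<in> M \<Longrightarrow> 0 < e \<Longrightarrow> 0 < emeasure N (M \<inter> ball x e)"
  shows "support (uniform_measure N M) = M"
proof -
  have "emeasure (uniform_measure N M) (ball x e) = emeasure N (M \<inter> ball x e) / emeasure N M" for x e
    using M by (intro emeasure_uniform_measure) (auto simp: N borel_closed)
  then have "support (uniform_measure N M) = {x. \<forall>e>0. 0 < emeasure N (M \<inter> ball x e)}"
    using M(2) by (simp add: support_def ennreal_zero_less_divide less_top)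
  also have "\<dots> = M"
  proof (intro equalityI subsetI)
    fix x assume x: "x \<in> {x. \<forall>e>0. 0 < emeasure N (M \<inter> ball x e)}"
    show "x \<in> M"
    proof (rule ccontr)
      assume "x \<notin> M"
      then obtain e where "0 < e" "ball x e \<subseteq> - M" using M(1) openE[of "- M" x] by auto
      moreover then have "M \<inter> ball x e = {}" by blast
      ultimately show False using x by auto
    qed
  qed (use pos in auto)
  finally show ?thesis .
qed

lemma uniform_measure_in_fixed_point_model:
  fixes M :: "(real^'n::finite) set"
  defines "D \<equiv> uniform_measure (hausdorff_measure CARD('d::finite)) M"
  assumes M: "M \<in> manifold_class TYPE('d) \<rho>" "0 \<in> M"
    and m: "hausdorff_outer CARD('d) M = ennreal m" "0 < m" "fmin \<le> 1 / m" "1 / m \<le> fmax"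
    and pos: "\<And>x e. x \<in> M \<Longrightarrow> 0 < e \<Longrightarrow> 0 < hausdorff_outer CARD('d) (M \<inter> ball x e)"
    and L: "0 \<le> L"
  shows "D \<in> fixed_point_model TYPE('d) \<rho> fmin fmax L" "support D = M"
proof -
  let ?H = "hausdorff_measure CARD('d) :: (real^'n) measure"
  have closed: "closed M" using M(1) by (auto simp: manifold_class_def compact_imp_closed)
  then have "M \<in> sets borel" by (rule borel_closed)
  have emeasure: "emeasure ?H B = hausdorff_outer CARD('d) B" if "B \<in> sets borel" for B
    using that by (intro emeasure_hausdorff_measure) auto
  then have HM: "emeasure ?H M = ennreal m" using m(1) \<open>M \<in> sets borel\<close> by simp
  show support: "support D = M"
    unfolding D_def using closed HM pos \<open>M \<in> sets borel\<close>
    by (intro support_uniform_measure) (auto simp: emeasure)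
  have "prob_space D"
    unfolding D_def using HM m(2) by (intro prob_space_uniform_measure) auto
  moreover have "D = density ?H (\<lambda>x. ennreal (1 / m) * indicator M x)"
    unfolding D_def uniform_measure_def HM using divide_ennreal[of 1 m] m(2)
    by (intro arg_cong[of _ _ "density ?H"]) (auto simp: fun_eq_iff split: split_indicator)
  moreover have "L-lipschitz_on M (\<lambda>x. 1 / m)" using L by (intro lipschitz_onI) auto
  ultimately show "D \<in> fixed_point_model TYPE('d) \<rho> fmin fmax L"
    unfolding fixed_point_model_def using M m support
    by (intro CollectI conjI exI[of _ M] exI[of _ "\<lambda>x. 1 / m"]) (auto simp: D_def)
qed

section \<open>Bumped spheres\<close>

definition bump_reach_condition :: "real \<Rightarrow> real \<Rightarrow> real \<Rightarrow> real \<Rightarrow> bool" where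
  "bump_reach_condition h \<delta> R r \<longleftrightarrow>
     0 \<le> r \<and> r * ((1 + 12 * h / \<delta>) / R + 2 * (6 * h / \<delta>\<^sup>2)) \<le> (1 - 12 * h / \<delta>)\<^sup>2"

locale bumped_sphere = separated_bumps h \<delta> X v
  for h \<delta> :: real and X :: "((real^'d::finite) \<times> real) set"
    and v :: "(real^'d) \<times> real \<Rightarrow> real^'n::finite" +
  fixes A :: "(real^'d) \<times> real \<Rightarrow> real^'n" and R :: real and p0 :: "(real^'d) \<times> real"
  assumes A: "orthogonal_transformation A" and R: "0 < R"
    and p0: "norm p0 = R" "\<And>i. i \<in> X \<Longrightarrow> \<delta> \<le> dist p0 i"
    and slope: "real CARD('d) * (12 * h / \<delta>) \<le> 1 / 2"
begin

definition distortion :: real where "distortion = 12 * h / \<delta>"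

definition embed :: "(real^'d) \<times> real \<Rightarrow> real^'n" where "embed x = A (x - p0) + bump_field h \<delta> X v x"

definition surface :: "(real^'n) set" where "surface = embed ` sphere 0 R"

lemma distortion_bounds: "0 \<le> distortion" "distortion \<le> 1 / 2"
proof -
  show "0 \<le> distortion" using h \<delta> by (simp add: distortion_def)
  have "1 * distortion \<le> real CARD('d) * distortion"
    using \<open>0 \<le> distortion\<close> one_le_card_finite[where 'a='d] by (intro mult_right_mono) auto
  then show "distortion \<le> 1 / 2" using slope by (simp add: distortion_def)
qed

lemma linear_A: "linear A" and norm_A [simp]: "norm (A x) = norm x"
  using A by (simp_all add: orthogonal_transformation_linear orthogonal_transformation_norm)

lemma embed_diff: "embed y - embed x = A (y - x) + (bump_field h \<delta> X v y - bump_field h \<delta> X v x)"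
  by (simp add: embed_def linear_diff[OF linear_A])

lemma embed_expands: "(1 - distortion) * dist x y \<le> dist (embed x) (embed y)"
  using norm_diff_ineq[of "A (x - y)" "bump_field h \<delta> X v x - bump_field h \<delta> X v y"]
    bump_field_lipschitz[of x y]
  by (simp add: dist_norm embed_diff distortion_def left_diff_distrib)

lemma embed_lipschitz: "dist (embed x) (embed y) \<le> (1 + distortion) * dist x y"
  using norm_triangle_ineq[of "A (x - y)" "bump_field h \<delta> X v x - bump_field h \<delta> X v y"]
    bump_field_lipschitz[of x y]
  by (simp add: dist_norm embed_diff distortion_def distrib_right)

lemma has_derivative_embed: "(embed has_derivative (\<lambda>w. A w + bump_field_deriv h \<delta> X v x w)) (at x)"
proof -
  have "((\<lambda>x. A (x - p0)) has_derivative A) (at x)"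
    using linear_imp_has_derivative[OF linear_A]
    by (auto simp: linear_diff[OF linear_A] intro!: derivative_eq_intros)
  then show ?thesis
    unfolding embed_def[abs_def] by (intro has_derivative_add has_derivative_bump_field)
qed

lemma C2_on_embed: "C2_on V embed"
proof -
  have "C2_on V (\<lambda>x. A x + - A p0)" by (intro C2_on_add C2_on_const C2_on_linear linear_A)
  then show ?thesis
    unfolding embed_def[abs_def]
    by (intro C2_on_add C2_on_bump_field) (simp add: linear_diff[OF linear_A])
qed

lemma reach_surface:
  assumes "bump_reach_condition h \<delta> R r"
  shows "ereal r \<le> reach surface"
  unfolding surface_def
proof (rule reach_sphere_image_ge[OF R _ _ has_derivative_embed _ _ embed_expands])
  show "0 \<le> r" "r * ((1 + distortion) / R + 2 * (6 * h / \<delta>\<^sup>2)) \<le> (1 - distortion)\<^sup>2"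
    using assms by (simp_all add: bump_reach_condition_def distortion_def)
  show "0 \<le> 1 - distortion" using distortion_bounds by simp
  show "norm (A w + bump_field_deriv h \<delta> X v x w) \<le> (1 + distortion) * norm w" for x w
    using norm_triangle_ineq[of "A w" "bump_field_deriv h \<delta> X v x w"] bump_field_deriv_bound[of x w]
    by (simp add: distortion_def algebra_simps)
  show "norm (embed y - embed x - (A (y - x) + bump_field_deriv h \<delta> X v x (y - x)))
      \<le> 6 * h / \<delta>\<^sup>2 * (norm (y - x))\<^sup>2" for x y
    using bump_field_taylor[of y x] by (simp add: embed_diff)
qed

lemma zero_in_surface: "0 \<in> surface"
proof -
  have "embed p0 = 0"
    using bump_field_far_from_sites[OF p0(2)] by (simp add: embed_def linear_0[OF linear_A])
  then show ?thesis unfolding surface_def using p0(1) by (metis image_eqI mem_sphere_0)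
qed

lemma surface_in_manifold_class:
  assumes "bump_reach_condition h \<delta> R r"
  shows "surface \<in> manifold_class TYPE('d) r"
proof -
  have "2 \<le> DIM((real^'d) \<times> real)" using one_le_card_finite[where 'a='d] by simp
  then have "compact surface" "connected surface"
    unfolding surface_def using C2_on_imp_continuous_on[OF C2_on_embed]
    by (intro compact_continuous_image connected_continuous_image compact_sphere connected_sphere; blast)+
  moreover have "C2_submanifold TYPE('d) surface"
    unfolding surface_def using distortion_bounds
    by (intro C2_submanifold_sphere_image[OF R C2_on_embed _ embed_expands]) simp
  ultimately show ?thesis unfolding manifold_class_def using reach_surface[OF assms] by simp
qed

lemma distortion_power_le: "(1 + distortion) ^ CARD('d) \<le> 2" "(1 / (1 - distortion)) ^ CARD('d) \<le> 2"
proof -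
  have "1 / 2 \<le> (1 - distortion) ^ CARD('d)"
    using Bernoulli_inequality[of "- distortion" "CARD('d)"] distortion_bounds slope
    by (simp add: distortion_def[symmetric])
  then show inverse: "(1 / (1 - distortion)) ^ CARD('d) \<le> 2" by (simp add: power_divide field_simps)
  have "1 + distortion \<le> 1 / (1 - distortion)" using distortion_bounds by (simp add: field_simps)
  then have "(1 + distortion) ^ CARD('d) \<le> (1 / (1 - distortion)) ^ CARD('d)"
    using distortion_bounds by (intro power_mono) auto
  then show "(1 + distortion) ^ CARD('d) \<le> 2" using inverse by linarith
qed

lemma hausdorff_outer_embed_image:
  "hausdorff_outer CARD('d) (embed ` B) \<le> 2 * hausdorff_outer CARD('d) B"
  "hausdorff_outer CARD('d) B \<le> 2 * hausdorff_outer CARD('d) (embed ` B)"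
proof -
  have "hausdorff_outer CARD('d) (embed ` B)
      \<le> ennreal ((1 + distortion) ^ CARD('d)) * hausdorff_outer CARD('d) B"
    using distortion_bounds embed_lipschitz
    by (intro hausdorff_outer_lipschitz_image lipschitz_onI) auto
  also have "\<dots> \<le> ennreal 2 * hausdorff_outer CARD('d) B"
    using distortion_power_le by (intro mult_right_mono ennreal_leI) auto
  finally show "hausdorff_outer CARD('d) (embed ` B) \<le> 2 * hausdorff_outer CARD('d) B" by simp
  have "hausdorff_outer CARD('d) B
      \<le> ennreal ((1 / (1 - distortion)) ^ CARD('d)) * hausdorff_outer CARD('d) (embed ` B)"
    using distortion_bounds embed_expands by (intro hausdorff_outer_le_expanding_image) auto
  also have "\<dots> \<le> ennreal 2 * hausdorff_outer CARD('d) (embed ` B)"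
    using distortion_power_le by (intro mult_right_mono ennreal_leI) auto
  finally show "hausdorff_outer CARD('d) B \<le> 2 * hausdorff_outer CARD('d) (embed ` B)" by simp
qed

lemma hausdorff_outer_surface_ball_pos:
  assumes x: "x \<in> surface" and e: "0 < e"
  shows "0 < hausdorff_outer CARD('d) (surface \<inter> ball x e)"
proof -
  obtain y where y: "norm y = R" "x = embed y" using x by (auto simp: surface_def)
  define B where "B = sphere 0 R \<inter> ball y (e / (1 + distortion))"
  have "y \<noteq> 0" using y R by auto
  then have "0 < hausdorff_outer CARD('d) B"
    using hausdorff_outer_cap_pos[of y "e / (1 + distortion)"] e distortion_bounds y
    by (simp add: B_def)
  also have "\<dots> \<le> 2 * hausdorff_outer CARD('d) (embed ` B)" by (rule hausdorff_outer_embed_image)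
  also have "\<dots> \<le> 2 * hausdorff_outer CARD('d) (surface \<inter> ball x e)"
  proof (intro mult_left_mono hausdorff_outer_mono subsetI)
    fix z assume "z \<in> embed ` B"
    then obtain w where w: "norm w = R" "dist y w < e / (1 + distortion)" "z = embed w"
      by (auto simp: B_def)
    have "dist x z \<le> (1 + distortion) * dist y w" using embed_lipschitz w(3) y(2) by simp
    also have "\<dots> < e" using w(2) distortion_bounds by (simp add: field_simps)
    finally show "z \<in> surface \<inter> ball x e" using w by (auto simp: surface_def)
  qed simp
  finally show ?thesis by (auto simp: zero_less_iff_neq_zero)
qed

lemma hausdorff_outer_surface_bounds:
  assumes f: "0 < f" and vol: "hausdorff_outer CARD('d) (sphere (0::(real^'d) \<times> real) R)
      = ennreal (1 / (2 * f))"
  obtains m where "hausdorff_outer CARD('d) surface = ennreal m" "0 < m" "f \<le> 1 / m" "1 / m \<le> 4 * f"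
proof -
  have "hausdorff_outer CARD('d) surface \<le> 2 * ennreal (1 / (2 * f))"
    and lower: "ennreal (1 / (2 * f)) \<le> 2 * hausdorff_outer CARD('d) surface"
    using hausdorff_outer_embed_image[of "sphere 0 R"] unfolding surface_def vol by auto
  moreover have "2 * ennreal (1 / (2 * f)) = ennreal (1 / f)"
    using f by (subst ennreal_numeral[symmetric], subst ennreal_mult'[symmetric]) auto
  ultimately obtain m where m: "hausdorff_outer CARD('d) surface = ennreal m" "0 \<le> m" "m \<le> 1 / f"
    using f by (cases "hausdorff_outer CARD('d) surface") (auto simp: top_unique less_imp_le)
  have "ennreal (1 / (2 * f)) \<le> ennreal (2 * m)"
    using lower m by (simp add: ennreal_mult)
  then have "1 / (4 * f) \<le> m" using f m(2) by (subst (asm) ennreal_le_iff) (auto simp: field_simps)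
  moreover from this have "0 < m" using f by (auto intro: less_le_trans[rotated])
  ultimately show ?thesis using that[OF m(1)] m(3) f by (simp add: field_simps)
qed

lemma uniform_distribution_in_model:
  assumes reach: "bump_reach_condition h \<delta> R r"
    and f: "0 < fmin" "fmin \<le> fmax / 4" and L: "0 \<le> L"
    and vol: "hausdorff_outer CARD('d) (sphere (0::(real^'d) \<times> real) R) = ennreal (1 / (2 * fmin))"
  obtains D where "D \<in> fixed_point_model TYPE('d) r fmin fmax L" "support D = surface"
proof -
  obtain m where m: "hausdorff_outer CARD('d) surface = ennreal m" "0 < m" "fmin \<le> 1 / m"
    "1 / m \<le> 4 * fmin"
    by (rule hausdorff_outer_surface_bounds[OF f(1) vol])
  then have "1 / m \<le> fmax" using f(2) by simp
  with m show ?thesis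
    using that uniform_measure_in_fixed_point_model[OF surface_in_manifold_class[OF reach]
        zero_in_surface _ _ _ _ hausdorff_outer_surface_ball_pos L]
    by blast
qed

end

section \<open>Binary and spherical codes\<close>

lemma card_small_subsets_le:
  fixes y :: real
  assumes K: "finite K" and y: "0 \<le> y" "y \<le> 1"
  shows "real (card {U \<in> Pow K. m * card U \<le> card K}) * y ^ card K \<le> (1 + y ^ m) ^ card K"
proof -
  let ?W = "{U \<in> Pow K. m * card U \<le> card K}"
  have "y ^ card K \<le> (y ^ m) ^ card U" if "U \<in> ?W" for U
    using that y by (auto simp: power_mult[symmetric] intro: power_decreasing)
  then have "real (card ?W) * y ^ card K \<le> (\<Sum>U\<in>?W. (y ^ m) ^ card U)"
    using sum_mono[of ?W "\<lambda>_. y ^ card K"] by simp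
  also have "\<dots> \<le> (\<Sum>U\<in>Pow K. (y ^ m) ^ card U)"
    using K y by (intro sum_mono2) auto
  also have "\<dots> = (1 + y ^ m) ^ card K"
    using prod_add[OF K, of "\<lambda>_. y ^ m" "\<lambda>_. 1"] by (simp add: add.commute)
  finally show ?thesis .
qed

lemma covering_code_card:
  assumes K: "finite K" and \<T>: "finite \<T>" "\<T> \<subseteq> Pow K"
    and cover: "\<And>U. U \<subseteq> K \<Longrightarrow> \<exists>T\<in>\<T>. m * card (sym_diff T U) \<le> card K"
  shows "2 ^ card K \<le> card \<T> * card {U \<in> Pow K. m * card U \<le> card K}"
proof -
  let ?W = "{U \<in> Pow K. m * card U \<le> card K}"
  have "U \<in> (\<Union>T\<in>\<T>. sym_diff T ` ?W)" if U: "U \<subseteq> K" for U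
  proof -
    obtain T where T: "T \<in> \<T>" "m * card (sym_diff T U) \<le> card K" using cover[OF U] by auto
    then have "sym_diff T U \<in> ?W" using U \<T>(2) by auto
    moreover have "U = sym_diff T (sym_diff T U)" by blast
    ultimately show ?thesis using T(1) by blast
  qed
  then have "card (Pow K) \<le> card (\<Union>T\<in>\<T>. sym_diff T ` ?W)"
    using \<T>(1) K by (intro card_mono) auto
  also have "\<dots> \<le> (\<Sum>T\<in>\<T>. card (sym_diff T ` ?W))" using \<T>(1) by (rule card_UN_le)
  also have "\<dots> \<le> card \<T> * card ?W"
    by (rule sum_bounded_above[where 'a=nat, unfolded of_nat_id]) (use K in \<open>auto intro: card_image_le\<close>)
  finally show ?thesis using K by (simp add: card_Pow)
qed

lemma gilbert_varshamov_code:
  fixes y :: real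
  assumes K: "finite K" and y: "0 \<le> y" "y \<le> 1"
  obtains \<T> where "finite \<T>" "\<T> \<subseteq> Pow K" "(2 * y / (1 + y ^ m)) ^ card K \<le> real (card \<T>)"
    "\<And>T T'. T \<in> \<T> \<Longrightarrow> T' \<in> \<T> \<Longrightarrow> T \<noteq> T' \<Longrightarrow> card K < m * card (sym_diff T T')"
proof -
  let ?far = "\<lambda>T T'. card K < m * card (sym_diff T T')" and ?W = "{U \<in> Pow K. m * card U \<le> card K}"
  have bound: "card P \<le> card (Pow K)" if "P \<subseteq> Pow K" for P
    using that K by (intro card_mono) auto
  have sym: "?far T T' \<Longrightarrow> ?far T' T" for T T'
    by (simp add: Un_commute)
  obtain \<T> where \<T>: "finite \<T>" "\<T> \<subseteq> Pow K" "pairwise ?far \<T>"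
    and max: "\<And>U. U \<in> Pow K \<Longrightarrow> U \<in> \<T> \<or> (\<exists>T\<in>\<T>. \<not> ?far T U)"
    using maximal_pairwise_subset[of ?far "Pow K", OF sym bound] by blast
  have "\<exists>T\<in>\<T>. m * card (sym_diff T U) \<le> card K" if "U \<subseteq> K" for U
  proof (cases "U \<in> \<T>")
    case True
    then show ?thesis by (intro bexI[of _ U]) auto
  next
    case False
    then show ?thesis using max[of U] that by (auto simp: not_less)
  qed
  then have "2 ^ card K \<le> card \<T> * card ?W" by (rule covering_code_card[OF K \<T>(1,2)])
  then have "real (2 ^ card K) \<le> real (card \<T> * card ?W)" by (rule of_nat_mono)
  then have "2 ^ card K \<le> real (card \<T>) * real (card ?W)" by simp
  then have "2 ^ card K * y ^ card K \<le> real (card \<T>) * real (card ?W) * y ^ card K"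
    using y by (intro mult_right_mono) auto
  also have "\<dots> \<le> real (card \<T>) * (1 + y ^ m) ^ card K"
    using card_small_subsets_le[OF K y, of m] by (simp add: mult.assoc mult_left_mono)
  finally have "(2 * y) ^ card K \<le> real (card \<T>) * (1 + y ^ m) ^ card K"
    by (simp add: power_mult_distrib)
  then have "(2 * y / (1 + y ^ m)) ^ card K \<le> real (card \<T>)"
    using y by (simp add: power_divide pos_divide_le_eq add_pos_nonneg)
  then show ?thesis using that[of \<T>] \<T> by (simp add: pairwise_def)
qed

definition sign_vector :: "'a::real_inner set \<Rightarrow> 'a set \<Rightarrow> 'a" where
  "sign_vector B T = (\<Sum>b\<in>B. (if b \<in> T then 1 else - 1) *\<^sub>R b) /\<^sub>R sqrt (real (card B))"

lemma inner_sum_orthonormal: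
  fixes B :: "'a::real_inner set"
  assumes B: "finite B" "pairwise orthogonal B" "\<And>b. b \<in> B \<Longrightarrow> norm b = 1"
  shows "(\<Sum>b\<in>B. f b *\<^sub>R b) \<bullet> (\<Sum>b\<in>B. g b *\<^sub>R b) = (\<Sum>b\<in>B. f b * g b)"
proof -
  have delta: "b \<bullet> c = (if b = c then 1 else 0)" if "b \<in> B" "c \<in> B" for b c
    using that B(2,3) by (auto simp: pairwise_def orthogonal_def dot_square_norm)
  have "(\<Sum>b\<in>B. f b *\<^sub>R b) \<bullet> (\<Sum>b\<in>B. g b *\<^sub>R b) = (\<Sum>b\<in>B. f b * (\<Sum>c\<in>B. g c * (b \<bullet> c)))"
    by (subst inner_sum_left) (simp add: inner_sum_right sum_distrib_left mult.left_commute)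
  also have "\<dots> = (\<Sum>b\<in>B. f b * (\<Sum>c\<in>B. if b = c then g c else 0))"
    by (intro sum.cong refl arg_cong2[of _ _ _ _ "(*)"]) (simp add: delta)
  also have "\<dots> = (\<Sum>b\<in>B. f b * g b)" using B(1) by (intro sum.cong) (simp_all add: sum.delta)
  finally show ?thesis .
qed

lemma inner_sign_vector:
  fixes B :: "'a::real_inner set"
  assumes B: "finite B" "B \<noteq> {}" "pairwise orthogonal B" "\<And>b. b \<in> B \<Longrightarrow> norm b = 1"
    and T: "T \<subseteq> B" "T' \<subseteq> B"
  shows "sign_vector B T \<bullet> sign_vector B T' = 1 - 2 * real (card (sym_diff T T')) / real (card B)"
proof -
  let ?s = "\<lambda>T b. if b \<in> T then 1 else - 1 :: real"
  have "(\<Sum>b\<in>B. ?s T b *\<^sub>R b) \<bullet> (\<Sum>b\<in>B. ?s T' b *\<^sub>R b) = (\<Sum>b\<in>B. ?s T b * ?s T' b)"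
    by (rule inner_sum_orthonormal[OF B(1,3,4)])
  also have "\<dots> = (\<Sum>b\<in>B. 1 - 2 * (if b \<in> sym_diff T T' then 1 else 0))"
    by (intro sum.cong) auto
  also have "\<dots> = real (card B) - 2 * real (card (sym_diff T T'))"
  proof -
    have "B \<inter> {b. b \<in> sym_diff T T'} = sym_diff T T'" using T by auto
    then have "(\<Sum>b\<in>B. if b \<in> sym_diff T T' then 1 else 0 :: real) = real (card (sym_diff T T'))"
      using B(1) by (simp only: sum.If_cases) simp
    then show ?thesis by (simp only: sum_subtractf sum_distrib_left[symmetric]) simp
  qed
  finally have "(\<Sum>b\<in>B. ?s T b *\<^sub>R b) \<bullet> (\<Sum>b\<in>B. ?s T' b *\<^sub>R b) = \<dots>" .
  moreover have "0 < real (card B)" using B by (simp add: card_gt_0_iff)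
  ultimately show ?thesis
    unfolding sign_vector_def by (simp add: field_simps flip: power2_eq_square)
qed

lemma exp_quarter_le: "exp (1 / 4) \<le> 2 * (4 / 5) / (1 + (4 / 5) ^ 8 :: real)"
proof (rule power_le_imp_le_base)
  show "exp (1/4) ^ Suc 3 \<le> (2 * (4/5) / (1 + (4/5) ^ 8) :: real) ^ Suc 3"
    using exp_le by (simp add: exp_of_nat_mult[symmetric] power_divide del: power_Suc)
qed simp

lemma spherical_code:
  fixes V :: "'a::euclidean_space set"
  assumes V: "subspace V" "0 < dim V"
  obtains W where "finite W" "W \<subseteq> V" "\<And>v. v \<in> W \<Longrightarrow> norm v = 1"
    "\<And>v w. v \<in> W \<Longrightarrow> w \<in> W \<Longrightarrow> v \<noteq> w \<Longrightarrow> v \<bullet> w \<le> 3 / 4"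
    "exp (real (dim V) / 4) \<le> real (card W)"
proof -
  obtain B where B: "B \<subseteq> V" "pairwise orthogonal B" "\<And>b. b \<in> B \<Longrightarrow> norm b = 1" "card B = dim V"
    using orthonormal_basis_subspace[OF V(1)] by metis
  have finB: "finite B" "B \<noteq> {}" using B(4) V(2) by (metis card_gt_0_iff)+
  obtain \<T> where \<T>: "finite \<T>" "\<T> \<subseteq> Pow B" "(2 * (4/5) / (1 + (4/5) ^ 8)) ^ card B \<le> real (card \<T>)"
    and far: "\<And>T T'. T \<in> \<T> \<Longrightarrow> T' \<in> \<T> \<Longrightarrow> T \<noteq> T' \<Longrightarrow> card B < 8 * card (sym_diff T T')"
    using gilbert_varshamov_code[OF finB(1), of "4/5" 8] by auto
  have inner: "sign_vector B T \<bullet> sign_vector B T'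
      = 1 - 2 * real (card (sym_diff T T')) / real (card B)"
    if "T \<in> \<T>" "T' \<in> \<T>" for T T'
    using that \<T>(2) by (intro inner_sign_vector finB B(2,3)) auto
  then have unit: "norm (sign_vector B T) = 1" if "T \<in> \<T>" for T
    using that by (simp add: norm_eq_sqrt_inner)
  have angle: "sign_vector B T \<bullet> sign_vector B T' \<le> 3 / 4" if "T \<in> \<T>" "T' \<in> \<T>" "T \<noteq> T'" for T T'
  proof -
    have "real (card B) \<le> 8 * real (card (sym_diff T T'))" using far[OF that] by linarith
    then show ?thesis using finB unfolding inner[OF that(1,2)]
      by (simp add: field_simps card_gt_0_iff)
  qed
  have "inj_on (sign_vector B) \<T>"
  proof (rule inj_onI, rule ccontr)
    fix T T' assume T: "T \<in> \<T>" "T' \<in> \<T>" "sign_vector B T = sign_vector B T'" "T \<noteq> T'"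
    then show False using angle[OF T(1,2,4)] unit[OF T(2)] by (simp add: dot_square_norm)
  qed
  then have card: "card (sign_vector B ` \<T>) = card \<T>" by (rule card_image)
  have "exp (1/4) ^ card B \<le> (2 * (4/5) / (1 + (4/5) ^ 8 :: real)) ^ card B"
    by (intro power_mono exp_quarter_le) auto
  then have "exp (real (dim V) / 4) \<le> real (card (sign_vector B ` \<T>))"
    using \<T>(3) by (simp add: exp_of_nat_mult[symmetric] card B(4))
  moreover have "sign_vector B T \<in> V" for T
    unfolding sign_vector_def using V(1) B(1) by (intro subspace_scale subspace_sum) auto
  ultimately show ?thesis using that[of "sign_vector B ` \<T>"] \<T>(1) unit angle by blast
qed

definition unit_normal_code :: "('a::real_inner \<Rightarrow> 'b::real_inner) \<Rightarrow> 'a \<Rightarrow> 'b set \<Rightarrow> bool" where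
  "unit_normal_code A x W \<longleftrightarrow> finite W \<and> (\<forall>v\<in>W. norm v = 1) \<and>
     (\<forall>v\<in>W. \<forall>w. w \<bullet> x = 0 \<longrightarrow> A w \<bullet> v = 0) \<and> (\<forall>v\<in>W. \<forall>v'\<in>W. v \<noteq> v' \<longrightarrow> v \<bullet> v' \<le> 3 / 4)"

lemma unit_normal_codeD:
  assumes "unit_normal_code A x W"
  shows "finite W" "v \<in> W \<Longrightarrow> norm v = 1" "v \<in> W \<Longrightarrow> w \<bullet> x = 0 \<Longrightarrow> A w \<bullet> v = 0"
    "v \<in> W \<Longrightarrow> v' \<in> W \<Longrightarrow> v \<noteq> v' \<Longrightarrow> v \<bullet> v' \<le> 3 / 4"
  using assms by (auto simp: unit_normal_code_def)

lemma unit_normal_code_exists: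
  fixes A :: "'a::euclidean_space \<Rightarrow> 'b::euclidean_space"
  assumes A: "orthogonal_transformation A" and x: "x \<noteq> 0" and k: "k + DIM('a) = DIM('b) + 1" "0 < k"
  obtains W where "unit_normal_code A x W" "exp (real k / 4) \<le> real (card W)"
proof -
  define T where "T = A ` {w. x \<bullet> w = 0}"
  define V where "V = {y. \<forall>t\<in>T. orthogonal t y}"
  have lin: "linear A" using A by (rule orthogonal_transformation_linear)
  have "inj A"
    unfolding linear_injective_0[OF lin] using A
    by (metis norm_eq_zero orthogonal_transformation_norm)
  then have "dim T = DIM('a) - 1"
    unfolding T_def using dim_image_eq[OF lin, of "{w. x \<bullet> w = 0}"] x
    by (simp add: dim_hyperplane inj_on_subset)
  moreover have "subspace T"
    unfolding T_def by (intro linear_subspace_image lin subspace_hyperplane)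
  then have "dim V + dim T = DIM('b)"
    using dim_subspace_orthogonal_to_vectors[of T UNIV] by (simp add: V_def)
  ultimately have dim: "dim V = k" using k DIM_positive[where 'a='a] by linarith
  have "subspace V"
    unfolding V_def subspace_def by (auto simp: orthogonal_def inner_add_right)
  then obtain W where W: "finite W" "W \<subseteq> V" "\<And>v. v \<in> W \<Longrightarrow> norm v = 1"
    "\<And>v w. v \<in> W \<Longrightarrow> w \<in> W \<Longrightarrow> v \<noteq> w \<Longrightarrow> v \<bullet> w \<le> 3 / 4" "exp (real (dim V) / 4) \<le> real (card W)"
    by (rule spherical_code) (use k(2) dim in auto)
  moreover have "A w \<bullet> v = 0" if "v \<in> W" "w \<bullet> x = 0" for v w
    using that W(2) by (auto simp: V_def T_def orthogonal_def inner_commute)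
  ultimately show ?thesis using that[of W] dim by (simp add: unit_normal_code_def)
qed

lemma normal_code_family:
  assumes dim: "DIM('a) \<le> DIM('b)"
  obtains A :: "'a::euclidean_space \<Rightarrow> 'b::euclidean_space" and W
  where "orthogonal_transformation A" "\<forall>x. x \<noteq> 0 \<longrightarrow> unit_normal_code A x (W x)"
    "\<forall>x. x \<noteq> 0 \<longrightarrow> exp (real (DIM('b) + 1 - DIM('a)) / 4) \<le> real (card (W x))"
proof -
  obtain A :: "'a \<Rightarrow> 'b" where A: "orthogonal_transformation A"
    using isometry_subset_subspace[of "UNIV :: 'a set" "UNIV :: 'b set"] dim
    by (auto simp: orthogonal_transformation)
  have "\<exists>W. x \<noteq> 0 \<longrightarrow>
      unit_normal_code A x W \<and> exp (real (DIM('b) + 1 - DIM('a)) / 4) \<le> real (card W)" for x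
  proof (cases "x = 0")
    case False
    then show ?thesis
      by (rule unit_normal_code_exists[OF A, where k="DIM('b) + 1 - DIM('a)"]) (use dim in auto)
  qed simp
  then show ?thesis using that[OF A] by metis
qed

section \<open>Statistical query algorithms\<close>

definition hausdorff_apart :: "real \<Rightarrow> 'a::metric_space set \<Rightarrow> 'a set \<Rightarrow> bool" where
  "hausdorff_apart \<epsilon> M M' \<longleftrightarrow>
     (\<forall>K. \<not> (hausdorff_distance M K \<le> ereal \<epsilon> \<and> hausdorff_distance M' K \<le> ereal \<epsilon>))"

lemma hausdorff_apartI:
  assumes x: "x \<in> M" and far: "\<And>y. y \<in> M' \<Longrightarrow> c \<le> dist y x" and c: "2 * \<epsilon> < c"
  shows "hausdorff_apart \<epsilon> M M'"
  unfolding hausdorff_apart_def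
proof (intro allI notI)
  fix K assume close: "hausdorff_distance M K \<le> ereal \<epsilon> \<and> hausdorff_distance M' K \<le> ereal \<epsilon>"
  have "einfdist x M \<le> 0" unfolding einfdist_def using x by (intro INF_lower2[of x]) auto
  moreover have "0 \<le> einfdist x M" unfolding einfdist_def by (intro INF_greatest) auto
  ultimately have M: "einfdist x M = 0" by simp
  have M': "ereal c \<le> einfdist x M'" unfolding einfdist_def using far by (intro INF_greatest) auto
  have "\<bar>einfdist x N - einfdist x K\<bar> \<le> hausdorff_distance N K" for N
    unfolding hausdorff_distance_def by (intro SUP_upper UNIV_I)
  then have "\<bar>0 - einfdist x K\<bar> \<le> ereal \<epsilon>" "\<bar>einfdist x M' - einfdist x K\<bar> \<le> ereal \<epsilon>"
    using close M by (metis order_trans)+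
  then show False
    using M' c by (cases "einfdist x K"; cases "einfdist x M'") auto
qed

lemma not_hausdorff_apart_self:
  assumes "M \<noteq> {}" "0 \<le> \<epsilon>"
  shows "\<not> hausdorff_apart \<epsilon> M M"
proof -
  obtain p where p: "p \<in> M" using assms(1) by auto
  have "\<bar>einfdist x M - einfdist x M\<bar> \<le> ereal \<epsilon>" for x
  proof -
    have "0 \<le> einfdist x M" unfolding einfdist_def by (intro INF_greatest) auto
    moreover have "einfdist x M \<le> ereal (dist p x)"
      unfolding einfdist_def using p by (rule INF_lower)
    ultimately show ?thesis using assms(2) by (cases "einfdist x M") auto
  qed
  then have "hausdorff_distance M M \<le> ereal \<epsilon>" unfolding hausdorff_distance_def by (rule SUP_least)
  then show ?thesis by (auto simp: hausdorff_apart_def)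
qed

lemma interval_net:
  fixes a b \<tau> :: real
  assumes \<tau>: "0 < \<tau>" and ab: "a \<le> b"
  obtains V where "finite V" "real (card V) \<le> 1 + (b - a) / (2 * \<tau>)"
    "\<And>x. a \<le> x \<Longrightarrow> x \<le> b \<Longrightarrow> \<exists>v\<in>V. \<bar>v - x\<bar> \<le> \<tau>"
proof -
  define n where "n = nat \<lfloor>(b - a) / (2 * \<tau>)\<rfloor>"
  define grid where "grid j = a + \<tau> * (2 * real j + 1)" for j
  have "\<exists>v\<in>grid ` {..n}. \<bar>v - x\<bar> \<le> \<tau>" if x: "a \<le> x" "x \<le> b" for x
  proof -
    define y where "y = (x - a) / (2 * \<tau>)"
    define j where "j = nat \<lfloor>y\<rfloor>"
    have "0 \<le> y" "y \<le> (b - a) / (2 * \<tau>)" using x \<tau> by (auto simp: y_def divide_right_mono)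
    then have j: "j \<le> n" "real j \<le> y" "y \<le> real j + 1"
      unfolding j_def n_def by (auto intro!: nat_mono floor_mono)
    have "grid j - x = \<tau> * (2 * (real j - y) + 1)"
      using \<tau> by (simp add: grid_def y_def field_simps)
    then have "\<bar>grid j - x\<bar> \<le> \<tau>" using \<tau> j by (simp add: abs_mult mult_left_le)
    then show ?thesis using j(1) by auto
  qed
  moreover have "real (card (grid ` {..n})) \<le> 1 + (b - a) / (2 * \<tau>)"
  proof -
    have "real n \<le> (b - a) / (2 * \<tau>)" unfolding n_def using ab \<tau> by (intro of_nat_floor) simp
    then show ?thesis using card_image_le[of "{..n}" grid] by simp
  qed
  ultimately show ?thesis using that[of "grid ` {..n}"] by simp
qed

lemma (in prob_space) abs_expectation_le:
  fixes f :: "'a \<Rightarrow> real"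
  assumes "f \<in> borel_measurable M" "\<And>x. \<bar>f x\<bar> \<le> c"
  shows "\<bar>expectation f\<bar> \<le> c"
proof -
  have "integrable M f" using assms by (intro integrable_const_bound[of _ c]) auto
  then have "- c \<le> expectation f" "expectation f \<le> c"
    using assms(2) by (auto intro!: integral_ge_const integral_le_const simp: abs_le_iff minus_le_iff)
  then show ?thesis by (simp add: abs_le_iff)
qed

definition rounding_oracle :: "(real \<Rightarrow> real) \<Rightarrow> 'a measure \<Rightarrow> ('a \<Rightarrow> real) list \<Rightarrow> real" where
  "rounding_oracle rnd D qs = rnd (integral\<^sup>L D (last qs))"

lemma stat_oracle_rounding:
  assumes D: "prob_space D" "sets D = sets borel" and rnd: "\<And>x. \<bar>x\<bar> \<le> 1 \<Longrightarrow> \<bar>rnd x - x\<bar> \<le> \<tau>"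
  shows "stat_oracle \<tau> D (rounding_oracle rnd D)"
proof -
  interpret prob_space D by (rule D)
  have "\<bar>expectation r\<bar> \<le> 1" if "r \<in> sq_queries" for r
    using that D(2) by (intro abs_expectation_le) (auto simp: sq_queries_def cong: measurable_cong_sets)
  then show ?thesis by (simp add: stat_oracle_def rounding_oracle_def rnd)
qed

lemma sq_run_answers:
  assumes "\<And>qs. orc qs \<in> V"
  shows "snd (sq_run Q orc i) \<in> {as. set as \<subseteq> V \<and> length as = i}"
  by (induction i) (auto simp: Let_def assms split: prod.splits)

lemma (in prob_space) sum_prob_le_of_card_le:
  assumes I: "finite I" and E: "\<And>i. i \<in> I \<Longrightarrow> E i \<in> events"
    and card: "\<And>\<omega>. real (card {i\<in>I. \<omega> \<in> E i}) \<le> c"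
  shows "(\<Sum>i\<in>I. prob (E i)) \<le> c"
proof -
  have int: "integrable M (indicator (E i) :: 'a \<Rightarrow> real)" if "i \<in> I" for i
    using E[OF that] by (intro integrable_const_bound[of _ 1]) (auto simp: indicator_def)
  have "(\<Sum>i\<in>I. prob (E i)) = (\<Sum>i\<in>I. expectation (indicator (E i)))"
    using E by (intro sum.cong) auto
  also have "\<dots> = expectation (\<lambda>\<omega>. \<Sum>i\<in>I. indicator (E i) \<omega>)"
    by (rule Bochner_Integration.integral_sum[symmetric, OF int])
  also have "\<dots> \<le> c"
  proof (rule integral_le_const)
    show "AE \<omega> in M. (\<Sum>i\<in>I. indicator (E i) \<omega>) \<le> c"
      using card I by (simp add: indicator_def sum.If_cases Int_def)
  qed (intro Bochner_Integration.integrable_sum int)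
  finally show ?thesis .
qed

text \<open>An oracle that rounds to a grid of at most \<open>1 + 1/\<tau>\<close> values leaves each deterministic algorithm
  at most \<open>(1 + 1/\<tau>) ^ q\<close> outputs, and each output is correct for at most one distribution.\<close>
lemma sq_packing_bound:
  fixes \<Omega> :: "'w measure" and Qs :: "'w \<Rightarrow> nat \<Rightarrow> real list \<Rightarrow> (real^'n::finite \<Rightarrow> real)"
    and Out :: "'w \<Rightarrow> real list \<Rightarrow> (real^'n) set" and \<D> :: "(real^'n) measure set"
  assumes \<tau>: "0 < \<tau>" and \<Omega>: "prob_space \<Omega>" and \<D>: "finite \<D>"
    "\<And>D. D \<in> \<D> \<Longrightarrow> prob_space D" "\<And>D. D \<in> \<D> \<Longrightarrow> sets D = sets borel"
    and apart: "pairwise (\<lambda>D D'. hausdorff_apart \<epsilon> (support D) (support D')) \<D>"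
    and estimates: "\<And>D orc. D \<in> \<D> \<Longrightarrow> stat_oracle \<tau> D orc \<Longrightarrow>
        \<exists>E \<in> sets \<Omega>. measure \<Omega> E \<ge> 1 - \<alpha> \<and>
          (\<forall>\<omega>\<in>E. hausdorff_distance (support D) (Out \<omega> (snd (sq_run (Qs \<omega>) orc q))) \<le> ereal \<epsilon>)"
  shows "real (card \<D>) * (1 - \<alpha>) \<le> (1 + 1 / \<tau>) ^ q"
proof -
  interpret prob_space \<Omega> by (rule \<Omega>)
  obtain V where V: "finite V" "real (card V) \<le> 1 + (1 - (- 1)) / (2 * \<tau>)"
    and net: "\<And>x. - 1 \<le> x \<Longrightarrow> x \<le> 1 \<Longrightarrow> \<exists>v\<in>V. \<bar>v - x\<bar> \<le> \<tau>"
    by (rule interval_net[OF \<tau>, of "- 1" 1]) auto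
  have "\<exists>v\<in>V. \<bar>x\<bar> \<le> 1 \<longrightarrow> \<bar>v - x\<bar> \<le> \<tau>" for x
    using net[of x] net[of 0] by (cases "\<bar>x\<bar> \<le> 1") (auto simp: abs_le_iff)
  then obtain rnd where rnd: "\<And>x. rnd x \<in> V" "\<And>x. \<bar>x\<bar> \<le> 1 \<Longrightarrow> \<bar>rnd x - x\<bar> \<le> \<tau>" by metis
  define answers where "answers \<omega> D = snd (sq_run (Qs \<omega>) (rounding_oracle rnd D) q)" for \<omega> D
  have "\<exists>E \<in> sets \<Omega>. measure \<Omega> E \<ge> 1 - \<alpha> \<and>
      (\<forall>\<omega>\<in>E. hausdorff_distance (support D) (Out \<omega> (answers \<omega> D)) \<le> ereal \<epsilon>)" if "D \<in> \<D>" for D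
    unfolding answers_def using that by (intro estimates stat_oracle_rounding \<D> rnd)
  then obtain E where E: "\<And>D. D \<in> \<D> \<Longrightarrow> E D \<in> events" "\<And>D. D \<in> \<D> \<Longrightarrow> 1 - \<alpha> \<le> prob (E D)"
    "\<And>D \<omega>. D \<in> \<D> \<Longrightarrow> \<omega> \<in> E D \<Longrightarrow> hausdorff_distance (support D) (Out \<omega> (answers \<omega> D)) \<le> ereal \<epsilon>"
    by metis
  have "real (card {D\<in>\<D>. \<omega> \<in> E D}) \<le> (1 + 1 / \<tau>) ^ q" for \<omega>
  proof -
    let ?J = "{D\<in>\<D>. \<omega> \<in> E D}" and ?L = "{as. set as \<subseteq> V \<and> length as = q}"
    have "inj_on (answers \<omega>) ?J"
    proof (rule inj_onI, rule ccontr)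
      fix D D' assume D: "D \<in> ?J" "D' \<in> ?J" "answers \<omega> D = answers \<omega> D'" "D \<noteq> D'"
      then show False using pairwiseD[OF apart, of D D'] E(3)[of D \<omega>] E(3)[of D' \<omega>]
        by (auto simp: hausdorff_apart_def)
    qed
    moreover have "answers \<omega> D \<in> ?L" for D
      unfolding answers_def by (rule sq_run_answers) (simp add: rounding_oracle_def rnd)
    ultimately have "card ?J \<le> card ?L"
      using finite_lists_length_eq[OF V(1)] by (intro card_inj_on_le) auto
    then have "real (card ?J) \<le> real (card V ^ q)" by (simp add: card_lists_length_eq[OF V(1)])
    also have "\<dots> \<le> (1 + 1 / \<tau>) ^ q" unfolding of_nat_power using V(2) by (intro power_mono) auto
    finally show ?thesis .
  qed
  with \<D>(1) E(1) have "(\<Sum>D\<in>\<D>. prob (E D)) \<le> (1 + 1 / \<tau>) ^ q" by (rule sum_prob_le_of_card_le)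
  then show ?thesis using sum_mono[of \<D> "\<lambda>_. 1 - \<alpha>" "\<lambda>D. prob (E D)"] E(2) by simp
qed

section \<open>Separation of bumped spheres\<close>

lemma unit_vectors_apart:
  fixes v v' :: "'a::real_inner"
  assumes "norm v = 1" "norm v' = 1" "v \<bullet> v' \<le> 3 / 4" "0 \<le> b"
  shows "13 / 20 \<le> norm (v - b *\<^sub>R v')"
proof -
  have "(norm (v - b *\<^sub>R v'))\<^sup>2 = 1 + b\<^sup>2 - 2 * (b * (v \<bullet> v'))"
    using assms(1,2) dot_square_norm[of "v - b *\<^sub>R v'"] dot_square_norm[of v] dot_square_norm[of v']
    by (simp add: inner_diff_left inner_diff_right inner_commute power2_eq_square)
  moreover have "b * (v \<bullet> v') \<le> b * (3 / 4)" using assms by (intro mult_left_mono) auto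
  moreover have "0 \<le> (b - 3 / 4)\<^sup>2" by simp
  ultimately have "(13 / 20)\<^sup>2 \<le> (norm (v - b *\<^sub>R v'))\<^sup>2"
    by (simp add: power2_eq_square algebra_simps)
  then show ?thesis by (rule power2_le_imp_le) simp
qed

text \<open>The secant \<open>i - z\<close> is tangential up to the radial correction \<open>\<parallel>i - z\<parallel>\<^sup>2 / (2 R)\<close>.\<close>
lemma normal_displacement_le:
  fixes A :: "'a::real_inner \<Rightarrow> 'b::real_inner"
  assumes A: "orthogonal_transformation A" and R: "0 < R" and iz: "norm i = R" "norm z = R"
    and normal: "\<And>w. w \<bullet> i = 0 \<Longrightarrow> A w \<bullet> u = 0"
  shows "norm u \<le> norm (A (i - z) + u) + (norm (i - z))\<^sup>2 / (2 * R)"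
proof -
  have lin: "linear A" and inner: "A x \<bullet> A y = x \<bullet> y" for x y
    using A by (simp_all add: orthogonal_transformation_def)
  define c where "c = (norm (i - z))\<^sup>2 / (2 * R\<^sup>2)"
  define t where "t = i - z - c *\<^sub>R i"
  have t: "t \<bullet> i = 0"
    using inner_diff_same_norm[of i z] iz R
    by (simp add: t_def c_def inner_diff_left dot_square_norm)
  have "i - z = t + c *\<^sub>R i" by (simp add: t_def)
  then have split: "A (i - z) + u = A t + (c *\<^sub>R A i + u)"
    by (simp add: linear_add[OF lin] linear_cmul[OF lin])
  have "orthogonal (A t) (c *\<^sub>R A i + u)"
    using normal[OF t] t by (simp add: orthogonal_def inner_add_right inner)
  then have "(norm (c *\<^sub>R A i + u))\<^sup>2 \<le> (norm (A t + (c *\<^sub>R A i + u)))\<^sup>2"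
    by (simp add: norm_add_Pythagorean)
  then have "norm (c *\<^sub>R A i + u) \<le> norm (A (i - z) + u)"
    unfolding split by (rule power2_le_imp_le) simp
  moreover have "norm u \<le> norm (c *\<^sub>R A i + u) + norm (c *\<^sub>R A i)"
    using norm_triangle_ineq4[of "c *\<^sub>R A i + u" "c *\<^sub>R A i"] by simp
  moreover have "norm (c *\<^sub>R A i) = (norm (i - z))\<^sup>2 / (2 * R)"
    using orthogonal_transformation_norm[OF A, of i] iz(1) R by (simp add: c_def power2_eq_square)
  ultimately show ?thesis by simp
qed

locale bump_code =
  fixes h \<delta> :: real and X :: "((real^'d::finite) \<times> real) set"
    and W :: "(real^'d) \<times> real \<Rightarrow> (real^'n::finite) set"
    and A :: "(real^'d) \<times> real \<Rightarrow> real^'n" and R :: real and p0 :: "(real^'d) \<times> real"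
  assumes A: "orthogonal_transformation A" and R: "0 < R"
    and h: "0 < h" "4 * h \<le> \<delta>" "320 * h \<le> R" "real CARD('d) * (12 * h / \<delta>) \<le> 1 / 2"
    and X: "finite X" "dist_separated (2 * \<delta>) X" "\<And>i. i \<in> X \<Longrightarrow> norm i = R"
    and p0: "norm p0 = R" "\<And>i. i \<in> X \<Longrightarrow> \<delta> \<le> dist p0 i"
    and W: "\<And>i. i \<in> X \<Longrightarrow> unit_normal_code A i (W i)"
begin

definition codewords :: "((real^'d) \<times> real \<Rightarrow> real^'n) set" where "codewords = PiE X W"

definition codeword_map :: "((real^'d) \<times> real \<Rightarrow> real^'n) \<Rightarrow> (real^'d) \<times> real \<Rightarrow> real^'n" where
  "codeword_map v = bumped_sphere.embed h \<delta> X v A p0"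

definition codeword_surface :: "((real^'d) \<times> real \<Rightarrow> real^'n) \<Rightarrow> (real^'n) set" where
  "codeword_surface v = codeword_map v ` sphere 0 R"

lemma finite_codewords: "finite codewords"
  unfolding codewords_def using X(1) unit_normal_codeD(1)[OF W] by (intro finite_PiE)

lemma codeword_in_code: "v \<in> codewords \<Longrightarrow> i \<in> X \<Longrightarrow> v i \<in> W i"
  by (simp add: codewords_def PiE_mem)

lemma norm_codeword: "v \<in> codewords \<Longrightarrow> i \<in> X \<Longrightarrow> norm (v i) = 1"
  using unit_normal_codeD(2)[OF W codeword_in_code] by blast

lemma bumped_sphere_codeword:
  assumes "v \<in> codewords"
  shows "bumped_sphere h \<delta> X v A R p0"
proof
  show "norm (v i) \<le> 1" if "i \<in> X" for i
    using norm_codeword[OF assms that] by simp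
qed (use h X p0 A R in auto)

lemma codeword_surface_eq:
  assumes "v \<in> codewords"
  shows "codeword_surface v = bumped_sphere.surface h \<delta> X v A R p0"
proof -
  interpret bumped_sphere h \<delta> X v A R p0 by (rule bumped_sphere_codeword[OF assms])
  show ?thesis by (simp add: codeword_surface_def codeword_map_def surface_def)
qed

lemma codeword_map_diff:
  assumes v: "v \<in> codewords" "v' \<in> codewords" and i: "i \<in> X"
  shows "codeword_map v i - codeword_map v' z = A (i - z) + (h *\<^sub>R v i - bump_field h \<delta> X v' z)"
proof -
  interpret v: bumped_sphere h \<delta> X v A R p0 by (rule bumped_sphere_codeword[OF v(1)])
  interpret v': bumped_sphere h \<delta> X v' A R p0 by (rule bumped_sphere_codeword[OF v(2)])
  have "bump_field h \<delta> X v i = h *\<^sub>R v i" using v.bump_field_near_site[of i i] i v.\<delta> by simp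
  then show ?thesis
    by (simp add: codeword_map_def v.embed_def v'.embed_def linear_diff[OF v.linear_A])
qed

lemma bump_difference_normal:
  assumes v: "v \<in> codewords" "v' \<in> codewords" and i: "i \<in> X" "v i \<noteq> v' i" and z: "dist z i < \<delta>"
  defines "b \<equiv> h *\<^sub>R v i - bump_field h \<delta> X v' z"
  shows "13 / 20 * h \<le> norm b" "w \<bullet> i = 0 \<Longrightarrow> A w \<bullet> b = 0"
proof -
  interpret v': bumped_sphere h \<delta> X v' A R p0 by (rule bumped_sphere_codeword[OF v(2)])
  define \<beta> where "\<beta> = bump ((z - i) /\<^sub>R \<delta>)"
  have b: "b = h *\<^sub>R (v i - \<beta> *\<^sub>R v' i)"
    unfolding b_def \<beta>_def v'.bump_field_near_site[OF i(1) z] by (simp add: scaleR_diff_right)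
  note code = unit_normal_codeD[OF W[OF i(1)]] codeword_in_code[OF v(1) i(1)]
    codeword_in_code[OF v(2) i(1)]
  have "13 / 20 \<le> norm (v i - \<beta> *\<^sub>R v' i)"
    unfolding \<beta>_def by (intro unit_vectors_apart bump_range code i(2))
  then show "13 / 20 * h \<le> norm b" using h unfolding b by simp
  assume "w \<bullet> i = 0"
  then show "A w \<bullet> b = 0"
    using code(3) code(5,6) unfolding b by (simp add: inner_diff_right)
qed

lemma codeword_map_apart:
  assumes v: "v \<in> codewords" "v' \<in> codewords" and i: "i \<in> X" "v i \<noteq> v' i" and z: "norm z = R"
  shows "5 / 8 * h \<le> dist (codeword_map v' z) (codeword_map v i)"
proof -
  interpret v': bumped_sphere h \<delta> X v' A R p0 by (rule bumped_sphere_codeword[OF v(2)])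
  let ?b = "h *\<^sub>R v i - bump_field h \<delta> X v' z"
  have "5 / 8 * h \<le> norm (A (i - z) + ?b)"
  proof (cases "4 * h \<le> norm (i - z)")
    case True
    have "norm ?b \<le> h + 2 * h"
      using norm_triangle_ineq4[of "h *\<^sub>R v i" "bump_field h \<delta> X v' z"] v'.norm_bump_field_le[of z]
        norm_codeword[OF v(1) i(1)] h by simp
    then show ?thesis using norm_diff_ineq[of "A (i - z)" ?b] True h by simp
  next
    case False
    then have "dist z i < \<delta>" using h by (simp add: dist_norm norm_minus_commute)
    note normal = bump_difference_normal[OF v i this]
    have "norm ?b \<le> norm (A (i - z) + ?b) + (norm (i - z))\<^sup>2 / (2 * R)"
      by (rule normal_displacement_le[OF A R X(3)[OF i(1)] z normal(2)])
    moreover have "(norm (i - z))\<^sup>2 / (2 * R) \<le> h / 40"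
    proof -
      have "(norm (i - z))\<^sup>2 \<le> (4 * h)\<^sup>2" using False by (intro power_mono) auto
      also have "\<dots> = (320 * h) * h / 20" by (simp add: power2_eq_square)
      also have "\<dots> \<le> R * h / 20" using h by (intro divide_right_mono mult_right_mono) auto
      finally show ?thesis using R by (simp add: field_simps)
    qed
    ultimately show ?thesis using normal(1) by linarith
  qed
  then show ?thesis
    using codeword_map_diff[OF v i(1), of z]
    by (simp add: dist_norm norm_minus_commute[of "codeword_map v' z"])
qed

lemma codeword_surfaces_apart:
  assumes v: "v \<in> codewords" "v' \<in> codewords" "v \<noteq> v'" and \<epsilon>: "2 * \<epsilon> < 5 / 8 * h"
  shows "hausdorff_apart \<epsilon> (codeword_surface v) (codeword_surface v')"
proof -
  obtain i where i: "i \<in> X" "v i \<noteq> v' i" using v unfolding codewords_def by (metis PiE_ext)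
  show ?thesis
  proof (rule hausdorff_apartI[OF _ _ \<epsilon>])
    show "codeword_map v i \<in> codeword_surface v"
      using X(3)[OF i(1)] by (simp add: codeword_surface_def)
    show "5 / 8 * h \<le> dist y (codeword_map v i)" if "y \<in> codeword_surface v'" for y
      using that codeword_map_apart[OF v(1,2) i] by (auto simp: codeword_surface_def)
  qed
qed

lemma card_codewords_ge:
  assumes "0 \<le> c" "\<And>i. i \<in> X \<Longrightarrow> c \<le> real (card (W i))"
  shows "c ^ card X \<le> real (card codewords)"
proof -
  have "c ^ card X = (\<Prod>i\<in>X. c)" by simp
  also have "\<dots> \<le> (\<Prod>i\<in>X. real (card (W i)))" using assms by (intro prod_mono) auto
  finally show ?thesis unfolding codewords_def card_PiE[OF X(1)] by simp
qed

lemma uniform_distributions: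
  fixes fmin fmax L \<epsilon> r :: real
  assumes reach: "bump_reach_condition h \<delta> R r"
    and f: "0 < fmin" "fmin \<le> fmax / 4" and L: "0 \<le> L" and \<epsilon>: "0 \<le> \<epsilon>" "2 * \<epsilon> < 5 / 8 * h"
    and vol: "hausdorff_outer CARD('d) (sphere (0::(real^'d) \<times> real) R) = ennreal (1 / (2 * fmin))"
  obtains \<D> :: "(real^'n) measure set"
  where "finite \<D>" "\<D> \<subseteq> fixed_point_model TYPE('d) r fmin fmax L" "card \<D> = card codewords"
    "pairwise (\<lambda>D D'. hausdorff_apart \<epsilon> (support D) (support D')) \<D>"
proof -
  have "\<exists>D. D \<in> fixed_point_model TYPE('d) r fmin fmax L \<and> support D = codeword_surface v
      \<and> codeword_surface v \<noteq> {}"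
    if codeword: "v \<in> codewords" for v
  proof -
    interpret bumped_sphere h \<delta> X v A R p0 by (rule bumped_sphere_codeword[OF codeword])
    show ?thesis
      using uniform_distribution_in_model[OF reach f L vol] zero_in_surface
      unfolding codeword_surface_eq[OF codeword] by blast
  qed
  then obtain D where D: "\<And>v. v \<in> codewords \<Longrightarrow> D v \<in> fixed_point_model TYPE('d) r fmin fmax L"
    "\<And>v. v \<in> codewords \<Longrightarrow> support (D v) = codeword_surface v"
    "\<And>v. v \<in> codewords \<Longrightarrow> codeword_surface v \<noteq> {}"
    by metis
  have apart: "hausdorff_apart \<epsilon> (support (D v)) (support (D v'))"
    if "v \<in> codewords" "v' \<in> codewords" "v \<noteq> v'" for v v'
    using codeword_surfaces_apart[OF that \<epsilon>(2)] D(2) that by simp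
  have "inj_on D codewords"
    using apart not_hausdorff_apart_self[OF D(3) \<epsilon>(1)] D(2) by (intro inj_onI) metis
  then have "card (D ` codewords) = card codewords" by (rule card_image)
  moreover have "pairwise (\<lambda>D D'. hausdorff_apart \<epsilon> (support D) (support D')) (D ` codewords)"
    unfolding pairwise_def using apart by blast
  ultimately show ?thesis
    using that[of "D ` codewords"] finite_codewords D(1) by (simp add: image_subset_iff)
qed

end

section \<open>The packing\<close>

lemma hausdorff_outer_unit_sphere:
  "hausdorff_outer CARD('d) (sphere (0::(real^'d::finite) \<times> real) 1)
      = ennreal (sphere_volume TYPE('d))"
  and sphere_volume_pos: "0 < sphere_volume TYPE('d)"
proof -
  let ?S = "sphere (0::(real^'d) \<times> real) 1"
  have "emeasure (hausdorff_measure CARD('d)) ?S = hausdorff_outer CARD('d) ?S"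
    by (intro emeasure_hausdorff_measure) (auto intro: borel_closed)
  moreover obtain P :: "((real^'d) \<times> real) set" where
    "hausdorff_outer (DIM(real^'d)) ?S
        \<le> ennreal (real (card P) * (unit_ball_vol (DIM(real^'d)) * (9 / 4 * (1 / 20)) ^ DIM(real^'d)))"
    by (rule sphere_net[of "1/20" 1, where 'a="real^'d"]) auto
  then have "hausdorff_outer CARD('d) ?S < top" by (auto intro: le_less_trans)
  ultimately show eq: "hausdorff_outer CARD('d) ?S = ennreal (sphere_volume TYPE('d))"
    by (simp add: sphere_volume_def measure_def)
  have "0 < hausdorff_outer (DIM(real^'d)) (?S \<inter> ball (0, 1) 1)"
    using hausdorff_outer_cap_pos[of "(0::real^'d, 1)" 1] by (simp add: norm_Pair zero_prod_def)
  also have "\<dots> \<le> hausdorff_outer (DIM(real^'d)) ?S" by (intro hausdorff_outer_mono) auto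
  finally show "0 < sphere_volume TYPE('d)" by (simp add: eq)
qed

lemma sphere_of_volume:
  assumes f: "0 < f" and \<rho>: "0 < \<rho>"
    "2 ^ (CARD('d) + 1) * sphere_volume TYPE('d::finite) * f * \<rho> ^ CARD('d) \<le> 1"
  obtains R where "2 * \<rho> \<le> R"
    "hausdorff_outer CARD('d) (sphere (0::(real^'d) \<times> real) R) = ennreal (1 / (2 * f))"
proof -
  let ?\<sigma> = "sphere_volume TYPE('d)"
  define R where "R = root CARD('d) (1 / (2 * f * ?\<sigma>))"
  have Rd: "R ^ CARD('d) = 1 / (2 * f * ?\<sigma>)" and R: "0 < R"
    using sphere_volume_pos[where 'd='d] f
    by (auto simp: R_def real_root_pow_pos2 intro: real_root_gt_zero)
  have "(2 * \<rho>) ^ CARD('d) \<le> R ^ CARD('d)"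
    unfolding Rd using \<rho> sphere_volume_pos[where 'd='d] f
    by (simp add: power_mult_distrib field_simps)
  then have "2 * \<rho> \<le> R" by (subst (asm) power_mono_iff) (use R \<rho>(1) in auto)
  moreover have "hausdorff_outer CARD('d) (sphere (0::(real^'d) \<times> real) R) = ennreal (1 / (2 * f))"
  proof -
    have "sphere (0::(real^'d) \<times> real) R = (\<lambda>x. R *\<^sub>R x) ` sphere 0 1"
      using R by (simp add: sphere_scale)
    then have "hausdorff_outer CARD('d) (sphere (0::(real^'d) \<times> real) R)
        = ennreal (R ^ CARD('d)) * ennreal ?\<sigma>"
      by (simp add: hausdorff_outer_scaleR[OF R] hausdorff_outer_unit_sphere)
    then show ?thesis
      using sphere_volume_pos[where 'd='d] f by (simp add: Rd ennreal_mult'[symmetric])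
  qed
  ultimately show ?thesis by (rule that)
qed

text \<open>Here \<open>e = \<surd>(\<epsilon> / \<rho>)\<close>: the bumps have height \<open>4 e\<^sup>2 \<rho> = 4 \<epsilon>\<close> and radius \<open>10 e \<rho> = 10 \<surd>(\<epsilon> \<rho>)\<close>.\<close>
lemma bump_scale_bounds:
  fixes e \<rho> R :: real
  assumes e: "0 < e" "e \<le> 1 / 2 ^ 17" and \<rho>: "0 < \<rho>" "2 * \<rho> \<le> R"
  shows "2 * (10 * e * \<rho>) \<le> R / 20" "4 * (4 * e\<^sup>2 * \<rho>) \<le> 10 * e * \<rho>" "320 * (4 * e\<^sup>2 * \<rho>) \<le> R"
    "12 * (4 * e\<^sup>2 * \<rho>) / (10 * e * \<rho>) = 24 / 5 * e"
proof -
  have "e * \<rho> \<le> 1 / 400 * \<rho>" using e \<rho> by (intro mult_right_mono) auto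
  then show radius: "2 * (10 * e * \<rho>) \<le> R / 20" using \<rho> by linarith
  have "e * (e * \<rho>) \<le> 1 / 2 ^ 17 * (e * \<rho>)" using e \<rho> by (intro mult_right_mono) auto
  then have "e\<^sup>2 * \<rho> \<le> e * \<rho> / 131072" by (simp add: power2_eq_square)
  moreover have "0 < e * \<rho>" using e \<rho> by simp
  ultimately show "4 * (4 * e\<^sup>2 * \<rho>) \<le> 10 * e * \<rho>" "320 * (4 * e\<^sup>2 * \<rho>) \<le> R"
    using radius by linarith+
  show "12 * (4 * e\<^sup>2 * \<rho>) / (10 * e * \<rho>) = 24 / 5 * e"
    using e(1) \<rho>(1) by (simp add: power2_eq_square field_simps)
qed

lemma sphere_bump_code:
  assumes dim: "CARD('d::finite) < CARD('n::finite)" and \<rho>: "0 < \<rho>" "2 * \<rho> \<le> R"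
    and e: "0 < e" "e \<le> 1 / 2 ^ 17" "real CARD('d) * e \<le> 1 / 2 ^ 17"
  obtains X :: "((real^'d) \<times> real) set" and W :: "(real^'d) \<times> real \<Rightarrow> (real^'n) set" and A p0
  where "bump_code (4 * e\<^sup>2 * \<rho>) (10 * e * \<rho>) X W A R p0" "1 \<le> card X"
    "hausdorff_outer CARD('d) (sphere (0::(real^'d) \<times> real) R)
      \<le> ennreal (real (card X + 1) * (unit_ball_vol CARD('d) * (45 * e * \<rho>) ^ CARD('d)))"
    "\<forall>i\<in>X. exp (real (CARD('n) - CARD('d)) / 4) \<le> real (card (W i))"
proof -
  let ?d = "CARD('d)"
  define \<delta> where "\<delta> = 10 * e * \<rho>"
  have \<delta>: "0 < 2 * \<delta>" using e \<rho> by (simp add: \<delta>_def)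
  note scale = bump_scale_bounds[OF e(1,2) \<rho>, folded \<delta>_def]
  obtain P :: "((real^'d) \<times> real) set" where P: "finite P" "P \<subseteq> sphere 0 R"
    "dist_separated (2 * \<delta>) P" "2 \<le> card P"
    and vol: "hausdorff_outer (DIM(real^'d)) (sphere (0::(real^'d) \<times> real) R)
       \<le> ennreal (real (card P) * (unit_ball_vol (DIM(real^'d)) * (9 / 4 * (2 * \<delta>)) ^ DIM(real^'d)))"
    using sphere_net[OF \<delta> scale(1), where 'a="real^'d"] by blast
  then have "P \<noteq> {}" by auto
  then obtain p0 where p0: "p0 \<in> P" by blast
  define X where "X = P - {p0}"
  have card_P: "card P = card X + 1" using P(1,4) p0 by (simp add: X_def)
  have X: "norm i = R" "i \<noteq> 0" if "i \<in> X" for i using that P(2) \<rho> by (auto simp: X_def)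
  obtain A :: "(real^'d) \<times> real \<Rightarrow> real^'n" and W where A: "orthogonal_transformation A"
    and W: "\<forall>x. x \<noteq> 0 \<longrightarrow> unit_normal_code A x (W x)"
      "\<forall>x. x \<noteq> 0 \<longrightarrow> exp (real (DIM(real^'n) + 1 - DIM((real^'d) \<times> real)) / 4) \<le> real (card (W x))"
    by (rule normal_code_family[where 'a="(real^'d) \<times> real" and 'b="real^'n"]) (use dim in auto)
  have "bump_code (4 * e\<^sup>2 * \<rho>) \<delta> X W A R p0"
  proof
    show "real ?d * (12 * (4 * e\<^sup>2 * \<rho>) / \<delta>) \<le> 1 / 2" unfolding scale(4) using e(3) by simp
    show "dist_separated (2 * \<delta>) X"
      using P(3) by (auto simp: dist_separated_def X_def intro: pairwise_subset)
    show "\<delta> \<le> dist p0 i" if "i \<in> X" for i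
      using dist_separatedD[OF P(3) p0, of i] that \<delta> by (auto simp: X_def)
    show "norm p0 = R" "finite X" using P p0 by (auto simp: X_def)
    show "0 < R" "0 < 4 * e\<^sup>2 * \<rho>" using e \<rho> by auto
  qed (fact scale A X(1) W(1)[rule_format, OF X(2)])+
  moreover have "\<forall>i\<in>X. exp (real (CARD('n) - ?d) / 4) \<le> real (card (W i))"
    using W(2) X(2) by (simp del: split_paired_All)
  ultimately show ?thesis
    using that[of X W A p0] P(4) vol by (simp add: card_P \<delta>_def ac_simps)
qed

lemma bump_reach_condition_at_scale:
  assumes e: "0 < e" "e \<le> 1 / 2 ^ 17" and \<rho>: "0 < \<rho>" "2 * \<rho> \<le> R"
  shows "bump_reach_condition (4 * e\<^sup>2 * \<rho>) (10 * e * \<rho>) R \<rho>"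
proof -
  define h \<delta> where "h = 4 * e\<^sup>2 * \<rho>" and "\<delta> = 10 * e * \<rho>"
  have slope: "12 * h / \<delta> = 24 / 5 * e"
    unfolding h_def \<delta>_def by (rule bump_scale_bounds(4)[OF e \<rho>])
  have curvature: "6 * h / \<delta>\<^sup>2 = 6 / 25 / \<rho>"
    using e \<rho> by (simp add: h_def \<delta>_def power2_eq_square field_simps)
  have "(1 + 24 / 5 * e) / R \<le> (1 + 24 / 5 * e) / (2 * \<rho>)"
    using \<rho> e by (intro divide_left_mono) auto
  then have "\<rho> * ((1 + 24 / 5 * e) / R + 2 * (6 / 25 / \<rho>))
      \<le> \<rho> * ((1 + 24 / 5 * e) / (2 * \<rho>) + 2 * (6 / 25 / \<rho>))"
    using \<rho> by (intro mult_left_mono add_right_mono) auto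
  also have "\<dots> = (1 + 24 / 5 * e) / 2 + 12 / 25" using \<rho> by (simp add: field_simps)
  also have "\<dots> \<le> 1 - 2 * (24 / 5 * e)" using e by (simp add: field_simps)
  also have "\<dots> \<le> (1 - 24 / 5 * e)\<^sup>2" by (simp add: power2_eq_square algebra_simps)
  finally show ?thesis
    unfolding bump_reach_condition_def h_def[symmetric] \<delta>_def[symmetric]
      slope curvature using \<rho> by simp
qed

lemma power_32_ge: "1 \<le> d \<Longrightarrow> 16 * (1 + real d) \<le> 32 ^ d"
  by (induction d rule: dec_induct) auto

lemma packing_count:
  fixes k d N :: nat and \<omega> f \<rho> e :: real
  assumes d: "1 \<le> d" and k: "1 \<le> k" and N: "1 \<le> N" and pos: "0 < \<omega>" "0 < f" "0 < \<rho>" "0 < e"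
    and vol: "1 / (2 * f) \<le> real (N + 1) * (\<omega> * (45 * e * \<rho>) ^ d)"
  shows "real (k + d) / (\<omega> * f * \<rho> ^ d) * (1 / (1440 * e)) ^ d \<le> real N * (real k / 4)"
proof -
  define Z where "Z = 1 / (\<omega> * f * \<rho> ^ d) * (1 / (1440 * e)) ^ d"
  have Z: "0 < Z" using pos by (simp add: Z_def)
  have "1440 * e * \<rho> = 32 * (45 * e * \<rho>)" by simp
  then have "(1440 * e) ^ d * \<rho> ^ d = 32 ^ d * (45 * e * \<rho>) ^ d" by (metis power_mult_distrib)
  then have "Z = (1 / f) / (32 ^ d * (\<omega> * (45 * e * \<rho>) ^ d))"
    by (simp add: Z_def power_divide ac_simps)
  then have "32 ^ d * Z = 2 * ((1 / (2 * f)) / (\<omega> * (45 * e * \<rho>) ^ d))" by simp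
  also have "\<dots> \<le> 2 * real (N + 1)"
    using vol pos by (intro mult_left_mono, subst pos_divide_le_eq) auto
  finally have "32 ^ d * Z \<le> 4 * real N" using N by simp
  moreover have "16 * ((1 + real d) * Z) \<le> 32 ^ d * Z"
    unfolding mult.assoc[symmetric] using power_32_ge[OF d] Z by (intro mult_right_mono) auto
  ultimately have "(1 + real d) * Z \<le> real N / 4" by linarith
  then have "real k * ((1 + real d) * Z) \<le> real k * (real N / 4)" by (rule mult_left_mono) simp
  moreover have "real (k + d) * Z \<le> real k * (1 + real d) * Z"
  proof (rule mult_right_mono)
    have "1 * real d \<le> real k * real d" using k by (intro mult_right_mono) auto
    then show "real (k + d) \<le> real k * (1 + real d)" by (simp add: algebra_simps)
  qed (use Z in auto)
  moreover have "real (k + d) / (\<omega> * f * \<rho> ^ d) * (1 / (1440 * e)) ^ d = real (k + d) * Z"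
    by (simp add: Z_def)
  ultimately show ?thesis by (simp add: mult.assoc mult.commute[of "real N"])
qed

lemma resolution_powr_le:
  assumes "0 < e"
  shows "(1 / (2 ^ 21 * e\<^sup>2)) powr (real d / 2) \<le> (1 / (1440 * e)) ^ d"
proof -
  define c where "c = 1 / (1440 * e)"
  have c: "0 < c" using assms by (simp add: c_def)
  have "1 / (2 ^ 21 * e\<^sup>2) \<le> c\<^sup>2"
    using assms by (simp add: c_def power_divide power_mult_distrib divide_left_mono)
  then have "(1 / (2 ^ 21 * e\<^sup>2)) powr (real d / 2) \<le> (c\<^sup>2) powr (real d / 2)"
    by (intro powr_mono2) auto
  also have "\<dots> = (c powr 2) powr (real d / 2)" using c by simp
  also have "\<dots> = c powr real d" by (simp only: powr_powr) simp
  also have "\<dots> = c ^ d" by (rule powr_realpow[OF c])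
  finally show ?thesis unfolding c_def .
qed

lemma resolution_scale:
  fixes \<epsilon> \<rho> :: real
  assumes "0 < \<epsilon>" "0 < \<rho>" "1 \<le> d" "\<epsilon> \<le> \<rho> / (2 ^ 34 * real d ^ 2)"
  obtains e where "0 < e" "\<epsilon> = e\<^sup>2 * \<rho>" "e \<le> 1 / 2 ^ 17" "real d * e \<le> 1 / 2 ^ 17"
proof -
  define e where "e = sqrt (\<epsilon> / \<rho>)"
  have e: "0 < e" "\<epsilon> = e\<^sup>2 * \<rho>" using assms by (simp_all add: e_def)
  have "\<epsilon> / \<rho> \<le> (1 / (2 ^ 17 * real d))\<^sup>2"
    using assms(1-4) by (simp add: power_divide power_mult_distrib field_simps)
  then have "e \<le> 1 / (2 ^ 17 * real d)" unfolding e_def by (intro real_le_lsqrt) (use assms in auto)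
  then have de: "real d * e \<le> 1 / 2 ^ 17" using assms by (simp add: field_simps)
  moreover have "1 * e \<le> real d * e" using assms e(1) by (intro mult_right_mono) auto
  ultimately show ?thesis using that[OF e] by simp
qed

lemma fixed_point_model_packing:
  fixes \<rho> fmin fmax L \<epsilon> :: real
  assumes dim: "CARD('d::finite) < CARD('n::finite)"
    and pos: "0 < \<rho>" "0 < fmin" "fmin \<le> fmax / 4" "0 \<le> L" "0 < \<epsilon>"
    and small: "\<epsilon> \<le> \<rho> / (2 ^ 34 * real CARD('d) ^ 2)"
    and vol: "2 ^ (CARD('d) + 1) * sphere_volume TYPE('d) * fmin * \<rho> ^ CARD('d) \<le> 1"
  obtains \<D> :: "(real^'n) measure set"
  where "finite \<D>" "\<D> \<subseteq> fixed_point_model TYPE('d) \<rho> fmin fmax L"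
    "pairwise (\<lambda>D D'. hausdorff_apart \<epsilon> (support D) (support D')) \<D>"
    "exp (real CARD('n) / (ball_volume TYPE('d) * fmin * \<rho> ^ CARD('d))
       * (\<rho> / (2 ^ 21 * \<epsilon>)) powr (real CARD('d) / 2)) \<le> real (card \<D>)"
proof -
  let ?d = "CARD('d)" and ?k = "CARD('n) - CARD('d)" and ?\<omega> = "unit_ball_vol CARD('d)"
  have d: "1 \<le> ?d" by (simp add: Suc_le_eq)
  obtain R where radius: "2 * \<rho> \<le> R"
    and volR: "hausdorff_outer ?d (sphere (0::(real^'d) \<times> real) R) = ennreal (1 / (2 * fmin))"
    by (rule sphere_of_volume[OF pos(2,1) vol])
  obtain e where e: "0 < e" "\<epsilon> = e\<^sup>2 * \<rho>" "e \<le> 1 / 2 ^ 17" "real ?d * e \<le> 1 / 2 ^ 17"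
    by (rule resolution_scale[OF pos(5,1) d small])
  obtain X and W :: "(real^'d) \<times> real \<Rightarrow> (real^'n) set" and A p0
    where code: "bump_code (4 * e\<^sup>2 * \<rho>) (10 * e * \<rho>) X W A R p0"
      and sites: "1 \<le> card X" "ennreal (1 / (2 * fmin))
          \<le> ennreal (real (card X + 1) * (?\<omega> * (45 * e * \<rho>) ^ ?d))"
      and large: "\<forall>i\<in>X. exp (real ?k / 4) \<le> real (card (W i))"
    by (rule sphere_bump_code[OF dim pos(1) radius e(1,3,4), unfolded volR])
  interpret bump_code "4 * e\<^sup>2 * \<rho>" "10 * e * \<rho>" X W A R p0 by (rule code)
  have scale: "0 \<le> \<epsilon>" "2 * \<epsilon> < 5 / 8 * (4 * e\<^sup>2 * \<rho>)" using pos e by auto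
  obtain \<D> :: "(real^'n) measure set" where \<D>: "finite \<D>"
    "\<D> \<subseteq> fixed_point_model TYPE('d) \<rho> fmin fmax L" "card \<D> = card codewords"
    "pairwise (\<lambda>D D'. hausdorff_apart \<epsilon> (support D) (support D')) \<D>"
    by (rule uniform_distributions[OF bump_reach_condition_at_scale[OF e(1,3) pos(1) radius]
          pos(2-4) scale volR])
  have resolution: "\<rho> / (2 ^ 21 * \<epsilon>) = 1 / (2 ^ 21 * e\<^sup>2)" using pos e by (simp add: field_simps)
  have ball: "ball_volume TYPE('d) = ?\<omega>" by (simp add: ball_volume_def content_ball)
  let ?N = "real CARD('n) / (ball_volume TYPE('d) * fmin * \<rho> ^ ?d)
    * (\<rho> / (2 ^ 21 * \<epsilon>)) powr (real ?d / 2)"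
  have "?N \<le> real CARD('n) / (?\<omega> * fmin * \<rho> ^ ?d) * (1 / (1440 * e)) ^ ?d"
    unfolding resolution ball using pos by (intro mult_left_mono resolution_powr_le[OF e(1)]) auto
  also have "\<dots> \<le> real (card X) * (real ?k / 4)"
    using packing_count[OF d _ sites(1), of ?k ?\<omega> fmin \<rho> e] sites(2) pos e(1) dim
    by (simp add: ennreal_le_iff)
  finally have "exp ?N \<le> exp (real ?k / 4) ^ card X"
    by (simp flip: exp_of_nat_mult)
  also have "\<dots> \<le> real (card \<D>)" unfolding \<D>(3) using large by (intro card_codewords_ge) auto
  finally show ?thesis by (rule that[OF \<D>(1,2,4)])
qed

lemma exp_mult_le_power_imp:
  fixes N p s :: real
  assumes "0 < p" "0 < s" "exp N * p \<le> (1 + s) ^ q"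
  shows "(N + ln p) / ln (1 + s) \<le> real q"
proof -
  have "ln (exp N * p) \<le> ln ((1 + s) ^ q)" using assms by (intro ln_mono) auto
  then have "N + ln p \<le> real q * ln (1 + s)" using assms(1,2) by (simp add: ln_mult ln_realpow)
  moreover have "0 < ln (1 + s)" using assms(2) by simp
  ultimately show ?thesis by (simp add: pos_divide_le_eq)
qed

theorem theorem5p3:
  fixes rchmin fmin fmax L \<tau> \<alpha> \<epsilon> :: real
    and q :: nat
    and \<Omega> :: "'w measure"
    and Qs :: "'w \<Rightarrow> nat \<Rightarrow> real list \<Rightarrow> (real^'n::finite \<Rightarrow> real)"
    and Out :: "'w \<Rightarrow> real list \<Rightarrow> (real^'n) set"
  assumes "1 \<le> CARD('d::finite)" and "CARD('d) < CARD('n)"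
    and "rchmin > 0" and "0 < fmin" and "fmin \<le> fmax / 4" and "L \<ge> 0"
    and "\<tau> > 0" and "\<alpha> < 1"
    and "0 < \<epsilon>" and "\<epsilon> \<le> rchmin / (2 ^ 34 * real (CARD('d)) ^ 2)"
    and "2 ^ (CARD('d) + 1) * sphere_volume TYPE('d) * fmin * rchmin ^ CARD('d) \<le> 1"
    and "prob_space \<Omega>"
    and "\<forall>\<omega> i as. Qs \<omega> i as \<in> sq_queries"
    and "\<forall>D \<in> fixed_point_model TYPE('d) rchmin fmin fmax L. \<forall>orc. stat_oracle \<tau> D orc \<longrightarrow>
           (\<exists>E \<in> sets \<Omega>. measure \<Omega> E \<ge> 1 - \<alpha> \<and>
              (\<forall>\<omega>\<in>E. hausdorff_distance (support D) (Out \<omega> (snd (sq_run (Qs \<omega>) orc q))) \<le> ereal \<epsilon>))"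
  shows "real q \<ge>
    (real CARD('n) / (ball_volume TYPE('d) * fmin * rchmin ^ CARD('d))
       * (rchmin / (2 ^ 21 * \<epsilon>)) powr (real CARD('d) / 2) + ln (1 - \<alpha>))
    / ln (1 + 1 / \<tau>)"
proof (rule exp_mult_le_power_imp)
  let ?N = "real CARD('n) / (ball_volume TYPE('d) * fmin * rchmin ^ CARD('d))
    * (rchmin / (2 ^ 21 * \<epsilon>)) powr (real CARD('d) / 2)"
  obtain \<D> :: "(real^'n) measure set" where finite: "finite \<D>"
    and model: "\<D> \<subseteq> fixed_point_model TYPE('d) rchmin fmin fmax L"
    and apart: "pairwise (\<lambda>D D'. hausdorff_apart \<epsilon> (support D) (support D')) \<D>"
    and card: "exp ?N \<le> real (card \<D>)"
    by (rule fixed_point_model_packing[OF assms(2-6,9-11)])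
  have "exp ?N * (1 - \<alpha>) \<le> real (card \<D>) * (1 - \<alpha>)"
    using card assms(8) by (intro mult_right_mono) auto
  also have "\<dots> \<le> (1 + 1 / \<tau>) ^ q"
  proof (rule sq_packing_bound[where Qs=Qs and Out=Out, OF assms(7,12) finite _ _ apart])
    show "prob_space D" "sets D = sets borel" if "D \<in> \<D>" for D
      using that model by (auto simp: fixed_point_model_def)
  qed (use assms(14) model in blast)
  finally show "exp ?N * (1 - \<alpha>) \<le> (1 + 1 / \<tau>) ^ q" .
qed (use assms(7,8) in auto)

end
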